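(* Let $G$ be a real linear reductive algebraic group, let $\tau:G\longrightarrow \mathrm{GL}(V)$ be a rational representation of $G$ on a finite-dimensional real vector space $V$, and let $w\in V\smallsetminus\{0\}$ be a nice element. The orbit $G\cdot w$ is distinguished if and only if $$\operatorname{mcc}(\mathfrak{R}(w))\in \operatorname{int}(\operatorname{CH}(\mathfrak{R}(w))).$$ Moreover, in such case, there exists $X\in\mathfrak a$ such that $\exp(X)\cdot w$ is a critical point of $F_{\mathfrak g}$.
   Context: $G$ is regarded as a real reductive Lie group: a closed subgroup of a complex reductive group $\widehat G=U^{\mathbb C}$ (the universal complexification of a compact Lie group $U$ with Lie algebra $\mathfrak u$) such that $K\times\mathfrak p\to G$, $(k,X)\mapsto k\exp(X)$, is a diffeomorphism, where $K=G\cap U$, $\mathfrak p=\mathfrak g\cap\sqrt{-1}\,\mathfrak u$, $\mathfrak g=\operatorname{Lie}(G)$, $\mathfrak k=\operatorname{Lie}(K)$. Put $\pi=d\tau|_e:\mathfrak g\to\mathfrak{gl}(V)$. Fix an inner product $\langle\cdot,\cdot\rangle$ on $V$ for which $K$ acts by isometries and $\pi(\mathfrak p)$ by symmetric operators, and an inner product $\langle\!\langle\cdot,\cdot\rangle\!\rangle$ on $\mathfrak g$ for which $\operatorname{Ad}(K)$ acts by isometries, $\operatorname{ad}(\mathfrak p)$ by symmetric operators, and $\mathfrak k\perp\mathfrak p$. Fix a subalgebra $\mathfrak a$ of $\mathfrak g$ maximal among those contained in $\mathfrak p$ (it is abelian), and let $A=\exp(\mathfrak a)$. Weights: $\Delta(V)\subset\mathfrak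 a$ is the finite set of $\alpha$ with $V_\alpha=\{v\in V:\pi(X)v=\langle\!\langle X,\alpha\rangle\!\rangle v\ \forall X\in\mathfrak a\}\neq 0$, and $V=\bigoplus_{\alpha\in\Delta(V)}V_\alpha$ orthogonally. For $v\in V\smallsetminus\{0\}$, written $v=\sum_\alpha v_\alpha$ with $v_\alpha\in V_\alpha$, set $\mathfrak R(v)=\{\alpha\in\Delta(V):v_\alpha\ne0\}$. For a finite set $\Phi\subset\mathfrak a$, $\operatorname{CH}(\Phi)$ is its convex hull, $\operatorname{mcc}(\Phi)$ is the unique vector of $\operatorname{CH}(\Phi)$ closest to the origin, and $\operatorname{int}(\operatorname{CH}(\Phi))$ is the interior of $\operatorname{CH}(\Phi)$ relative to the affine hull of $\Phi$. Moment map: $m_{\mathfrak g}:V\smallsetminus\{0\}\to\mathfrak p\subseteq\mathfrak g$ is defined by $\langle\!\langle m_{\mathfrak g}(v),X\rangle\!\rangle=\frac{1}{\|v\|^2}\langle\pi(X)v,v\rangle$ for all $X\in\mathfrak p$; $F_{\mathfrak g}=\|m_{\mathfrak g}\|^2$. An orbit $G\cdot v$ is distinguished if it contains a critical point of $F_{\mathfrak g}:V\smallsetminus\{0\}\to\mathbb R$. A vector subspace $W\subseteq V$ is a nice space if it is $A$-invariant and $m_{\mathfrak g}(w)\in\mathfrak a$ for every $w\in W\smallsetminus\{0\}$; the elements of a nice space are called nice elements. *)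

theory Defs
  imports "HOL-Analysis.Analysis"
begin

type_synonym 'n cmat = "complex^'n^'n"

(* In HOL-Analysis the type class multiplication and power act componentwise on vectors, so the
   library function exp is not the matrix exponential. *)
definition mexp :: "'n::finite cmat \<Rightarrow> 'n cmat" where
  "mexp X = (\<Sum>k. (1 / fact k) *\<^sub>R (((**) X) ^^ k) (mat 1))"

definition bracket :: "'n::finite cmat \<Rightarrow> 'n cmat \<Rightarrow> 'n cmat" where
  "bracket X Y = X ** Y - Y ** X"

definition matrix_group :: "'n::finite cmat set \<Rightarrow> bool" where
  "matrix_group G \<longleftrightarrow>
     mat 1 \<in> G \<and> (\<forall>g\<in>G. invertible g \<and> matrix_inv g \<in> G) \<and> (\<forall>g\<in>G. \<forall>h\<in>G. g ** h \<in> G)"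

definition lie :: "'n::finite cmat set \<Rightarrow> 'n cmat set" where
  "lie G = {X. \<forall>t::real. mexp (t *\<^sub>R X) \<in> G}"

text \<open>In finite dimension, a map on an open set is \<open>C\<^sup>k\<^sup>+\<^sup>1\<close> iff it is differentiable and all its
  directional derivatives are \<open>C\<^sup>k\<close>.\<close>

primrec Ck_on :: "nat \<Rightarrow> ('a::euclidean_space \<Rightarrow> 'b::euclidean_space) \<Rightarrow> 'a set \<Rightarrow> bool" where
  "Ck_on 0 f S \<longleftrightarrow> continuous_on S f"
| "Ck_on (Suc k) f S \<longleftrightarrow>
     f differentiable_on S \<and> (\<forall>v. Ck_on k (\<lambda>x. frechet_derivative f (at x) v) S)"

text \<open>Smooth maps and diffeomorphisms between arbitrary subsets, in terms of local smooth extensions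
  to the ambient space. On embedded submanifolds these are the intrinsic notions.\<close>

definition smooth_map_on :: "'a::euclidean_space set \<Rightarrow> ('a \<Rightarrow> 'b::euclidean_space) \<Rightarrow> bool" where
  "smooth_map_on S f \<longleftrightarrow>
     (\<forall>x\<in>S. \<exists>N h. open N \<and> x \<in> N \<and> (\<forall>k. Ck_on k h N) \<and> (\<forall>y\<in>N \<inter> S. h y = f y))"

definition diffeomorphism_between ::
  "('a::euclidean_space \<Rightarrow> 'b::euclidean_space) \<Rightarrow> 'a set \<Rightarrow> 'b set \<Rightarrow> bool" where
  "diffeomorphism_between f S T \<longleftrightarrow>
     bij_betw f S T \<and> smooth_map_on S f \<and> smooth_map_on T (inv_into S f)"

text \<open>The universal complexification of a compact subgroup \<open>U\<close> of the complex general linear group,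
  realised as the subgroup \<open>U exp(i \<uu>)\<close>.\<close>

definition complexification :: "'n::finite cmat set \<Rightarrow> 'n cmat set" where
  "complexification U = {u ** mexp (mat \<i> ** X) | u X. u \<in> U \<and> X \<in> lie U}"

definition kgroup :: "'n::finite cmat set \<Rightarrow> 'n cmat set \<Rightarrow> 'n cmat set" where
  "kgroup U G = G \<inter> U"

definition pspace :: "'n::finite cmat set \<Rightarrow> 'n cmat set \<Rightarrow> 'n cmat set" where
  "pspace U G = lie G \<inter> (\<lambda>X. mat \<i> ** X) ` lie U"

definition real_reductive :: "'n::finite cmat set \<Rightarrow> 'n cmat set \<Rightarrow> bool" where
  "real_reductive U G \<longleftrightarrow>
     matrix_group U \<and> compact U \<and> matrix_group G \<and>
     closedin (top_of_set (complexification U)) G \<and>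
     diffeomorphism_between (\<lambda>(k, X). k ** mexp X) (kgroup U G \<times> pspace U G) G"

text \<open>Polynomials are real polynomials in the real and imaginary parts of the matrix entries, so this
  is Zariski closedness in the complex general linear group regarded as a real algebraic group; it
  includes the real algebraic subgroups of the real general linear group.\<close>

definition real_algebraic :: "'n::finite cmat set \<Rightarrow> bool" where
  "real_algebraic G \<longleftrightarrow>
     (\<exists>P. (\<forall>p\<in>P. real_polynomial_function p) \<and> G = {g. invertible g \<and> (\<forall>p\<in>P. p g = 0)})"

definition representation ::
  "'n::finite cmat set \<Rightarrow> ('n cmat \<Rightarrow> 'v::euclidean_space \<Rightarrow> 'v) \<Rightarrow> bool" where
  "representation G \<tau> \<longleftrightarrow>
     (\<forall>g\<in>G. linear (\<tau> g)) \<and> \<tau> (mat 1) = id \<and> (\<forall>g\<in>G. \<forall>h\<in>G. \<tau> (g ** h) = \<tau> g \<circ> \<tau> h)"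

text \<open>Matrix coefficients are regular functions, i.e. polynomials in the entries of \<open>g\<close> and
  in \<open>1 / det g\<close>.\<close>

definition rational_representation ::
  "'n::finite cmat set \<Rightarrow> ('n cmat \<Rightarrow> 'v::euclidean_space \<Rightarrow> 'v) \<Rightarrow> bool" where
  "rational_representation G \<tau> \<longleftrightarrow>
     representation G \<tau> \<and>
     (\<forall>x y. \<exists>q :: 'n cmat \<times> complex \<Rightarrow> real.
        real_polynomial_function q \<and> (\<forall>g\<in>G. \<tau> g x \<bullet> y = q (g, 1 / det g)))"

definition drep :: "('n::finite cmat \<Rightarrow> 'v::euclidean_space \<Rightarrow> 'v) \<Rightarrow> 'n cmat \<Rightarrow> 'v \<Rightarrow> 'v" where
  "drep \<tau> X v = vector_derivative (\<lambda>t. \<tau> (mexp (t *\<^sub>R X)) v) (at 0)"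

definition inner_product_on :: "'a::real_vector set \<Rightarrow> ('a \<Rightarrow> 'a \<Rightarrow> real) \<Rightarrow> bool" where
  "inner_product_on S ip \<longleftrightarrow>
     (\<forall>X\<in>S. \<forall>Y\<in>S. ip X Y = ip Y X) \<and>
     (\<forall>X\<in>S. \<forall>Y\<in>S. \<forall>Z\<in>S. ip (X + Y) Z = ip X Z + ip Y Z) \<and>
     (\<forall>c. \<forall>X\<in>S. \<forall>Y\<in>S. ip (c *\<^sub>R X) Y = c * ip X Y) \<and>
     (\<forall>X\<in>S. X \<noteq> 0 \<longrightarrow> ip X X > 0)"

text \<open>The inner product on \<open>V\<close> is that of the type class.\<close>

definition compatible_inner_on_V ::
  "'n::finite cmat set \<Rightarrow> 'n cmat set \<Rightarrow> ('n cmat \<Rightarrow> 'v::euclidean_space \<Rightarrow> 'v) \<Rightarrow> bool" where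
  "compatible_inner_on_V U G \<tau> \<longleftrightarrow>
     (\<forall>k\<in>kgroup U G. \<forall>v w. \<tau> k v \<bullet> \<tau> k w = v \<bullet> w) \<and>
     (\<forall>X\<in>pspace U G. \<forall>v w. drep \<tau> X v \<bullet> w = v \<bullet> drep \<tau> X w)"

definition compatible_inner_on_lie ::
  "'n::finite cmat set \<Rightarrow> 'n cmat set \<Rightarrow> ('n cmat \<Rightarrow> 'n cmat \<Rightarrow> real) \<Rightarrow> bool" where
  "compatible_inner_on_lie U G ip \<longleftrightarrow>
     inner_product_on (lie G) ip \<and>
     (\<forall>k\<in>kgroup U G. \<forall>X\<in>lie G. \<forall>Y\<in>lie G.
        ip (k ** X ** matrix_inv k) (k ** Y ** matrix_inv k) = ip X Y) \<and>
     (\<forall>Z\<in>pspace U G. \<forall>X\<in>lie G. \<forall>Y\<in>lie G. ip (bracket Z X) Y = ip X (bracket Z Y)) \<and>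
     (\<forall>X\<in>lie (kgroup U G). \<forall>Y\<in>pspace U G. ip X Y = 0)"

definition lie_subalgebra :: "'n::finite cmat set \<Rightarrow> 'n cmat set \<Rightarrow> bool" where
  "lie_subalgebra \<aa> \<gg> \<longleftrightarrow> \<aa> \<subseteq> \<gg> \<and> subspace \<aa> \<and> (\<forall>X\<in>\<aa>. \<forall>Y\<in>\<aa>. bracket X Y \<in> \<aa>)"

definition maximal_subalgebra_in_p ::
  "'n::finite cmat set \<Rightarrow> 'n cmat set \<Rightarrow> 'n cmat set \<Rightarrow> bool" where
  "maximal_subalgebra_in_p U G \<aa> \<longleftrightarrow>
     lie_subalgebra \<aa> (lie G) \<and> \<aa> \<subseteq> pspace U G \<and>
     (\<forall>\<bb>. lie_subalgebra \<bb> (lie G) \<and> \<bb> \<subseteq> pspace U G \<and> \<aa> \<subseteq> \<bb> \<longrightarrow> \<bb> = \<aa>)"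

definition weight_space ::
  "('n::finite cmat \<Rightarrow> 'v::euclidean_space \<Rightarrow> 'v) \<Rightarrow> ('n cmat \<Rightarrow> 'n cmat \<Rightarrow> real) \<Rightarrow> 'n cmat set \<Rightarrow>
   'n cmat \<Rightarrow> 'v set" where
  "weight_space \<tau> ip \<aa> \<alpha> = {v. \<forall>X\<in>\<aa>. drep \<tau> X v = ip X \<alpha> *\<^sub>R v}"

definition weights ::
  "('n::finite cmat \<Rightarrow> 'v::euclidean_space \<Rightarrow> 'v) \<Rightarrow> ('n cmat \<Rightarrow> 'n cmat \<Rightarrow> real) \<Rightarrow> 'n cmat set \<Rightarrow>
   'n cmat set" where
  "weights \<tau> ip \<aa> = {\<alpha>\<in>\<aa>. weight_space \<tau> ip \<aa> \<alpha> \<noteq> {0}}"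

text \<open>The components \<open>v\<^sub>\<alpha>\<close> of \<open>v\<close>, as a function of \<open>\<alpha>\<close> extended by 0 outside the weights.\<close>

definition weight_components ::
  "('n::finite cmat \<Rightarrow> 'v::euclidean_space \<Rightarrow> 'v) \<Rightarrow> ('n cmat \<Rightarrow> 'n cmat \<Rightarrow> real) \<Rightarrow> 'n cmat set \<Rightarrow>
   'v \<Rightarrow> 'n cmat \<Rightarrow> 'v" where
  "weight_components \<tau> ip \<aa> v =
     (THE c. (\<forall>\<alpha>\<in>weights \<tau> ip \<aa>. c \<alpha> \<in> weight_space \<tau> ip \<aa> \<alpha>) \<and>
             (\<forall>\<alpha>. \<alpha> \<notin> weights \<tau> ip \<aa> \<longrightarrow> c \<alpha> = 0) \<and>
             v = (\<Sum>\<alpha>\<in>weights \<tau> ip \<aa>. c \<alpha>))"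

definition weight_support ::
  "('n::finite cmat \<Rightarrow> 'v::euclidean_space \<Rightarrow> 'v) \<Rightarrow> ('n cmat \<Rightarrow> 'n cmat \<Rightarrow> real) \<Rightarrow> 'n cmat set \<Rightarrow>
   'v \<Rightarrow> 'n cmat set" where
  "weight_support \<tau> ip \<aa> v = {\<alpha>\<in>weights \<tau> ip \<aa>. weight_components \<tau> ip \<aa> v \<alpha> \<noteq> 0}"

text \<open>Closeness to the origin is measured by \<open>ip\<close>, not by the norm of the type class.\<close>

definition mcc :: "('a::real_vector \<Rightarrow> 'a \<Rightarrow> real) \<Rightarrow> 'a set \<Rightarrow> 'a" where
  "mcc ip \<Phi> = (THE \<beta>. is_arg_min (\<lambda>\<gamma>. sqrt (ip \<gamma> \<gamma>)) (\<lambda>\<gamma>. \<gamma> \<in> convex hull \<Phi>) \<beta>)"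

definition moment_map ::
  "'n::finite cmat set \<Rightarrow> 'n cmat set \<Rightarrow> ('n cmat \<Rightarrow> 'v::euclidean_space \<Rightarrow> 'v) \<Rightarrow>
   ('n cmat \<Rightarrow> 'n cmat \<Rightarrow> real) \<Rightarrow> 'v \<Rightarrow> 'n cmat" where
  "moment_map U G \<tau> ip v =
     (THE Y. Y \<in> pspace U G \<and> (\<forall>X\<in>pspace U G. ip Y X = 1 / (norm v)\<^sup>2 * (drep \<tau> X v \<bullet> v)))"

definition moment_norm_sq ::
  "'n::finite cmat set \<Rightarrow> 'n cmat set \<Rightarrow> ('n cmat \<Rightarrow> 'v::euclidean_space \<Rightarrow> 'v) \<Rightarrow>
   ('n cmat \<Rightarrow> 'n cmat \<Rightarrow> real) \<Rightarrow> 'v \<Rightarrow> real" where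
  "moment_norm_sq U G \<tau> ip v = ip (moment_map U G \<tau> ip v) (moment_map U G \<tau> ip v)"

definition critical_point :: "('v::real_normed_vector \<Rightarrow> real) \<Rightarrow> 'v \<Rightarrow> bool" where
  "critical_point F v \<longleftrightarrow> v \<noteq> 0 \<and> (F has_derivative (\<lambda>_. 0)) (at v)"

definition distinguished_orbit ::
  "'n::finite cmat set \<Rightarrow> 'n cmat set \<Rightarrow> ('n cmat \<Rightarrow> 'v::euclidean_space \<Rightarrow> 'v) \<Rightarrow>
   ('n cmat \<Rightarrow> 'n cmat \<Rightarrow> real) \<Rightarrow> 'v set \<Rightarrow> bool" where
  "distinguished_orbit U G \<tau> ip Orb \<longleftrightarrow> (\<exists>x\<in>Orb. critical_point (moment_norm_sq U G \<tau> ip) x)"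

definition nice_space ::
  "'n::finite cmat set \<Rightarrow> 'n cmat set \<Rightarrow> ('n cmat \<Rightarrow> 'v::euclidean_space \<Rightarrow> 'v) \<Rightarrow>
   ('n cmat \<Rightarrow> 'n cmat \<Rightarrow> real) \<Rightarrow> 'n cmat set \<Rightarrow> 'v set \<Rightarrow> bool" where
  "nice_space U G \<tau> ip \<aa> W \<longleftrightarrow>
     subspace W \<and> (\<forall>a\<in>mexp ` \<aa>. \<tau> a ` W \<subseteq> W) \<and> (\<forall>w\<in>W - {0}. moment_map U G \<tau> ip w \<in> \<aa>)"

definition nice_element ::
  "'n::finite cmat set \<Rightarrow> 'n cmat set \<Rightarrow> ('n cmat \<Rightarrow> 'v::euclidean_space \<Rightarrow> 'v) \<Rightarrow>
   ('n cmat \<Rightarrow> 'n cmat \<Rightarrow> real) \<Rightarrow> 'n cmat set \<Rightarrow> 'v \<Rightarrow> bool" where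
  "nice_element U G \<tau> ip \<aa> w \<longleftrightarrow> (\<exists>W. nice_space U G \<tau> ip \<aa> W \<and> w \<in> W)"

end

theory Submission
  imports Defs
begin

text \<open>
  Write \<open>\<pi>\<close> for the infinitesimal representation, \<open>m\<close> for the moment map, \<open>F = \<parallel>m\<parallel>\<^sup>2\<close>, and
  \<open>\<beta>\<close> for the minimal convex combination of the weights of \<open>w\<close>. A nonzero vector \<open>v\<close> is critical for \<open>F\<close>
  iff \<open>\<pi>(m(v)) v = F(v) v\<close> (\<open>critical_iff\<close>).

  If \<open>\<beta>\<close> is a relatively interior point of the convex hull, some \<open>X \<in> \<aa>\<close> solves
  \<open>m(exp(X) w) = \<beta>\<close>: on the orbit of a nice vector under \<open>exp \<aa>\<close>, the value of \<open>m\<close> is a barycentre of the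
  weights with exponential coefficients, and every relatively interior point is such a barycentre
  (\<open>exponential_barycentre\<close>, \<open>moment_attains\<close>). As \<open>\<beta>\<close> is both interior and closest to the origin, all weights
  of \<open>w\<close> have the same product with \<open>\<beta>\<close>, so \<open>\<pi>(\<beta>)\<close> is the scalar \<open>\<parallel>\<beta>\<parallel>\<^sup>2\<close> on \<open>exp(X) w\<close>, which is
  therefore critical.

  Conversely let \<open>g w\<close> be critical and put \<open>\<gamma> = m(g w)\<close>. To \<open>X \<in> \<pp>\<close> belongs the parabolic subgroup
  \<open>P\<^sub>X\<close> of all \<open>p\<close> for which \<open>exp(-tX) p exp(tX)\<close> converges as \<open>t\<close> tends to infinity, and \<open>G = K P\<^sub>X\<close>
  (\<open>parabolic_decomposition\<close>). An element of \<open>P\<^sub>X\<close> does not change the exponential rate at which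
  \<open>exp(-tX)\<close> shrinks a vector, and a rate \<open>c\<close> at \<open>x\<close> forces \<open>\<langle>\<pi>(X) x, x\<rangle> \<ge> c \<langle>x, x\<rangle>\<close>
  (\<open>decay_bound\<close>). With \<open>X = \<gamma>\<close> this shows that \<open>\<parallel>\<gamma>\<parallel>\<close> is the minimum of \<open>\<parallel>m\<parallel>\<close> on the orbit, whence
  \<open>\<parallel>\<gamma>\<parallel> \<le> \<parallel>\<beta>\<parallel>\<close>. Suppose that \<open>\<beta>\<close> lies on the relative boundary. A small shift of \<open>\<beta>\<close> along a supporting
  direction gives \<open>\<beta>' \<in> \<aa>\<close> with \<open>\<langle>\<beta>', \<beta>\<rangle> = \<parallel>\<beta>\<parallel>\<^sup>2\<close> whose product with all weights of \<open>w\<close> is at least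
  \<open>\<parallel>\<beta>\<parallel>\<^sup>2\<close>, with strict inequality for one of them, and \<open>P\<^sub>\<beta>\<^sub>' \<subseteq> P\<^sub>\<beta>\<close>. Write \<open>g = k p\<close> with \<open>k \<in> K\<close> and
  \<open>p \<in> P\<^sub>\<beta>\<^sub>'\<close>, and \<open>x = p w\<close>. The rate for \<open>\<beta>\<close> together with \<open>\<parallel>m(x)\<parallel> \<le> \<parallel>\<beta>\<parallel>\<close> gives \<open>m(x) = \<beta>\<close>; then the rate for
  \<open>\<beta>'\<close> is an equality, and so \<open>\<pi>(\<beta>') x = \<parallel>\<beta>\<parallel>\<^sup>2 x\<close>.

  Niceness enters once more. Let \<open>u\<close> be the limit of the rescaled vectors \<open>exp(-t\<beta>') w\<close>, that is, the
  component of \<open>w\<close> in the eigenspace of \<open>\<pi>(\<beta>')\<close> for \<open>\<parallel>\<beta>\<parallel>\<^sup>2\<close>. Since \<open>x\<close> lies in this eigenspace, \<open>u\<close> and \<open>w\<close>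
  differ by a group element that is contracted to the identity by \<open>exp(-t\<beta>')\<close>. Its lowest root component \<open>E\<close> maps \<open>u\<close>
  into the nice space, whereas \<open>\<langle>\<pi>(E) y, y\<rangle> = 0\<close> for all its elements \<open>y\<close>; this yields
  \<open>\<pi>(E) u = 0\<close>, and removing \<open>E\<close> and repeating shows \<open>u = w\<close> (\<open>unipotent_rigidity\<close>). So all weights of \<open>w\<close> have
  product \<open>\<parallel>\<beta>\<parallel>\<^sup>2\<close> with \<open>\<beta>'\<close>, a contradiction.
\<close>

section \<open>Joint diagonalisation of symmetric operators\<close>

text \<open>
  At a maximiser \<open>x\<close> of the Rayleigh quotient, with value \<open>c\<close>, the form \<open>c B(u, v) - B(L u, v)\<close> is positive
  semidefinite on \<open>W\<close> and vanishes at \<open>(x, x)\<close>, so \<open>x\<close> is in its kernel. Definiteness is asked on \<open>W\<close> only: an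
  inner product given on a subspace will be extended to the whole space by a degenerate form.
\<close>

lemma form_eigenvector:
  fixes B :: "'a::euclidean_space \<Rightarrow> 'a \<Rightarrow> real"
  assumes B: "bilinear B" and sym: "\<And>x y. B x y = B y x"
    and W: "subspace W" and pos: "\<And>x. x \<in> W \<Longrightarrow> x \<noteq> 0 \<Longrightarrow> 0 < B x x"
    and L: "linear L" and LW: "\<And>x. x \<in> W \<Longrightarrow> L x \<in> W"
    and Lsym: "\<And>x y. x \<in> W \<Longrightarrow> y \<in> W \<Longrightarrow> B (L x) y = B x (L y)"
    and ne: "\<exists>x\<in>W. x \<noteq> 0"
  shows "\<exists>x\<in>W. x \<noteq> 0 \<and> (\<exists>c. L x = c *\<^sub>R x)"
proof -
  interpret bb: bounded_bilinear B using B bilinear_conv_bounded_bilinear by blast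
  have contL: "continuous_on S L" for S by (rule linear_continuous_on) (simp add: L linear_conv_bounded_linear[symmetric])
  let ?S = "W \<inter> sphere 0 1"
  have cS: "compact ?S" by (meson W closed_Int_compact closed_subspace compact_sphere)
  obtain x0 where x0: "x0 \<in> W" "x0 \<noteq> 0" using ne by blast
  then have "(1 / norm x0) *\<^sub>R x0 \<in> ?S" using W by (simp add: subspace_scale)
  then have neS: "?S \<noteq> {}" by blast
  have posS: "x \<in> ?S \<Longrightarrow> 0 < B x x" for x by (rule pos) auto
  have "continuous_on ?S (\<lambda>x. B (L x) x / B x x)"
    by (intro continuous_intros bb.continuous_on contL) (use posS in \<open>force simp: less_le\<close>)+
  then obtain x where x: "x \<in> ?S" and max: "\<And>y. y \<in> ?S \<Longrightarrow> B (L y) y / B y y \<le> B (L x) x / B x x"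
    using continuous_attains_sup[OF cS neS] by blast
  define c where "c = B (L x) x / B x x"
  define Q where "Q u v = c * B u v - B (L u) v" for u v
  interpret L: linear L by (rule L)
  have Qadd: "Q (u + s *\<^sub>R v) (u + s *\<^sub>R v) = Q u u + 2 * s * Q u v + s\<^sup>2 * Q v v" if "u \<in> W" "v \<in> W" for u v s
  proof -
    have "B (L v) u = B (L u) v" using Lsym[OF that] sym by metis
    then show ?thesis unfolding Q_def
      by (simp add: L.add L.scaleR bb.add_left bb.add_right bb.scaleR_left bb.scaleR_right sym[of v u] algebra_simps power2_eq_square)
  qed
  have Qpos: "0 \<le> Q y y" if "y \<in> W" for y
  proof (cases "y = 0")
    case True then show ?thesis by (simp add: Q_def bb.zero_left L.zero)
  next
    case False
    let ?y = "(1 / norm y) *\<^sub>R y"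
    have y: "?y \<in> ?S" using False that W by (simp add: subspace_scale)
    from max[OF y] posS[OF y] have "B (L ?y) ?y \<le> c * B ?y ?y" by (simp add: c_def field_simps)
    then have "(1 / norm y)\<^sup>2 * B (L y) y \<le> (1 / norm y)\<^sup>2 * (c * B y y)"
      by (simp add: L.scaleR bb.scaleR_left bb.scaleR_right power2_eq_square mult_ac)
    then show ?thesis using False by (simp add: Q_def)
  qed
  have xW: "x \<in> W" "x \<noteq> 0" using x by auto
  have Qx: "Q x x = 0" using posS[OF x] by (simp add: Q_def c_def)
  have Q0: "Q x y = 0" if y: "y \<in> W" for y
  proof (rule ccontr)
    assume n: "Q x y \<noteq> 0"
    have q: "0 \<le> 2 * s * Q x y + s\<^sup>2 * Q y y" for s
      using Qpos[of "x + s *\<^sub>R y"] Qadd[OF xW(1) y, of s] Qx W xW y by (simp add: subspace_add subspace_scale)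
    \<comment> \<open>a small step against the sign of \<open>Q x y\<close> makes \<open>Q\<close> negative, since its linear term wins\<close>
    define s where "s = - Q x y / (1 + Q y y)"
    have p: "0 < 1 + Q y y" using Qpos[OF y] by simp
    have "2 * s * Q x y + s\<^sup>2 * Q y y < 0"
    proof -
      have e: "s * (1 + Q y y) = - Q x y" using p by (simp add: s_def)
      have "2 * s * Q x y + s\<^sup>2 * Q y y = s * Q x y + s * (Q x y + s * (1 + Q y y)) - s\<^sup>2"
        by (simp add: algebra_simps power2_eq_square)
      also have "\<dots> = s * Q x y - s\<^sup>2" using e by simp
      also have "s * Q x y = - (Q x y)\<^sup>2 / (1 + Q y y)" by (simp add: s_def power2_eq_square)
      finally have "2 * s * Q x y + s\<^sup>2 * Q y y = - ((Q x y)\<^sup>2 / (1 + Q y y)) - s\<^sup>2" by simp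
      moreover have "0 < (Q x y)\<^sup>2 / (1 + Q y y)" using p n by simp
      ultimately show ?thesis by (smt (verit) zero_le_power2)
    qed
    then show False using q[of s] by simp
  qed
  let ?d = "c *\<^sub>R x - L x"
  have d: "?d \<in> W" using W LW xW by (simp add: subspace_diff subspace_scale)
  have "B ?d ?d = Q x ?d" by (simp add: Q_def bb.diff_left bb.scaleR_left)
  then have "?d = 0" using Q0[OF d] pos[OF d] by force
  then have "L x = c *\<^sub>R x" by simp
  then show ?thesis using xW by blast
qed

text \<open>
  An operator of the family that is not scalar on \<open>W\<close> has a proper eigenspace, which the other operators
  preserve; descend to it.
\<close>

lemma form_joint_eigenvector:
  fixes B :: "'a::euclidean_space \<Rightarrow> 'a \<Rightarrow> real" and F :: "'i \<Rightarrow> 'a \<Rightarrow> 'a"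
  assumes B: "bilinear B" and sym: "\<And>x y. B x y = B y x"
    and L: "\<And>i. i \<in> I \<Longrightarrow> linear (F i)"
    and comm: "\<And>i j x. i \<in> I \<Longrightarrow> j \<in> I \<Longrightarrow> F i (F j x) = F j (F i x)"
    and W: "subspace W" and pos: "\<And>x. x \<in> W \<Longrightarrow> x \<noteq> 0 \<Longrightarrow> 0 < B x x"
    and LW: "\<And>i x. i \<in> I \<Longrightarrow> x \<in> W \<Longrightarrow> F i x \<in> W"
    and Lsym: "\<And>i x y. i \<in> I \<Longrightarrow> x \<in> W \<Longrightarrow> y \<in> W \<Longrightarrow> B (F i x) y = B x (F i y)"
    and ne: "\<exists>x\<in>W. x \<noteq> 0"
  shows "\<exists>x\<in>W. x \<noteq> 0 \<and> (\<forall>i\<in>I. \<exists>c. F i x = c *\<^sub>R x)"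
  using W pos LW Lsym ne
proof (induction "dim W" arbitrary: W rule: less_induct)
  case less
  show ?case
  proof (cases "\<forall>i\<in>I. \<exists>c. \<forall>x\<in>W. F i x = c *\<^sub>R x")
    case True
    then show ?thesis using less.prems(5) by blast
  next
    case False
    then obtain i where i: "i \<in> I" and ns: "\<And>c. \<exists>x\<in>W. F i x \<noteq> c *\<^sub>R x" by blast
    have "\<exists>x\<in>W. x \<noteq> 0 \<and> (\<exists>c. F i x = c *\<^sub>R x)"
      by (rule form_eigenvector[where B = B]) (use B sym L less.prems i in auto)
    then obtain x c where x: "x \<in> W" "x \<noteq> 0" "F i x = c *\<^sub>R x" by blast
    interpret Fi: linear "F i" by (rule L[OF i])
    define W' where "W' = {y \<in> W. F i y = c *\<^sub>R y}"
    have sW': "subspace W'" using less.prems(1) unfolding W'_def subspace_def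
      by (auto simp: Fi.add Fi.scaleR Fi.zero algebra_simps)
    have sub: "W' \<subseteq> W" by (auto simp: W'_def)
    have "W' \<noteq> W" using ns[of c] by (auto simp: W'_def)
    then have dl: "dim W' < dim W"
      using subspace_dim_equal[OF sW' less.prems(1) sub] by linarith
    have inv: "F j y \<in> W'" if "j \<in> I" "y \<in> W'" for j y
    proof -
      interpret Fj: linear "F j" by (rule L[OF that(1)])
      show ?thesis using that less.prems(3)[OF that(1)] comm[OF i that(1), of y] by (auto simp: W'_def Fj.scaleR)
    qed
    have "\<exists>x\<in>W'. x \<noteq> 0 \<and> (\<forall>i\<in>I. \<exists>c. F i x = c *\<^sub>R x)"
    proof (rule less.hyps[OF dl sW'])
      show "0 < B y y" if "y \<in> W'" "y \<noteq> 0" for y using less.prems(2) that sub by blast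
      show "F j y \<in> W'" if "j \<in> I" "y \<in> W'" for j y by (rule inv[OF that])
      show "B (F j y) z = B y (F j z)" if "j \<in> I" "y \<in> W'" "z \<in> W'" for j y z
        using less.prems(4) that sub by blast
      show "\<exists>x\<in>W'. x \<noteq> 0" using x by (auto simp: W'_def)
    qed
    then show ?thesis using sub by blast
  qed
qed

text \<open>
  The orthogonal complement of a joint eigenvector is invariant by symmetry. For an empty family this is
  the existence of an orthogonal basis.
\<close>

lemma form_joint_eigenbasis:
  fixes B :: "'a::euclidean_space \<Rightarrow> 'a \<Rightarrow> real" and F :: "'i \<Rightarrow> 'a \<Rightarrow> 'a"
  assumes B: "bilinear B" and sym: "\<And>x y. B x y = B y x"
    and L: "\<And>i. i \<in> I \<Longrightarrow> linear (F i)"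
    and comm: "\<And>i j x. i \<in> I \<Longrightarrow> j \<in> I \<Longrightarrow> F i (F j x) = F j (F i x)"
    and W: "subspace W" and pos: "\<And>x. x \<in> W \<Longrightarrow> x \<noteq> 0 \<Longrightarrow> 0 < B x x"
    and LW: "\<And>i x. i \<in> I \<Longrightarrow> x \<in> W \<Longrightarrow> F i x \<in> W"
    and Lsym: "\<And>i x y. i \<in> I \<Longrightarrow> x \<in> W \<Longrightarrow> y \<in> W \<Longrightarrow> B (F i x) y = B x (F i y)"
  shows "\<exists>D. finite D \<and> D \<subseteq> W \<and> 0 \<notin> D \<and> span D = W
           \<and> (\<forall>x\<in>D. \<forall>y\<in>D. x \<noteq> y \<longrightarrow> B x y = 0)
           \<and> (\<forall>x\<in>D. \<forall>i\<in>I. \<exists>c. F i x = c *\<^sub>R x)"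
  using W pos LW Lsym
proof (induction "dim W" arbitrary: W rule: less_induct)
  case less
  interpret bb: bounded_bilinear B using B bilinear_conv_bounded_bilinear by blast
  show ?case
  proof (cases "\<exists>x\<in>W. x \<noteq> 0")
    case False
    then have "W = {0}" using less.prems(1) subspace_0 by blast
    then show ?thesis by (intro exI[of _ "{}"]) auto
  next
    case True
    have "\<exists>x\<in>W. x \<noteq> 0 \<and> (\<forall>i\<in>I. \<exists>c. F i x = c *\<^sub>R x)"
      by (rule form_joint_eigenvector[where B = B]) (use B sym L comm less.prems True in auto)
    then obtain x where x: "x \<in> W" "x \<noteq> 0" "\<And>i. i \<in> I \<Longrightarrow> \<exists>c. F i x = c *\<^sub>R x" by blast
    define W' where "W' = {y \<in> W. B x y = 0}"
    have sW': "subspace W'" using less.prems(1) unfolding W'_def subspace_def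
      by (auto simp: bb.add_right bb.scaleR_right bb.zero_right)
    have sub: "W' \<subseteq> W" by (auto simp: W'_def)
    have Bx: "0 < B x x" using less.prems(2) x by blast
    then have "x \<notin> W'" by (simp add: W'_def)
    then have "W' \<noteq> W" using x(1) by blast
    then have dl: "dim W' < dim W"
      using subspace_dim_equal[OF sW' less.prems(1) sub] by linarith
    have inv: "F j y \<in> W'" if "j \<in> I" "y \<in> W'" for j y
    proof -
      obtain c where "F j x = c *\<^sub>R x" using x(3) \<open>j \<in> I\<close> by blast
      then have "B x (F j y) = c * B x y" using less.prems(4)[OF that(1) x(1), of y] that
        by (simp add: W'_def bb.scaleR_left)
      then show ?thesis using that less.prems(3)[OF that(1)] by (auto simp: W'_def)
    qed
    have "\<exists>D. finite D \<and> D \<subseteq> W' \<and> 0 \<notin> D \<and> span D = W'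
           \<and> (\<forall>x\<in>D. \<forall>y\<in>D. x \<noteq> y \<longrightarrow> B x y = 0)
           \<and> (\<forall>x\<in>D. \<forall>i\<in>I. \<exists>c. F i x = c *\<^sub>R x)"
    proof (rule less.hyps[OF dl sW'])
      show "0 < B y y" if "y \<in> W'" "y \<noteq> 0" for y using less.prems(2) that sub by blast
      show "F j y \<in> W'" if "j \<in> I" "y \<in> W'" for j y by (rule inv[OF that])
      show "B (F j y) z = B y (F j z)" if "j \<in> I" "y \<in> W'" "z \<in> W'" for j y z
        using less.prems(4) that sub by blast
    qed
    then obtain D where D: "finite D" "D \<subseteq> W'" "0 \<notin> D" "span D = W'"
        and D5: "\<forall>x\<in>D. \<forall>y\<in>D. x \<noteq> y \<longrightarrow> B x y = 0"
        and D6: "\<forall>x\<in>D. \<forall>i\<in>I. \<exists>c. F i x = c *\<^sub>R x" by metis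
    have orth: "B x y = 0" "B y x = 0" if "y \<in> D" for y
    proof -
      show "B x y = 0" using that D(2) by (auto simp: W'_def)
      then show "B y x = 0" using sym by metis
    qed
    have "span (insert x D) = W"
    proof
      show "span (insert x D) \<subseteq> W" using x(1) D(2) sub less.prems(1) by (intro span_minimal) auto
      show "W \<subseteq> span (insert x D)"
      proof
        fix y assume y: "y \<in> W"
        have "y - (B x y / B x x) *\<^sub>R x \<in> W'"
          using y x(1) less.prems(1) Bx
          by (simp add: W'_def subspace_diff subspace_scale bb.diff_right bb.scaleR_right)
        then show "y \<in> span (insert x D)" using D(4) span_breakdown_eq by blast
      qed
    qed
    moreover have "insert x D \<subseteq> W \<and> 0 \<notin> insert x D \<and> finite (insert x D)" using D(1-3) x(1,2) sub by auto
    moreover have "\<forall>y\<in>insert x D. \<forall>z\<in>insert x D. y \<noteq> z \<longrightarrow> B y z = 0"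
      using D5 orth by simp
    moreover have "\<forall>y\<in>insert x D. \<forall>i\<in>I. \<exists>c. F i y = c *\<^sub>R y"
      using D6 x(3) by simp
    ultimately show ?thesis by metis
  qed
qed

lemma orthogonal_expansion:
  fixes B :: "'a::euclidean_space \<Rightarrow> 'a \<Rightarrow> real"
  assumes B: "bilinear B" and D: "finite D" "\<And>x y. x \<in> D \<Longrightarrow> y \<in> D \<Longrightarrow> x \<noteq> y \<Longrightarrow> B x y = 0"
    and pos: "\<And>x. x \<in> D \<Longrightarrow> 0 < B x x" and v: "v \<in> span D"
  shows "v = (\<Sum>x\<in>D. (B v x / B x x) *\<^sub>R x)"
proof -
  interpret bb: bounded_bilinear B using B bilinear_conv_bounded_bilinear by blast
  obtain c where c: "v = (\<Sum>x\<in>D. c x *\<^sub>R x)" using v span_finite[OF D(1)] by auto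
  have "B v y = c y * B y y" if "y \<in> D" for y
  proof -
    have "B v y = (\<Sum>x\<in>D. c x * B x y)" by (simp add: c bb.sum_left bb.scaleR_left)
    also have "\<dots> = (\<Sum>x\<in>D. if x = y then c y * B y y else 0)" using D(2) that by (intro sum.cong) auto
    finally show ?thesis using D(1) that by simp
  qed
  then show ?thesis using pos by (subst c, intro sum.cong) (auto simp: less_le)
qed

section \<open>The matrix exponential\<close>

lemma bounded_bilinear_matrix_mult: "bounded_bilinear ((**) :: 'n::finite cmat \<Rightarrow> 'n cmat \<Rightarrow> 'n cmat)"
proof -
  have "bilinear ((**) :: 'n cmat \<Rightarrow> 'n cmat \<Rightarrow> 'n cmat)"
    unfolding bilinear_def
    by (intro conjI allI linearI)
       (auto simp: vec_eq_iff matrix_matrix_mult_def sum.distrib scaleR_sum_right algebra_simps)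
  then show ?thesis using bilinear_conv_bounded_bilinear by blast
qed

interpretation mm: bounded_bilinear "(**) :: 'n::finite cmat \<Rightarrow> 'n cmat \<Rightarrow> 'n cmat"
  by (rule bounded_bilinear_matrix_mult)

abbreviation mpow :: "'n::finite cmat \<Rightarrow> nat \<Rightarrow> 'n cmat" where
  "mpow X k \<equiv> (((**) X) ^^ k) (mat 1)"

lemma mpow_intertwine:
  assumes "X ** A = A ** Y"
  shows "mpow X k ** A = A ** mpow Y k"
proof (induction k)
  case (Suc k)
  have "mpow X (Suc k) ** A = X ** (A ** mpow Y k)" by (simp add: Suc matrix_mul_assoc[symmetric])
  also have "\<dots> = A ** mpow Y (Suc k)" by (simp add: assms matrix_mul_assoc)
  finally show ?case .
qed simp

lemma mpow_scaleR: "mpow (t *\<^sub>R X) k = t ^ k *\<^sub>R mpow X k"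
  by (induction k) (simp_all add: mm.scaleR_left mm.scaleR_right mult.commute)

lemma norm_matrix_mult_le: "norm (A ** B) \<le> norm A * norm (B :: 'n::finite cmat)"
proof -
  have row: "norm ((A ** B) $ i) \<le> norm (A $ i) * norm B" for i
  proof -
    have sc: "norm (\<chi> j. c * v $ j) = norm c * norm v" for c and v :: "complex^'n"
      unfolding norm_vec_def by (subst L2_set_right_distrib) (simp_all add: norm_mult)
    have "(A ** B) $ i = (\<Sum>k\<in>UNIV. \<chi> j. A $ i $ k * B $ k $ j)"
      by (simp add: vec_eq_iff matrix_matrix_mult_def)
    then have "norm ((A ** B) $ i) \<le> (\<Sum>k\<in>UNIV. norm (\<chi> j. A $ i $ k * B $ k $ j))"
      by (simp only: norm_sum)
    also have "\<dots> = (\<Sum>k\<in>UNIV. norm (A $ i $ k) * norm (B $ k))" by (simp add: sc)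
    also have "\<dots> \<le> L2_set (\<lambda>k. norm (A $ i $ k)) UNIV * L2_set (\<lambda>k. norm (B $ k)) UNIV"
      using L2_set_mult_ineq[of "\<lambda>k. norm (A $ i $ k)" "\<lambda>k. norm (B $ k)" UNIV] by simp
    also have "\<dots> = norm (A $ i) * norm B" by (simp only: norm_vec_def[of B] norm_vec_def[of "A $ i"])
    finally show ?thesis .
  qed
  have "norm (A ** B) \<le> L2_set (\<lambda>i. norm (A $ i) * norm B) UNIV"
    unfolding norm_vec_def[of "A ** B"] by (rule L2_set_mono) (use row in auto)
  also have "\<dots> = norm A * norm B" unfolding norm_vec_def[of A] by (rule L2_set_left_distrib[symmetric]) simp
  finally show ?thesis .
qed

lemma norm_mpow_bound:
  "norm (mpow (X :: 'n::finite cmat) k) \<le> (norm X) ^ k * norm (mat 1 :: 'n cmat)"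
proof (induction k)
  case (Suc k)
  have "norm (mpow X (Suc k)) \<le> norm X * norm (mpow X k)" using norm_matrix_mult_le[of X "mpow X k"] by simp
  also have "\<dots> \<le> norm X * ((norm X) ^ k * norm (mat 1 :: 'n cmat))"
    using Suc by (intro mult_left_mono) auto
  finally show ?case by (simp add: mult_ac)
qed simp

lemma summable_mexp: "summable (\<lambda>k. norm ((1 / fact k) *\<^sub>R mpow (X :: 'n::finite cmat) k))"
proof -
  have s: "summable (\<lambda>k. norm (mat 1 :: 'n cmat) * (inverse (fact k) * (norm X) ^ k))"
    by (intro summable_mult summable_exp)
  show ?thesis
  proof (rule summable_comparison_test'[OF s, of 0])
    fix k :: nat
    have "norm (mpow X k) / fact k \<le> (norm X) ^ k * norm (mat 1 :: 'n cmat) / fact k"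
      by (intro divide_right_mono norm_mpow_bound) auto
    then show "norm (norm ((1 / fact k) *\<^sub>R mpow X k))
        \<le> norm (mat 1 :: 'n cmat) * (inverse (fact k) * (norm X) ^ k)"
      by (simp add: field_simps)
  qed
qed

lemma mexp_sums: "(\<lambda>k. (1 / fact k) *\<^sub>R mpow X k) sums mexp X"
  unfolding mexp_def by (rule summable_sums[OF summable_norm_cancel[OF summable_mexp]])

lemma mexp_0 [simp]: "mexp 0 = mat 1"
proof -
  have "(\<lambda>k. (1 / fact k) *\<^sub>R mpow 0 k) sums (\<Sum>k\<in>{0}. (1 / fact k) *\<^sub>R mpow (0 :: 'a cmat) k)"
    by (rule sums_finite) (auto simp: gr0_conv_Suc mm.zero_left)
  then show ?thesis using mexp_sums[of "0 :: 'a cmat"] sums_unique2 by fastforce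
qed

text \<open>
  Each real coordinate of \<open>t \<mapsto> mexp (t X)\<close> is an everywhere convergent power series in \<open>t\<close>, which may be
  differentiated term by term.
\<close>

lemma mexp_has_vector_derivative:
  "((\<lambda>t. mexp (t *\<^sub>R X)) has_vector_derivative X ** mexp (t *\<^sub>R X)) (at t within S)"
proof -
  have "((\<lambda>t. mexp (t *\<^sub>R X) \<bullet> b) has_derivative (\<lambda>h. (h *\<^sub>R (X ** mexp (t *\<^sub>R X))) \<bullet> b)) (at t)" for b
  proof -
    define c where "c k = (mpow X k \<bullet> b) / fact k" for k
    have ser: "(\<lambda>k. c k * y ^ k) sums (mexp (y *\<^sub>R X) \<bullet> b)" for y
    proof -
      have "(\<lambda>k. ((1 / fact k) *\<^sub>R mpow (y *\<^sub>R X) k) \<bullet> b) sums (mexp (y *\<^sub>R X) \<bullet> b)"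
        by (rule bounded_linear.sums[OF bounded_linear_inner_left mexp_sums])
      then show ?thesis by (simp add: c_def mpow_scaleR mult.commute)
    qed
    have "(\<lambda>k. (X ** ((1 / fact k) *\<^sub>R mpow (t *\<^sub>R X) k)) \<bullet> b) sums ((X ** mexp (t *\<^sub>R X)) \<bullet> b)"
      by (intro bounded_linear.sums[OF bounded_linear_inner_left] bounded_linear.sums[OF mm.bounded_linear_right] mexp_sums)
    moreover have "(X ** ((1 / fact k) *\<^sub>R mpow (t *\<^sub>R X) k)) \<bullet> b = diffs c k * t ^ k" for k
    proof -
      have "fact (Suc k) = (1 + real k) * fact k" by simp
      then show ?thesis by (simp add: diffs_def c_def mpow_scaleR mm.scaleR_right)
    qed
    ultimately have d: "(\<lambda>k. diffs c k * t ^ k) sums ((X ** mexp (t *\<^sub>R X)) \<bullet> b)" by simp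
    have "((\<lambda>x. \<Sum>n. c n * x^n) has_field_derivative (\<Sum>n. diffs c n * t^n)) (at t)"
      by (rule termdiffs_strong_converges_everywhere) (use ser sums_summable in blast)
    then have "((\<lambda>x. mexp (x *\<^sub>R X) \<bullet> b) has_field_derivative (X ** mexp (t *\<^sub>R X)) \<bullet> b) (at t)"
      using ser d by (simp add: sums_iff)
    then show ?thesis
      unfolding has_field_derivative_def by (rule has_derivative_eq_rhs) (simp add: fun_eq_iff)
  qed
  then have "((\<lambda>t. mexp (t *\<^sub>R X)) has_derivative (\<lambda>h. h *\<^sub>R (X ** mexp (t *\<^sub>R X)))) (at t within S)"
    by (subst has_derivative_componentwise_within) (blast intro: has_derivative_at_withinI)
  then show ?thesis by (simp add: has_vector_derivative_def)
qed

lemma mexp_intertwine: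
  fixes X A Y :: "'n::finite cmat"
  assumes "X ** A = A ** Y"
  shows "mexp X ** A = A ** mexp Y"
proof -
  have "(\<lambda>k. ((1 / fact k) *\<^sub>R mpow X k) ** A) sums (mexp X ** A)"
    by (intro bounded_linear.sums[OF mm.bounded_linear_left] mexp_sums)
  moreover have "(\<lambda>k. A ** ((1 / fact k) *\<^sub>R mpow Y k)) sums (A ** mexp Y)"
    by (intro bounded_linear.sums[OF mm.bounded_linear_right] mexp_sums)
  ultimately show ?thesis
    by (simp add: mm.scaleR_left mm.scaleR_right mpow_intertwine[OF assms] sums_unique2)
qed

lemma zero_derivative_constant:
  fixes f :: "real \<Rightarrow> 'a::real_normed_vector"
  assumes "\<And>t. (f has_vector_derivative 0) (at t)"
  shows "f t = f s"
  using has_vector_derivative_zero_constant[of UNIV f] assms by (metis UNIV_I convex_UNIV)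

lemma mexp_minus_has_vector_derivative:
  "((\<lambda>t. mexp ((-t) *\<^sub>R X)) has_vector_derivative - (X ** mexp ((-t) *\<^sub>R X))) (at t)"
  using vector_diff_chain_at[of uminus "-1" t "\<lambda>t. mexp (t *\<^sub>R X)" "X ** mexp ((-t) *\<^sub>R X)"]
    mexp_has_vector_derivative[of X "-t" UNIV]
  by (simp add: o_def has_vector_derivative_minus)

text \<open>
  The product of \<open>mexp (t(X + Y))\<close>, \<open>mexp (- t X)\<close> and \<open>mexp (- t Y)\<close> has derivative zero.
\<close>

lemma mexp_add_inverse:
  fixes X Y :: "'n::finite cmat"
  assumes c: "X ** Y = Y ** X"
  shows "mexp (X + Y) ** mexp (- X) ** mexp (- Y) = mat 1"
proof -
  define E P Q where "E t = mexp (t *\<^sub>R (X + Y))" and "P t = mexp ((-t) *\<^sub>R X)" and "Q t = mexp ((-t) *\<^sub>R Y)" for t :: real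
  have "((\<lambda>t. E t ** P t ** Q t) has_vector_derivative 0) (at t)" for t
  proof -
    have EXY: "E t ** Z = Z ** E t" if "Z = X \<or> Z = Y" for Z
      unfolding E_def using that c
      by (intro mexp_intertwine) (auto simp: mm.scaleR_left mm.scaleR_right mm.add_left mm.add_right)
    have PY: "P t ** Y = Y ** P t"
      unfolding P_def by (intro mexp_intertwine) (simp only: mm.scaleR_left mm.scaleR_right c)
    have "((\<lambda>t. E t ** P t ** Q t) has_vector_derivative (E t ** P t) ** (- (Y ** Q t))
        + (E t ** (- (X ** P t)) + ((X + Y) ** E t) ** P t) ** Q t) (at t)"
      unfolding E_def P_def Q_def
      by (intro mm.has_vector_derivative mexp_has_vector_derivative mexp_minus_has_vector_derivative)
    moreover have "E t ** P t ** Y ** Q t = Y ** E t ** P t ** Q t"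
      by (simp add: EXY[symmetric] PY matrix_mul_assoc[symmetric])
    ultimately show ?thesis
      by (simp add: mm.minus_right mm.minus_left mm.add_left EXY matrix_mul_assoc)
  qed
  from zero_derivative_constant[OF this, of 1 0] show ?thesis by (simp add: E_def P_def Q_def)
qed

lemma mexp_minus: "mexp X ** mexp (- X) = mat 1" "mexp (- X) ** mexp X = mat 1"
  using mexp_add_inverse[of X 0] mexp_add_inverse[of "- X" 0] by (simp_all add: mm.zero_left mm.zero_right)

lemma mexp_add:
  fixes X Y :: "'n::finite cmat"
  assumes "X ** Y = Y ** X"
  shows "mexp (X + Y) = mexp X ** mexp Y"
proof -
  have c: "mexp Y ** mexp X = mexp X ** mexp Y"
    using assms by (intro mexp_intertwine) (metis mexp_intertwine)
  have "mexp (X + Y) = mexp (X + Y) ** (mexp (- X) ** (mexp (- Y) ** mexp Y) ** mexp X)" by (simp add: mexp_minus)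
  also have "\<dots> = (mexp (X + Y) ** mexp (- X) ** mexp (- Y)) ** (mexp Y ** mexp X)" by (simp add: matrix_mul_assoc)
  finally show ?thesis by (simp add: mexp_add_inverse[OF assms] c)
qed

lemma mexp_add_scaleR: "mexp ((s + t) *\<^sub>R X) = mexp (s *\<^sub>R X) ** mexp (t *\<^sub>R X)"
  by (simp add: scaleR_add_left mexp_add mm.scaleR_left mm.scaleR_right mult.commute)

lemma mexp_scalar: "mexp (c *\<^sub>R mat 1) = exp c *\<^sub>R (mat 1 :: 'n::finite cmat)"
proof -
  have "mpow (c *\<^sub>R mat 1) k = c ^ k *\<^sub>R (mat 1 :: 'n cmat)" for k
    by (induction k) (simp_all add: mm.scaleR_left)
  moreover have "(\<lambda>k. (inverse (fact k) * c ^ k) *\<^sub>R (mat 1 :: 'n cmat)) sums (exp c *\<^sub>R mat 1)"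
    using exp_converges[of c] by (intro bounded_linear.sums[OF bounded_linear_scaleR_left]) simp
  ultimately show ?thesis
    using mexp_sums[of "c *\<^sub>R (mat 1 :: 'n cmat)"] by (simp add: inverse_eq_divide sums_unique2)
qed

text \<open>
  The hypothesis says \<open>X E = E (X + c)\<close>, and the scalar \<open>c\<close> exponentiates separately.
\<close>

lemma mexp_bracket_eigen:
  fixes X E :: "'n::finite cmat"
  assumes "bracket X E = c *\<^sub>R E"
  shows "mexp (t *\<^sub>R X) ** E = exp (t * c) *\<^sub>R (E ** mexp (t *\<^sub>R X))"
proof -
  have XE: "X ** E = c *\<^sub>R E + E ** X" using assms by (simp add: bracket_def algebra_simps)
  have "mexp (t *\<^sub>R X) ** E = E ** mexp (t *\<^sub>R X + (t * c) *\<^sub>R mat 1)"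
    by (rule mexp_intertwine) (simp add: mm.scaleR_left mm.scaleR_right mm.add_right XE scaleR_add_right)
  also have "\<dots> = E ** (mexp (t *\<^sub>R X) ** mexp ((t * c) *\<^sub>R mat 1))"
    by (subst mexp_add) (simp_all add: mm.scaleR_left mm.scaleR_right)
  finally show ?thesis by (simp add: mexp_scalar mm.scaleR_right)
qed

lemma mpow_mexp: "mpow (mexp (t *\<^sub>R X)) k = mexp ((real k * t) *\<^sub>R X)"
proof (induction k)
  case (Suc k)
  have "mpow (mexp (t *\<^sub>R X)) (Suc k) = mexp (t *\<^sub>R X) ** mexp ((real k * t) *\<^sub>R X)" using Suc by simp
  also have "\<dots> = mexp ((t + real k * t) *\<^sub>R X)" by (rule mexp_add_scaleR[symmetric])
  finally show ?case by (simp add: algebra_simps)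
qed simp

section \<open>Lie algebras of closed matrix groups\<close>

lemma mexp_quadratic_bound:
  "\<exists>C>0. \<forall>X :: 'n::finite cmat. norm X \<le> 1 \<longrightarrow> norm (mexp X - mat 1 - X) \<le> C * (norm X)\<^sup>2"
proof -
  let ?N = "norm (mat 1 :: 'n cmat)"
  have b: "norm (mexp X - mat 1 - X) \<le> (?N * exp 1) * (norm X)\<^sup>2" if X: "norm X \<le> 1" for X :: "'n cmat"
  proof -
    have s: "summable (\<lambda>k. norm ((1 / fact (k + 2)) *\<^sub>R mpow X (k + 2)))"
      by (rule iffD2[OF summable_iff_shift[of "\<lambda>k. norm ((1 / fact k) *\<^sub>R mpow X k)" 2] summable_mexp])
    have "(\<lambda>k. (1 / fact (k + 2)) *\<^sub>R mpow X (k + 2)) sums (mexp X - (\<Sum>k<2. (1 / fact k) *\<^sub>R mpow X k))"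
      by (rule sums_split_initial_segment[OF mexp_sums])
    then have e: "mexp X - mat 1 - X = (\<Sum>k. (1 / fact (k + 2)) *\<^sub>R mpow X (k + 2))"
      by (simp add: sums_iff eval_nat_numeral algebra_simps)
    have "norm (mexp X - mat 1 - X) \<le> (\<Sum>k. norm ((1 / fact (k + 2)) *\<^sub>R mpow X (k + 2)))"
      unfolding e by (rule summable_norm[OF s])
    also have "\<dots> \<le> (\<Sum>k. (?N * (norm X)\<^sup>2) * (inverse (fact k)))"
    proof (rule suminf_le[OF _ s])
      show "summable (\<lambda>k. (?N * (norm X)\<^sup>2) * (inverse (fact k)))"
        using summable_exp[of "1 :: real"] by (intro summable_mult) simp
      fix k
      have "norm (mpow X (k + 2)) \<le> (norm X) ^ (k + 2) * ?N" by (rule norm_mpow_bound)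
      also have "\<dots> = (?N) * ((norm X)\<^sup>2 * norm X ^ k)"
        by (simp add: power_mult_distrib power_add eval_nat_numeral mult_ac)
      also have "\<dots> \<le> (?N) * ((norm X)\<^sup>2 * 1)"
        using X by (intro mult_left_mono power_le_one) auto
      finally have n: "norm (mpow X (k + 2)) \<le> ?N * (norm X)\<^sup>2" by (simp add: mult_ac)
      have "norm ((1 / fact (k + 2)) *\<^sub>R mpow X (k + 2)) = norm (mpow X (k + 2)) / fact (k + 2)" by simp
      also have "\<dots> \<le> (?N * (norm X)\<^sup>2) / fact k"
        using n by (intro frac_le fact_mono) auto
      finally show "norm ((1 / fact (k + 2)) *\<^sub>R mpow X (k + 2)) \<le> (?N * (norm X)\<^sup>2) * (inverse (fact k))"
        by (simp add: field_simps)
    qed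
    also have "\<dots> = (?N * (norm X)\<^sup>2) * exp 1"
      using exp_converges[of "1 :: real"] sums_mult[of "\<lambda>k. inverse (fact k)" "exp (1::real)"]
      by (simp add: sums_iff suminf_mult)
    finally show ?thesis by (simp add: mult_ac)
  qed
  have "?N > 0" by (simp add: mat_def vec_eq_iff)
  then have "?N * exp 1 > 0" by simp
  then show ?thesis using b by blast
qed

text \<open>
  Derivatives at the identity are written here and below as limits of \<open>s (a - 1)\<close> for a scale \<open>s\<close> that tends to
  infinity, since the group elements in question come as sequences and not as curves.
\<close>

lemma mexp_scaled_tendsto:
  fixes Z :: "'n::finite cmat"
  assumes Z: "(Y \<longlongrightarrow> Z) F" and s: "filterlim s at_top F"
  shows "((\<lambda>n. s n *\<^sub>R (mexp ((1 / s n) *\<^sub>R Y n) - mat 1)) \<longlongrightarrow> Z) F"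
proof -
  obtain C where C: "C > 0" "\<And>X :: 'n cmat. norm X \<le> 1 \<Longrightarrow> norm (mexp X - mat 1 - X) \<le> C * (norm X)\<^sup>2"
    using mexp_quadratic_bound by metis
  have i0: "((\<lambda>n. 1 / s n) \<longlongrightarrow> 0) F"
    using tendsto_inverse_0_at_top[OF s] by (simp add: inverse_eq_divide)
  have "((\<lambda>n. norm ((1 / s n) *\<^sub>R Y n)) \<longlongrightarrow> norm (0 *\<^sub>R Z)) F"
    by (intro tendsto_intros i0 Z)
  then have sm: "\<forall>\<^sub>F n in F. norm ((1 / s n) *\<^sub>R Y n) < 1" by (rule order_tendstoD(2)) simp
  have sp: "\<forall>\<^sub>F n in F. 0 < s n" using s by (simp add: filterlim_at_top_dense)
  have "((\<lambda>n. C * (norm (Y n))\<^sup>2 * (1 / s n)) \<longlongrightarrow> C * (norm Z)\<^sup>2 * 0) F"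
    by (intro tendsto_intros i0 Z)
  then have l0: "((\<lambda>n. C * (norm (Y n))\<^sup>2 * (1 / s n)) \<longlongrightarrow> 0) F" by simp
  have "\<forall>\<^sub>F n in F. norm (s n *\<^sub>R (mexp ((1 / s n) *\<^sub>R Y n) - mat 1) - Y n) \<le> C * (norm (Y n))\<^sup>2 * (1 / s n)"
    using sm sp
  proof eventually_elim
    case (elim n)
    let ?X = "(1 / s n) *\<^sub>R Y n"
    have "s n *\<^sub>R (mexp ?X - mat 1) - Y n = s n *\<^sub>R (mexp ?X - mat 1 - ?X)"
      using elim by (simp add: algebra_simps)
    then have "norm (s n *\<^sub>R (mexp ?X - mat 1) - Y n) = s n * norm (mexp ?X - mat 1 - ?X)"
      using elim by simp
    also have "\<dots> \<le> s n * (C * (norm ?X)\<^sup>2)" using C(2)[of ?X] elim by (intro mult_left_mono) auto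
    also have "\<dots> = C * (norm (Y n))\<^sup>2 * (1 / s n)" using elim by (simp add: power2_eq_square field_simps)
    finally show ?case .
  qed
  from Lim_null_comparison[OF this l0]
  have "((\<lambda>n. s n *\<^sub>R (mexp ((1 / s n) *\<^sub>R Y n) - mat 1) - Y n) \<longlongrightarrow> 0) F" .
  from tendsto_add[OF this Z] show ?thesis by simp
qed

lemma scaled_product_tendsto:
  fixes X Y :: "'n::finite cmat"
  assumes s: "filterlim s at_top F" and X: "((\<lambda>n. s n *\<^sub>R (a n - mat 1)) \<longlongrightarrow> X) F"
    and Y: "((\<lambda>n. s n *\<^sub>R (b n - mat 1)) \<longlongrightarrow> Y) F"
  shows "((\<lambda>n. s n *\<^sub>R (a n ** b n - mat 1)) \<longlongrightarrow> X + Y) F"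
proof -
  have i0: "((\<lambda>n. 1 / s n) \<longlongrightarrow> 0) F"
    using tendsto_inverse_0_at_top[OF s] by (simp add: inverse_eq_divide)
  have "((\<lambda>n. s n *\<^sub>R (a n - mat 1) + s n *\<^sub>R (b n - mat 1)
      + (1 / s n) *\<^sub>R ((s n *\<^sub>R (a n - mat 1)) ** (s n *\<^sub>R (b n - mat 1)))) \<longlongrightarrow> X + Y + 0 *\<^sub>R (X ** Y)) F"
    by (intro tendsto_add tendsto_scaleR mm.tendsto X Y i0)
  moreover have "s n *\<^sub>R (a n - mat 1) + s n *\<^sub>R (b n - mat 1)
      + (1 / s n) *\<^sub>R ((s n *\<^sub>R (a n - mat 1)) ** (s n *\<^sub>R (b n - mat 1))) = s n *\<^sub>R (a n ** b n - mat 1)" for n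
    by (cases "s n = 0") (simp_all add: mm.scaleR_left mm.scaleR_right mm.diff_left mm.diff_right algebra_simps)
  ultimately show ?thesis by simp
qed

text \<open>
  In the Frobenius norm the identity can have norm greater than 1, so powers are not estimated by powers of norms;
  instead a factor close to the identity stretches any matrix by at most \<open>1 + d\<close>.
\<close>

lemma norm_mpow_diff:
 assumes a: "norm (a - mat 1 :: 'n::finite cmat) \<le> d" and b: "norm (b - mat 1 :: 'n cmat) \<le> d"
  shows "norm (mpow a m - mpow b m) \<le> real m * (1 + d) ^ m * (norm (mat 1 :: 'n cmat) * norm (a - b))"
proof -
  have d: "0 \<le> d" using a by (meson mult_nonneg_nonneg norm_ge_zero order_trans less_imp_le)
  have step: "norm (c ** M) \<le> (1 + d) * norm M" if "norm (c - mat 1) \<le> d" for c M :: "'n cmat"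
  proof -
    have "norm (c ** M) = norm (M + (c - mat 1) ** M)" by (simp add: mm.diff_left)
    also have "\<dots> \<le> norm M + norm ((c - mat 1) ** M)" by (rule norm_triangle_ineq)
    also have "norm ((c - mat 1) ** M) \<le> norm (c - mat 1) * norm M" by (rule norm_matrix_mult_le)
    also have "\<dots> \<le> d * norm M" using that by (intro mult_right_mono) auto
    finally show ?thesis by (simp add: algebra_simps)
  qed
  have bm: "norm (mpow b m) \<le> (1 + d) ^ m * norm (mat 1 :: 'n cmat)" for m
  proof (induction m)
    case (Suc m)
    have "norm (mpow b (Suc m)) \<le> (1 + d) * norm (mpow b m)" using step[OF b] by simp
    also have "\<dots> \<le> (1 + d) * ((1 + d) ^ m * norm (mat 1 :: 'n cmat))" using Suc d by (intro mult_left_mono) auto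
    finally show ?case by (simp add: mult_ac)
  qed simp
  let ?e = "norm (mat 1 :: 'n cmat) * norm (a - b)"
  have e0: "0 \<le> ?e" by simp
  show ?thesis
  proof (induction m)
    case (Suc m)
    have "mpow a (Suc m) - mpow b (Suc m) = a ** (mpow a m - mpow b m) + (a - b) ** mpow b m"
      by (simp add: mm.diff_left mm.diff_right)
    then have "norm (mpow a (Suc m) - mpow b (Suc m))
        \<le> norm (a ** (mpow a m - mpow b m)) + norm ((a - b) ** mpow b m)" by (metis norm_triangle_ineq)
    also have "\<dots> \<le> (1 + d) * norm (mpow a m - mpow b m) + norm (a - b) * norm (mpow b m)"
      by (intro add_mono step[OF a] norm_matrix_mult_le)
    also have "\<dots> \<le> (1 + d) * (real m * (1 + d) ^ m * ?e) + norm (a - b) * ((1 + d) ^ m * norm (mat 1 :: 'n cmat))"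
      using Suc d bm[of m] by (intro add_mono mult_left_mono) auto
    also have "\<dots> = real m * (1 + d) ^ Suc m * ?e + (1 + d) ^ m * ?e" by (simp add: mult_ac)
    also have "(1 + d) ^ m * ?e \<le> (1 + d) ^ Suc m * ?e" using d e0 by (intro mult_right_mono) auto
    finally show ?case by (simp add: algebra_simps)
  qed simp
qed

text \<open>
  Both \<open>a\<^sub>n\<close> and \<open>mexp (Z / m\<^sub>n)\<close> are \<open>1 + Z / m\<^sub>n\<close> up to an error of smaller order, so their powers with
  exponent \<open>m\<^sub>n\<close> have the same limit.
\<close>

lemma mpow_tendsto_mexp:
  fixes a :: "nat \<Rightarrow> 'n::finite cmat"
  assumes m: "filterlim m at_top sequentially"
    and a: "(\<lambda>n. real (m n) *\<^sub>R (a n - mat 1)) \<longlonglongrightarrow> Z"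
  shows "(\<lambda>n. mpow (a n) (m n)) \<longlonglongrightarrow> mexp Z"
proof -
  have mr: "filterlim (\<lambda>n. real (m n)) at_top sequentially"
    by (rule filterlim_compose[OF filterlim_real_sequentially m])
  have m0: "\<forall>\<^sub>F n in sequentially. m n > 0" using m[unfolded filterlim_at_top, rule_format, of 1] by (simp add: Suc_le_eq)
  define b where "b n = mexp ((1 / real (m n)) *\<^sub>R Z)" for n
  have b: "(\<lambda>n. real (m n) *\<^sub>R (b n - mat 1)) \<longlonglongrightarrow> Z"
    using mexp_scaled_tendsto[OF tendsto_const mr] by (simp add: b_def)
  obtain C where C: "\<And>n. norm (real (m n) *\<^sub>R (a n - mat 1)) \<le> C" "\<And>n. norm (real (m n) *\<^sub>R (b n - mat 1)) \<le> C" "C > 0"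
  proof -
    obtain C1 where "\<And>n. norm (real (m n) *\<^sub>R (a n - mat 1)) \<le> C1" 
      using convergent_imp_Bseq[OF convergentI[OF a]] unfolding Bseq_def by blast
    moreover obtain C2 where "\<And>n. norm (real (m n) *\<^sub>R (b n - mat 1)) \<le> C2"
      using convergent_imp_Bseq[OF convergentI[OF b]] unfolding Bseq_def by blast
    ultimately show ?thesis by (intro that[of "max 1 (max C1 C2)"]) (auto simp: max.coboundedI2 le_max_iff_disj)
  qed
  have bd: "norm (mpow (a n) (m n) - mexp Z)
      \<le> exp (C) * (norm (mat 1 :: 'n cmat)) * norm (real (m n) *\<^sub>R (a n - mat 1) - real (m n) *\<^sub>R (b n - mat 1))"
    if "m n > 0" for n
  proof -
    have e: "mpow (b n) (m n) = mexp Z" using that by (simp add: b_def mpow_mexp)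
    have "norm (mpow (a n) (m n) - mpow (b n) (m n))
       \<le> real (m n) * (1 + C / real (m n)) ^ m n * (norm (mat 1 :: 'n cmat) * norm (a n - b n))"
    proof (intro norm_mpow_diff)
      have "real (m n) * norm (a n - mat 1) \<le> C" "real (m n) * norm (b n - mat 1) \<le> C"
        using C(1)[of n] C(2)[of n] by (simp_all only: norm_scaleR abs_of_nat)
      then show "norm (a n - mat 1) \<le> C / real (m n)" "norm (b n - mat 1) \<le> C / real (m n)"
        using that by (simp_all add: field_simps)
    qed
    also have "(1 + C / real (m n)) ^ m n \<le> exp (C)"
      using exp_ge_one_plus_x_over_n_power_n[of "m n" C] C(3) that
      by simp
    finally have "norm (mpow (a n) (m n) - mpow (b n) (m n))
       \<le> real (m n) * exp (C) * (norm (mat 1 :: 'n cmat) * norm (a n - b n))"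
      by (simp add: mult_left_mono mult_right_mono)
    also have "\<dots> = exp (C) * (norm (mat 1 :: 'n cmat)) * norm (real (m n) *\<^sub>R (a n - b n))" by (simp add: mult_ac)
    also have "real (m n) *\<^sub>R (a n - b n) = real (m n) *\<^sub>R (a n - mat 1) - real (m n) *\<^sub>R (b n - mat 1)"
      by (simp add: algebra_simps)
    finally show ?thesis by (simp add: e)
  qed
  let ?g = "\<lambda>n. exp C * norm (mat 1 :: 'n cmat) * norm (real (m n) *\<^sub>R (a n - mat 1) - real (m n) *\<^sub>R (b n - mat 1))"
  have "?g \<longlonglongrightarrow> exp C * norm (mat 1 :: 'n cmat) * norm (Z - Z)"
    by (intro tendsto_intros a b)
  then have g0: "?g \<longlonglongrightarrow> 0" by simp
  have "\<forall>\<^sub>F n in sequentially. norm (mpow (a n) (m n) - mexp Z) \<le> ?g n"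
    using m0 by eventually_elim (use bd in simp)
  from Lim_null_comparison[OF this g0] show ?thesis using LIM_zero_iff by blast
qed

lemma invertible_mexp: "invertible (mexp X)"
  unfolding invertible_def using mexp_minus by blast

lemma matrix_inv_unique:
  assumes "A ** B = mat 1" "B ** A = (mat 1 :: 'n::finite cmat)"
  shows "matrix_inv A = B"
proof -
  have "\<exists>A'. A ** A' = mat 1 \<and> A' ** A = mat 1" using assms by blast
  then have i: "A ** matrix_inv A = mat 1 \<and> matrix_inv A ** A = mat 1"
    unfolding matrix_inv_def by (rule someI_ex)
  have "matrix_inv A = (B ** A) ** matrix_inv A" using assms by simp
  also have "\<dots> = B" using i by (simp add: matrix_mul_assoc[symmetric])
  finally show ?thesis .
qed

lemma matrix_inv_mexp: "matrix_inv (mexp X) = mexp (- X)"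
  by (rule matrix_inv_unique) (simp_all add: mexp_minus)

definition closed_in_GL :: "'n::finite cmat set \<Rightarrow> bool" where
  "closed_in_GL G \<longleftrightarrow> (\<forall>s g. (\<forall>n. s n \<in> G) \<longrightarrow> s \<longlonglongrightarrow> g \<longrightarrow> invertible g \<longrightarrow> g \<in> G)"

lemma mpow_in_group: "matrix_group G \<Longrightarrow> g \<in> G \<Longrightarrow> mpow g k \<in> G"
  by (induction k) (auto simp: matrix_group_def)

text \<open>
  The powers of \<open>a\<^sub>n\<close> with exponent \<open>\<lfloor>t s\<^sub>n\<rfloor>\<close> converge to \<open>mexp (t Z)\<close>. This is the part of the closed subgroup
  theorem on which everything rests: it makes \<open>lie G\<close> a vector space, gives the Cartan decomposition, and produces the
  root vectors of the rigidity argument.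
\<close>

lemma tangent_in_lie:
  fixes a :: "nat \<Rightarrow> 'n::finite cmat"
  assumes G: "matrix_group G" "closed_in_GL G" and aG: "\<And>n. a n \<in> G"
    and s: "filterlim s at_top sequentially"
    and lim: "(\<lambda>n. s n *\<^sub>R (a n - mat 1)) \<longlonglongrightarrow> Z"
  shows "Z \<in> lie G"
proof -
  have pos: "mexp (t *\<^sub>R Z) \<in> G" if t: "t > 0" for t :: real
  proof -
    \<comment> \<open>\<open>a\<^sub>n\<close> is about \<open>1 + Z / s\<^sub>n\<close>, so this many factors add up to \<open>t Z\<close>\<close>
    define m where "m n = nat \<lfloor>t * s n\<rfloor>" for n
    have ts: "filterlim (\<lambda>n. t * s n) at_top sequentially"
      by (rule filterlim_tendsto_pos_mult_at_top[OF tendsto_const t s])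
    have m: "filterlim m at_top sequentially"
      unfolding m_def by (rule filterlim_compose[OF filterlim_nat_sequentially filterlim_compose[OF filterlim_floor_sequentially ts]])
    have sp: "\<forall>\<^sub>F n in sequentially. 0 < s n" using s by (simp add: filterlim_at_top_dense)
    have i0: "(\<lambda>n. 1 / s n) \<longlonglongrightarrow> 0"
      using tendsto_inverse_0_at_top[OF s] by (simp add: inverse_eq_divide)
    have r: "(\<lambda>n. real (m n) / s n - t) \<longlonglongrightarrow> 0"
    proof (rule Lim_null_comparison[OF _ i0])
      show "\<forall>\<^sub>F n in sequentially. norm (real (m n) / s n - t) \<le> 1 / s n"
        using sp
      proof eventually_elim
        case (elim n)
        then have "0 \<le> t * s n" using t by simp
        then have "real (m n) = of_int \<lfloor>t * s n\<rfloor>" by (simp add: m_def)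
        then have "\<bar>real (m n) - t * s n\<bar> \<le> 1" by linarith
        moreover have "real (m n) / s n - t = (real (m n) - t * s n) / s n" using elim by (simp add: field_simps)
        ultimately show ?case using elim by (simp add: divide_right_mono)
      qed
    qed
    have "(\<lambda>n. ((real (m n) / s n - t) + t) *\<^sub>R (s n *\<^sub>R (a n - mat 1))) \<longlonglongrightarrow> (0 + t) *\<^sub>R Z"
      by (intro tendsto_intros r lim)
    moreover have "\<forall>\<^sub>F n in sequentially. (real (m n) / s n - t + t) *\<^sub>R (s n *\<^sub>R (a n - mat 1)) = real (m n) *\<^sub>R (a n - mat 1)"
      using sp by eventually_elim simp
    ultimately have "(\<lambda>n. real (m n) *\<^sub>R (a n - mat 1)) \<longlonglongrightarrow> (0 + t) *\<^sub>R Z"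
      by (rule Lim_transform_eventually)
    then have "(\<lambda>n. real (m n) *\<^sub>R (a n - mat 1)) \<longlonglongrightarrow> t *\<^sub>R Z" by simp
    from mpow_tendsto_mexp[OF m this] have "(\<lambda>n. mpow (a n) (m n)) \<longlonglongrightarrow> mexp (t *\<^sub>R Z)" .
    moreover have "mpow (a n) (m n) \<in> G" for n by (rule mpow_in_group[OF G(1) aG])
    ultimately show ?thesis using G(2)[unfolded closed_in_GL_def, rule_format, of "\<lambda>n. mpow (a n) (m n)"] invertible_mexp by blast
  qed
  have "mexp (t *\<^sub>R Z) \<in> G" for t :: real
  proof (cases "t > 0")
    case False
    show ?thesis
    proof (cases "t = 0")
      case True then show ?thesis using G(1) by (simp add: matrix_group_def)
    next
      case False
      with \<open>\<not> t > 0\<close> have "mexp ((- t) *\<^sub>R Z) \<in> G" by (intro pos) simp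
      then have "matrix_inv (mexp ((- t) *\<^sub>R Z)) \<in> G" using G(1) unfolding matrix_group_def by blast
      then show ?thesis by (simp add: matrix_inv_mexp)
    qed
  qed (rule pos)
  then show ?thesis by (simp add: lie_def)
qed

lemma lie_scaleR: "X \<in> lie G \<Longrightarrow> c *\<^sub>R X \<in> lie G"
  by (simp add: lie_def)

lemma lie_mexp: "X \<in> lie G \<Longrightarrow> mexp X \<in> G"
  unfolding lie_def by (metis (mono_tags, lifting) mem_Collect_eq scaleR_one)

lemma lie_mexp_scaleR: "X \<in> lie G \<Longrightarrow> mexp (t *\<^sub>R X) \<in> G"
  by (simp add: lie_def)

lemma subspace_lie:
  assumes G: "matrix_group (G :: 'n::finite cmat set)" "closed_in_GL G"
  shows "subspace (lie G)"
proof (rule subspaceI)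
  show "0 \<in> lie G" using G(1) by (simp add: lie_def matrix_group_def)
  show "c *\<^sub>R X \<in> lie G" if "X \<in> lie G" for c X using that by (rule lie_scaleR)
  fix X Y assume XY: "X \<in> lie G" "Y \<in> lie G"
  note s = filterlim_real_sequentially
  define a where "a n = mexp ((1 / real n) *\<^sub>R X) ** mexp ((1 / real n) *\<^sub>R Y)" for n :: nat
  have aG: "a n \<in> G" for n
    using XY G(1) unfolding a_def matrix_group_def by (blast intro: lie_mexp_scaleR)
  have "(\<lambda>n. real n *\<^sub>R (a n - mat 1)) \<longlonglongrightarrow> X + Y"
    unfolding a_def by (intro scaled_product_tendsto mexp_scaled_tendsto tendsto_const s)
  from tangent_in_lie[OF G aG s this] show "X + Y \<in> lie G" .
qed

section \<open>Forms invariant under a compact group\<close>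

definition adj :: "'n::finite cmat \<Rightarrow> 'n cmat" where
  "adj A = (\<chi> i j. cnj (A $ j $ i))"

lemma adj_adj [simp]: "adj (adj A) = A"
  by (simp add: adj_def vec_eq_iff)

lemma adj_mult: "adj (A ** B) = adj B ** adj A"
  by (simp add: adj_def vec_eq_iff matrix_matrix_mult_def mult.commute)

lemma adj_mat: "adj (mat c) = mat (cnj c)"
  by (simp add: adj_def vec_eq_iff mat_def)

lemma bounded_linear_adj: "bounded_linear (adj :: 'n::finite cmat \<Rightarrow> 'n cmat)"
proof -
  have "linear (adj :: 'n cmat \<Rightarrow> 'n cmat)" by (rule linearI) (simp_all add: adj_def vec_eq_iff)
  then show ?thesis by (simp add: linear_conv_bounded_linear)
qed

lemma inner_cmat: "A \<bullet> B = Re (\<Sum>i\<in>UNIV. \<Sum>j\<in>UNIV. A $ i $ j * cnj (B $ i $ j))" for A B :: "'n::finite cmat"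
  by (simp add: inner_vec_def inner_complex_def)

lemma inner_mult_left_adj: "(A ** B) \<bullet> C = B \<bullet> (adj A ** C)" for A B C :: "'n::finite cmat"
proof -
  have "(\<Sum>i\<in>UNIV. \<Sum>j\<in>UNIV. (A ** B) $ i $ j * cnj (C $ i $ j))
      = (\<Sum>i\<in>UNIV. \<Sum>j\<in>UNIV. \<Sum>k\<in>UNIV. A $ i $ k * B $ k $ j * cnj (C $ i $ j))"
    by (simp add: matrix_matrix_mult_def sum_distrib_right)
  also have "\<dots> = (\<Sum>i\<in>UNIV. \<Sum>k\<in>UNIV. \<Sum>j\<in>UNIV. A $ i $ k * B $ k $ j * cnj (C $ i $ j))"
    by (rule sum.cong[OF refl]) (rule sum.swap)
  also have "\<dots> = (\<Sum>k\<in>UNIV. \<Sum>i\<in>UNIV. \<Sum>j\<in>UNIV. A $ i $ k * B $ k $ j * cnj (C $ i $ j))"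
    by (rule sum.swap)
  also have "\<dots> = (\<Sum>k\<in>UNIV. \<Sum>j\<in>UNIV. \<Sum>i\<in>UNIV. A $ i $ k * B $ k $ j * cnj (C $ i $ j))"
    by (rule sum.cong[OF refl]) (rule sum.swap)
  also have "\<dots> = (\<Sum>k\<in>UNIV. \<Sum>j\<in>UNIV. B $ k $ j * cnj ((adj A ** C) $ k $ j))"
    by (simp add: matrix_matrix_mult_def adj_def sum_distrib_left mult_ac)
  finally show ?thesis by (simp only: inner_cmat)
qed

lemma inner_adj: "adj A \<bullet> adj B = A \<bullet> B" for A B :: "'n::finite cmat"
proof -
  have "(\<Sum>i\<in>UNIV. \<Sum>j\<in>UNIV. adj A $ i $ j * cnj (adj B $ i $ j))
     = cnj (\<Sum>i\<in>UNIV. \<Sum>j\<in>UNIV. A $ j $ i * cnj (B $ j $ i))" by (simp add: adj_def)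
  also have "\<dots> = cnj (\<Sum>i\<in>UNIV. \<Sum>j\<in>UNIV. A $ i $ j * cnj (B $ i $ j))"
    by (subst sum.swap) simp
  finally show ?thesis by (simp only: inner_cmat complex_cnj_cancel_iff) simp
qed

lemma inner_mult_right_adj: "(A ** B) \<bullet> C = A \<bullet> (C ** adj B)" for A B C :: "'n::finite cmat"
  using inner_mult_left_adj[of "adj B" "adj A" "adj C"] inner_adj[of "A ** B" C] inner_adj[of A "C ** adj B"]
  by (simp add: adj_mult)

lemma mat_commute: "mat c ** A = A ** mat c" for A :: "'n::finite cmat"
proof -
  have "(mat c ** A) $ i $ j = c * A $ i $ j" for i j
  proof -
    have "(mat c ** A) $ i $ j = (\<Sum>k\<in>UNIV. if k = i then c * A $ k $ j else 0)"
      unfolding matrix_matrix_mult_def mat_def vec_lambda_beta by (rule sum.cong) auto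
    then show ?thesis by simp
  qed
  moreover have "(A ** mat c) $ i $ j = c * A $ i $ j" for i j
  proof -
    have "(A ** mat c) $ i $ j = (\<Sum>k\<in>UNIV. if k = j then c * A $ i $ k else 0)"
      unfolding matrix_matrix_mult_def mat_def vec_lambda_beta by (rule sum.cong) auto
    then show ?thesis by simp
  qed
  ultimately show ?thesis by (simp add: vec_eq_iff)
qed

lemma matrix_group_matrix_inv:
  assumes "matrix_group G" "g \<in> G"
  shows "matrix_inv g \<in> G" "g ** matrix_inv g = mat 1" "matrix_inv g ** g = mat 1"
proof -
  have "invertible g" using assms by (simp add: matrix_group_def)
  then obtain h where h: "g ** h = mat 1" "h ** g = mat 1" unfolding invertible_def by blast
  then have "matrix_inv g = h" by (rule matrix_inv_unique)
  then show "g ** matrix_inv g = mat 1" "matrix_inv g ** g = mat 1" using h by simp_all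
  show "matrix_inv g \<in> G" using assms by (simp add: matrix_group_def)
qed

text \<open>
  A fixed point argument in place of an average over \<open>U\<close>. The action \<open>S \<mapsto> u\<^sup>* S u\<close> preserves the compact
  convex hull of the matrices \<open>u\<^sup>* u\<close>, and the largest norm on the orbit of \<open>S\<close> is an invariant function of \<open>S\<close>. This
  function is smaller at the midpoint of two distinct minimisers, by the parallelogram law, so its minimiser is fixed.
\<close>

lemma compact_group_invariant_matrix:
  fixes U :: "'n::finite cmat set"
  assumes U: "matrix_group U" and cU: "compact U"
  shows "\<exists>S \<in> convex hull ((\<lambda>u. adj u ** u) ` U). \<forall>u\<in>U. adj u ** S ** u = S"
proof -
  define act where "act u S = adj u ** S ** u" for u S :: "'n cmat"
  define C where "C = convex hull ((\<lambda>u. adj u ** u) ` U)"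
  interpret ad: bounded_linear "adj :: 'n cmat \<Rightarrow> 'n cmat" by (rule bounded_linear_adj)
  have U1: "mat 1 \<in> U" using U by (simp add: matrix_group_def)
  have Um: "u ** v \<in> U" if "u \<in> U" "v \<in> U" for u v using U that by (simp add: matrix_group_def)
  have cont_act: "continuous_on X (\<lambda>u. act u S)" for X S
    unfolding act_def by (intro continuous_intros mm.continuous_on ad.continuous_on)
  have "compact ((\<lambda>u. adj u ** u) ` U)"
    using cont_act[of U "mat 1"] by (intro compact_continuous_image cU) (simp add: act_def)
  then have cC: "compact C" unfolding C_def by (rule compact_convex_hull)
  have convC: "convex C" by (simp add: C_def)
  have neC: "C \<noteq> {}" using U1 by (auto simp: C_def)
  have lin_act: "linear (act u)" for u
    by (rule linearI) (simp_all add: act_def mm.add_left mm.add_right mm.scaleR_left mm.scaleR_right)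
  have act_act: "act u (act v S) = act (v ** u) S" for u v S
    by (simp add: act_def adj_mult matrix_mul_assoc)
  have act_C: "act v S \<in> C" if "v \<in> U" "S \<in> C" for v S
  proof -
    have "act v ` C = convex hull (act v ` (\<lambda>u. adj u ** u) ` U)"
      unfolding C_def by (rule convex_hull_linear_image[OF lin_act])
    moreover have "act v ` (\<lambda>u. adj u ** u) ` U \<subseteq> (\<lambda>u. adj u ** u) ` U"
    proof
      fix y assume "y \<in> act v ` (\<lambda>u. adj u ** u) ` U"
      then obtain u where u: "u \<in> U" "y = act v (adj u ** u)" by blast
      then have "y = adj (u ** v) ** (u ** v)" by (simp add: act_def adj_mult matrix_mul_assoc)
      then show "y \<in> (\<lambda>u. adj u ** u) ` U" using Um[OF u(1) that(1)] by blast
    qed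
    ultimately have "act v ` C \<subseteq> C" unfolding C_def by (simp add: hull_mono)
    then show ?thesis using that by blast
  qed
  define f where "f S = Sup ((\<lambda>u. norm (act u S)) ` U)" for S
  have f_att: "\<exists>u\<in>U. f S = norm (act u S)" and f_ub: "u \<in> U \<Longrightarrow> norm (act u S) \<le> f S" for S u
  proof -
    have "continuous_on U (\<lambda>u. norm (act u S))" by (intro continuous_intros cont_act)
    then obtain u0 where u0: "u0 \<in> U" "\<And>u. u \<in> U \<Longrightarrow> norm (act u S) \<le> norm (act u0 S)"
      using continuous_attains_sup[OF cU] U1 by blast
    then have "f S = norm (act u0 S)" unfolding f_def by (intro cSup_eq_maximum) auto
    then show "\<exists>u\<in>U. f S = norm (act u S)" "u \<in> U \<Longrightarrow> norm (act u S) \<le> f S" using u0 by auto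
  qed
  obtain M where M: "\<And>u. u \<in> U \<Longrightarrow> norm (adj u) * norm u \<le> M"
  proof -
    have "continuous_on U (\<lambda>u. norm (adj u) * norm u)" by (intro continuous_intros ad.continuous_on)
    then have "\<exists>u0\<in>U. \<forall>u\<in>U. norm (adj u) * norm u \<le> norm (adj u0) * norm u0"
      using continuous_attains_sup[OF cU] U1 by blast
    then show ?thesis using that by blast
  qed
  have M0: "0 \<le> M" using M[OF U1] by (meson mult_nonneg_nonneg norm_ge_zero order_trans)
  have lip1: "f S \<le> f T + M * norm (S - T)" for S T
  proof -
    obtain u where u: "u \<in> U" "f S = norm (act u S)" using f_att by blast
    interpret lu: linear "act u" by (rule lin_act)
    have "act u S = act u T + act u (S - T)" by (simp add: lu.diff)
    then have "norm (act u S) \<le> norm (act u T) + norm (act u (S - T))" by (metis norm_triangle_ineq)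
    also have "norm (act u (S - T)) \<le> norm (adj u ** (S - T)) * norm u" unfolding act_def by (rule norm_matrix_mult_le)
    also have "\<dots> \<le> (norm (adj u) * norm (S - T)) * norm u" by (intro mult_right_mono norm_matrix_mult_le) auto
    also have "\<dots> \<le> M * norm (S - T)" using mult_right_mono[OF M[OF u(1)], of "norm (S - T)"] by (simp add: mult_ac)
    finally show ?thesis using f_ub[OF u(1), of T] u(2) by linarith
  qed
  have "continuous_on C f"
  proof (rule lipschitz_on_continuous_on[of M], rule lipschitz_onI)
    show "dist (f S) (f T) \<le> M * dist S T" for S T
      using lip1[of S T] lip1[of T S] by (simp add: dist_norm norm_minus_commute abs_le_iff)
  qed (rule M0)
  then obtain S where S: "S \<in> C" and min: "\<And>T. T \<in> C \<Longrightarrow> f S \<le> f T"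
    using continuous_attains_inf[OF cC neC] by blast
  have "act v S = S" if v: "v \<in> U" for v
  proof (rule ccontr)
    assume ne: "act v S \<noteq> S"
    define T where "T = act v S"
    have T: "T \<in> C" unfolding T_def by (rule act_C[OF v S])
    have mid: "(1/2) *\<^sub>R S + (1/2) *\<^sub>R T \<in> C" using convexD[OF convC S T] by simp
    obtain u where u: "u \<in> U" "f ((1/2) *\<^sub>R S + (1/2) *\<^sub>R T) = norm (act u ((1/2) *\<^sub>R S + (1/2) *\<^sub>R T))" using f_att by blast
    interpret lu: linear "act u" by (rule lin_act)
    define a b where "a = act u S" and "b = act u T"
    have ab: "norm a \<le> f S" "norm b \<le> f S"
      using f_ub[OF u(1), of S] f_ub[OF Um[OF v u(1)], of S] by (simp_all add: a_def b_def T_def act_act)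
    have "a \<noteq> b"
    proof
      assume "a = b"
      have inv: "act (matrix_inv u) (act u R) = R" for R
        using matrix_group_matrix_inv[OF U u(1)] by (simp add: act_act) (simp add: act_def adj_mat)
      have "S = act (matrix_inv u) a" "T = act (matrix_inv u) b" by (simp_all only: a_def b_def inv)
      then have "S = T" by (simp only: \<open>a = b\<close>)
      then show False using ne by (simp add: T_def)
    qed
    then have "0 < norm (a - b)" by simp
    have "(norm ((1/2) *\<^sub>R a + (1/2) *\<^sub>R b))\<^sup>2 = (norm a)\<^sup>2 / 2 + (norm b)\<^sup>2 / 2 - (norm (a - b))\<^sup>2 / 4"
      unfolding power2_norm_eq_inner by (simp add: inner_add_left inner_add_right inner_diff_left inner_diff_right inner_commute field_simps)
    also have "\<dots> < (f S)\<^sup>2"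
    proof -
      have "(norm a)\<^sup>2 \<le> (f S)\<^sup>2" "(norm b)\<^sup>2 \<le> (f S)\<^sup>2"
        by (rule power_mono[OF ab(1) norm_ge_zero], rule power_mono[OF ab(2) norm_ge_zero])
      moreover have "0 < (norm (a - b))\<^sup>2" using \<open>0 < norm (a - b)\<close> by simp
      ultimately show ?thesis by linarith
    qed
    finally have "norm ((1/2) *\<^sub>R a + (1/2) *\<^sub>R b) < f S"
      using ab(1) norm_ge_zero[of a] by (meson order_trans power_less_imp_less_base)
    moreover have "act u ((1/2) *\<^sub>R S + (1/2) *\<^sub>R T) = (1/2) *\<^sub>R a + (1/2) *\<^sub>R b"
      by (simp only: lu.add lu.scaleR a_def b_def)
    ultimately show False using min[OF mid] u(2) by simp
  qed
  then show ?thesis using S unfolding C_def act_def by blast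
qed

lemma convex_pos_linear: "linear f \<Longrightarrow> convex {x. 0 < (f x :: real)}"
  using convex_linear_vimage[of f "{0<..}"] by (simp add: vimage_def)

definition is_invariant_form :: "'n::finite cmat set \<Rightarrow> ('n cmat \<Rightarrow> 'n cmat \<Rightarrow> real) \<Rightarrow> bool" where
  "is_invariant_form U B \<longleftrightarrow> bilinear B \<and> (\<forall>x y. B x y = B y x) \<and> (\<forall>x. x \<noteq> 0 \<longrightarrow> 0 < B x x)
     \<and> (\<forall>u\<in>U. \<forall>x y. B (u ** x) (u ** y) = B x y) \<and> (\<forall>u\<in>U. \<forall>x y. B (x ** u) (y ** u) = B x y)
     \<and> (\<forall>x y. B (mat \<i> ** x) (mat \<i> ** y) = B x y)"

text \<open>
  Take \<open>Re tr(S x T y\<^sup>* )\<close>, where \<open>S\<close> accounts for left and \<open>T\<close> for right translations. Positivity passes to the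
  convex hulls from the generators: for \<open>S = u\<^sup>* u\<close> and \<open>T = v v\<^sup>*\<close> the form is \<open>\<parallel>u x v\<parallel>\<^sup>2\<close>.
\<close>

lemma compact_group_invariant_form:
  fixes U :: "'n::finite cmat set"
  assumes U: "matrix_group U" and cU: "compact U"
  shows "\<exists>B. is_invariant_form U B"
proof -
  interpret ad: bounded_linear "adj :: 'n cmat \<Rightarrow> 'n cmat" by (rule bounded_linear_adj)
  have U1: "mat 1 \<in> U" using U by (simp add: matrix_group_def)
  have U': "matrix_group (adj ` U)"
  proof -
    have "invertible (adj u) \<and> matrix_inv (adj u) \<in> adj ` U" if u: "u \<in> U" for u
    proof -
      note i = matrix_group_matrix_inv[OF U u]
      have e: "adj u ** adj (matrix_inv u) = mat 1" "adj (matrix_inv u) ** adj u = mat 1"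
        using i by (simp_all add: adj_mult[symmetric] adj_mat)
      then have "matrix_inv (adj u) = adj (matrix_inv u)" by (rule matrix_inv_unique)
      then show ?thesis using i(1) e unfolding invertible_def by auto
    qed
    moreover have "adj u ** adj v \<in> adj ` U" if "u \<in> U" "v \<in> U" for u v
      using U that by (auto simp: adj_mult[symmetric] matrix_group_def)
    moreover have "mat 1 \<in> adj ` U" using U1 adj_mat[of 1, where 'a = 'n] by (metis complex_cnj_one image_eqI)
    ultimately show ?thesis unfolding matrix_group_def by blast
  qed
  have cU': "compact (adj ` U)" by (intro compact_continuous_image cU ad.continuous_on continuous_on_id)
  obtain S where S: "S \<in> convex hull ((\<lambda>u. adj u ** u) ` U)" "\<And>u. u \<in> U \<Longrightarrow> adj u ** S ** u = S"
    using compact_group_invariant_matrix[OF U cU] by blast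
  obtain T where T: "T \<in> convex hull ((\<lambda>u. adj u ** u) ` adj ` U)" "\<And>u. u \<in> adj ` U \<Longrightarrow> adj u ** T ** u = T"
    using compact_group_invariant_matrix[OF U' cU'] by blast
  have T2: "u ** T ** adj u = T" if "u \<in> U" for u using T(2)[of "adj u"] that by simp
  have herm: "adj R = R" if "R \<in> convex hull ((\<lambda>u. adj u ** u) ` V)" for R :: "'n cmat" and V
  proof -
    have "convex {R :: 'n cmat. adj R = R}" by (rule convexI) (simp add: ad.add ad.scaleR)
    then have "convex hull ((\<lambda>u. adj u ** u) ` V) \<subseteq> {R. adj R = R}"
      by (intro hull_minimal) (auto simp: adj_mult)
    then show ?thesis using that by blast
  qed
  define B where "B x y = (S ** x ** T) \<bullet> y" for x y :: "'n cmat"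
  have bil: "bilinear B"
    unfolding bilinear_def B_def
    by (intro conjI allI linearI)
      (simp_all add: mm.add_left mm.add_right mm.scaleR_left mm.scaleR_right inner_add_left inner_add_right)
  have sym: "B x y = B y x" for x y
  proof -
    have "B x y = x \<bullet> (S ** y ** T)"
      unfolding B_def by (subst inner_mult_right_adj, subst inner_mult_left_adj)
        (simp add: matrix_mul_assoc herm[OF S(1)] herm[OF T(1)])
    then show ?thesis by (simp add: B_def inner_commute)
  qed
  have pos: "0 < B x x" if x: "x \<noteq> 0" for x
  proof -
    have gen: "0 < (adj u ** u ** x ** (v ** adj v)) \<bullet> x" if "u \<in> U" "v \<in> U" for u v
    proof -
      have "(adj u ** u ** x ** (v ** adj v)) \<bullet> x = ((adj u ** (u ** x ** v)) ** adj v) \<bullet> x"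
        by (simp add: matrix_mul_assoc)
      also have "\<dots> = (adj u ** (u ** x ** v)) \<bullet> (x ** v)" by (subst inner_mult_right_adj) simp
      also have "\<dots> = (u ** x ** v) \<bullet> (u ** x ** v)" by (subst inner_mult_left_adj) (simp add: matrix_mul_assoc)
      finally have "(adj u ** u ** x ** (v ** adj v)) \<bullet> x = (u ** x ** v) \<bullet> (u ** x ** v)" .
      moreover have "u ** x ** v \<noteq> 0"
      proof
        assume "u ** x ** v = 0"
        then have "matrix_inv u ** (u ** x ** v) ** matrix_inv v = 0" by (simp add: mm.zero_left mm.zero_right)
        moreover have "matrix_inv u ** (u ** x ** v) ** matrix_inv v = (matrix_inv u ** u) ** x ** (v ** matrix_inv v)"
          by (simp add: matrix_mul_assoc)
        ultimately show False using x matrix_group_matrix_inv[OF U] that by simp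
      qed
      ultimately show ?thesis by simp
    qed
    have half: "0 < (S' ** x ** (v ** adj v)) \<bullet> x" if "S' \<in> convex hull ((\<lambda>u. adj u ** u) ` U)" "v \<in> U" for S' v
    proof -
      let ?P = "{S'. 0 < (S' ** x ** (v ** adj v)) \<bullet> x}"
      have "convex ?P"
        by (intro convex_pos_linear linearI) (simp_all add: mm.add_left mm.scaleR_left inner_add_left)
      then have "convex hull ((\<lambda>u. adj u ** u) ` U) \<subseteq> ?P" using gen that(2) by (intro hull_minimal) auto
      then show ?thesis using that(1) by blast
    qed
    let ?P = "{T'. 0 < (S ** x ** T') \<bullet> x}"
    have "convex ?P"
      by (intro convex_pos_linear linearI) (simp_all add: mm.add_right mm.scaleR_right inner_add_left)
    then have "convex hull ((\<lambda>u. adj u ** u) ` adj ` U) \<subseteq> ?P" using half[OF S(1)] by (intro hull_minimal) auto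
    then show ?thesis using T(1) by (auto simp: B_def)
  qed
  have left: "B (u ** x) (u ** y) = B x y" if "u \<in> U" for u x y
  proof -
    have "B (u ** x) (u ** y) = ((adj u ** S ** u) ** x ** T) \<bullet> y"
      using inner_mult_left_adj[of "adj u" "S ** (u ** x) ** T" y] by (simp add: B_def matrix_mul_assoc)
    then show ?thesis by (simp add: S(2)[OF that] B_def)
  qed
  have right: "B (x ** u) (y ** u) = B x y" if "u \<in> U" for u x y
  proof -
    have "B (x ** u) (y ** u) = (S ** x ** (u ** T ** adj u)) \<bullet> y"
      using inner_mult_right_adj[of "S ** (x ** u) ** T" "adj u" y] by (simp add: B_def matrix_mul_assoc)
    then show ?thesis by (simp add: T2[OF that] B_def)
  qed
  have i: "B (mat \<i> ** x) (mat \<i> ** y) = B x y" for x y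
  proof -
    have "B (mat \<i> ** x) (mat \<i> ** y) = (mat \<i> ** (S ** x ** T)) \<bullet> (mat \<i> ** y)"
      unfolding B_def by (simp add: matrix_mul_assoc mat_commute[of \<i> S])
    also have "\<dots> = (S ** x ** T) \<bullet> ((mat (- \<i>) ** mat \<i>) ** y)"
      by (subst inner_mult_left_adj) (simp add: adj_mat matrix_mul_assoc)
    also have "mat (- \<i>) ** mat \<i> = (mat 1 :: 'n cmat)"
      by (simp add: vec_eq_iff matrix_matrix_mult_def mat_def mult_delta_left)
    finally show ?thesis by (simp add: B_def)
  qed
  have "is_invariant_form U B" unfolding is_invariant_form_def using bil sym pos left right i by blast
  then show ?thesis by blast
qed

section \<open>Real reductive groups\<close>

lemma has_derivative_scaled_tendsto:
  fixes f :: "'a::real_normed_vector \<Rightarrow> 'b::real_normed_vector"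
  assumes f: "(f has_derivative f') (at a)" and s: "filterlim s at_top F"
    and x: "((\<lambda>n. s n *\<^sub>R (x n - a)) \<longlongrightarrow> E) F"
  shows "((\<lambda>n. s n *\<^sub>R (f (x n) - f a)) \<longlongrightarrow> f' E) F"
proof -
  interpret f': bounded_linear f' using f by (rule has_derivative_bounded_linear)
  have i0: "((\<lambda>n. 1 / s n) \<longlongrightarrow> 0) F"
    using tendsto_inverse_0_at_top[OF s] by (simp add: inverse_eq_divide)
  have sp: "\<forall>\<^sub>F n in F. 0 < s n" using s by (simp add: filterlim_at_top_dense)
  have "((\<lambda>n. (1 / s n) *\<^sub>R (s n *\<^sub>R (x n - a)) + a) \<longlongrightarrow> 0 *\<^sub>R E + a) F"
    by (intro tendsto_intros i0 x)
  moreover have "\<forall>\<^sub>F n in F. (1 / s n) *\<^sub>R (s n *\<^sub>R (x n - a)) + a = x n"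
    using sp by eventually_elim simp
  ultimately have xa: "(x \<longlongrightarrow> a) F" using Lim_transform_eventually by fastforce
  define r where "r y = norm (f y - f a - f' (y - a)) / norm (y - a)" for y
  have "(r \<longlongrightarrow> 0) (at a)"
    using f unfolding has_derivative_at r_def has_derivative_iff_norm by blast
  then have "isCont r a" by (simp add: isCont_def r_def)
  from isCont_tendsto_compose[OF this xa] have r0: "((\<lambda>n. r (x n)) \<longlongrightarrow> 0) F" by (simp add: r_def)
  have "((\<lambda>n. r (x n) * norm (s n *\<^sub>R (x n - a))) \<longlongrightarrow> 0 * norm E) F"
    by (intro tendsto_intros r0 x)
  then have l0: "((\<lambda>n. r (x n) * norm (s n *\<^sub>R (x n - a))) \<longlongrightarrow> 0) F" by simp
  have "\<forall>\<^sub>F n in F. norm (s n *\<^sub>R (f (x n) - f a) - f' (s n *\<^sub>R (x n - a))) \<le> r (x n) * norm (s n *\<^sub>R (x n - a))"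
    using sp
  proof eventually_elim
    case (elim n)
    have "s n *\<^sub>R (f (x n) - f a) - f' (s n *\<^sub>R (x n - a)) = s n *\<^sub>R (f (x n) - f a - f' (x n - a))"
      unfolding f'.scaleR by (simp add: scaleR_diff_right)
    moreover have "norm (f (x n) - f a - f' (x n - a)) = r (x n) * norm (x n - a)"
      by (cases "x n = a") (simp_all add: r_def f'.zero)
    ultimately show ?case using elim by (simp add: mult_ac)
  qed
  from Lim_null_comparison[OF this l0]
  have "((\<lambda>n. s n *\<^sub>R (f (x n) - f a) - f' (s n *\<^sub>R (x n - a))) \<longlongrightarrow> 0) F" .
  from tendsto_add[OF this f'.tendsto[OF x]] show ?thesis by simp
qed

lemma det_differentiable: "(det :: 'n::finite cmat \<Rightarrow> complex) differentiable (at g)"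
proof -
  have c: "(\<lambda>A :: 'n cmat. A $ i $ j) differentiable (at g)" for i j
    by (intro bounded_linear_imp_differentiable bounded_linear_compose[OF bounded_linear_vec_nth] bounded_linear_vec_nth)
  have p: "(\<lambda>A :: 'n cmat. \<Prod>i\<in>I. A $ i $ (q i)) differentiable (at g)" if "finite I" for I q
    using that by (induction I) (auto intro!: differentiable_mult c)
  show ?thesis
    unfolding det_def by (intro differentiable_sum differentiable_mult differentiable_const ballI p) (simp_all add: finite_permutations p)
qed

lemma closed_in_GL_real_algebraic:
  assumes "real_algebraic G"
  shows "closed_in_GL G"
proof -
  obtain P where P: "\<And>p. p \<in> P \<Longrightarrow> real_polynomial_function p" "G = {g. invertible g \<and> (\<forall>p\<in>P. p g = 0)}"
    using assms unfolding real_algebraic_def by blast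
  show ?thesis
    unfolding closed_in_GL_def
  proof (intro allI impI)
    fix s g assume s: "\<forall>n. s n \<in> G" and l: "s \<longlonglongrightarrow> g" and i: "invertible g"
    have "p g = 0" if p: "p \<in> P" for p
    proof -
      have "(\<lambda>n. p (s n)) \<longlonglongrightarrow> p g"
        using continuous_real_polymonial_function[OF P(1)[OF p]] l by (rule isCont_tendsto_compose)
      moreover have "p (s n) = 0" for n using s p P(2) by blast
      ultimately show ?thesis by (simp add: LIMSEQ_const_iff)
    qed
    then show "g \<in> G" using i P(2) by blast
  qed
qed

definition invariant_form :: "'n::finite cmat set \<Rightarrow> 'n cmat \<Rightarrow> 'n cmat \<Rightarrow> real" where
  "invariant_form U = (SOME B. is_invariant_form U B)"

locale reductive_rep =
  fixes U G :: "'n::finite cmat set"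
    and \<tau> :: "'n cmat \<Rightarrow> 'v::euclidean_space \<Rightarrow> 'v"
    and ip :: "'n cmat \<Rightarrow> 'n cmat \<Rightarrow> real"
  assumes real_reductive: "real_reductive U G" and real_algebraic: "real_algebraic G"
    and rational: "rational_representation G \<tau>"
    and compatV: "compatible_inner_on_V U G \<tau>"
    and compatg: "compatible_inner_on_lie U G ip"
begin

abbreviation "K \<equiv> kgroup U G"
abbreviation "\<pp> \<equiv> pspace U G"
abbreviation "\<gg> \<equiv> lie G"
abbreviation "B \<equiv> invariant_form U"

lemma group_U: "matrix_group U" and compact_U: "compact U" and group_G: "matrix_group G"
  using real_reductive by (simp_all add: real_reductive_def)

lemma G_one: "mat 1 \<in> G" and G_mult: "g \<in> G \<Longrightarrow> h \<in> G \<Longrightarrow> g ** h \<in> G"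
  using group_G by (simp_all add: matrix_group_def)

lemma closed_G: "closed_in_GL G"
  by (rule closed_in_GL_real_algebraic[OF real_algebraic])

lemma closed_U: "closed_in_GL U"
  unfolding closed_in_GL_def using closed_sequentially[OF compact_imp_closed[OF compact_U]] by blast

lemma group_K: "matrix_group K"
  using group_U group_G by (auto simp: matrix_group_def kgroup_def)

lemma closed_K: "closed_in_GL K"
  using closed_G closed_U unfolding closed_in_GL_def kgroup_def by blast

lemma K_G: "k \<in> K \<Longrightarrow> k \<in> G" and K_U: "k \<in> K \<Longrightarrow> k \<in> U"
  by (simp_all add: kgroup_def)

lemma K_inv: "k \<in> K \<Longrightarrow> matrix_inv k \<in> K" "k \<in> K \<Longrightarrow> k ** matrix_inv k = mat 1"
  "k \<in> K \<Longrightarrow> matrix_inv k ** k = mat 1"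
  using matrix_group_matrix_inv[OF group_K] by blast+

lemma G_inv: "k \<in> G \<Longrightarrow> matrix_inv k \<in> G" "k \<in> G \<Longrightarrow> k ** matrix_inv k = mat 1"
  "k \<in> G \<Longrightarrow> matrix_inv k ** k = mat 1"
  using matrix_group_matrix_inv[OF group_G] by blast+

lemma K_sequentially_compact:
  assumes "\<And>n. k n \<in> K"
  obtains l r where "l \<in> K" "strict_mono (r :: nat \<Rightarrow> nat)" "(k \<circ> r) \<longlonglongrightarrow> l"
proof -
  have "\<forall>n. k n \<in> U" using assms K_U by blast
  then obtain l r where l: "l \<in> U" "strict_mono (r :: nat \<Rightarrow> nat)" "(k \<circ> r) \<longlonglongrightarrow> l"
    using compact_U unfolding compact_def by metis
  moreover have "invertible l" using l(1) group_U by (simp add: matrix_group_def)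
  moreover have "\<forall>n. (k \<circ> r) n \<in> K" using assms by simp
  ultimately have "l \<in> K" using closed_K[unfolded closed_in_GL_def, rule_format, of "k \<circ> r" l] by blast
  then show ?thesis using l that by blast
qed

lemma subspace_g: "subspace \<gg>"
  by (rule subspace_lie[OF group_G closed_G])

lemma subspace_p: "subspace \<pp>"
proof -
  have "linear (\<lambda>X. mat \<i> ** X :: 'n cmat)" by (rule linearI) (simp_all add: mm.add_right mm.scaleR_right)
  then have "subspace ((\<lambda>X. mat \<i> ** X) ` lie U)" by (rule linear_subspace_image) (rule subspace_lie[OF group_U closed_U])
  then show ?thesis unfolding pspace_def by (intro subspace_inter subspace_g)
qed

lemma p_g: "X \<in> \<pp> \<Longrightarrow> X \<in> \<gg>"
  by (simp add: pspace_def)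

lemma polar_bij: "bij_betw (\<lambda>(k, X). k ** mexp X) (K \<times> \<pp>) G"
  and polar_smooth: "smooth_map_on G (inv_into (K \<times> \<pp>) (\<lambda>(k, X). k ** mexp X))"
  using real_reductive by (simp_all add: real_reductive_def diffeomorphism_between_def)

lemma polar:
  assumes "g \<in> G"
  obtains k X where "k \<in> K" "X \<in> \<pp>" "g = k ** mexp X"
proof -
  have "g \<in> (\<lambda>(k, X). k ** mexp X) ` (K \<times> \<pp>)" using assms bij_betw_imp_surj_on[OF polar_bij] by simp
  then obtain x where "x \<in> K \<times> \<pp>" "g = fst x ** mexp (snd x)" by (auto simp: case_prod_beta)
  then show ?thesis using that[of "fst x" "snd x"] by auto
qed

text \<open>
  Differentiate the inverse of the polar map at the identity along \<open>mexp (s E)\<close>; this uses the differentiability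
  of that inverse, which is defined on \<open>G\<close>, through its local extension to matrices.
\<close>

lemma cartan_decomposition:
  assumes E: "E \<in> \<gg>"
  obtains Z X where "Z \<in> lie K" "X \<in> \<pp>" "E = Z + X"
proof -
  define f where "f = (\<lambda>(k, X). k ** mexp X :: 'n cmat)"
  define fi where "fi = inv_into (K \<times> \<pp>) f"
  have K1: "mat 1 \<in> K" using group_K by (simp add: matrix_group_def)
  have p0: "0 \<in> \<pp>" using subspace_p by (rule subspace_0)
  have fi1: "fi (mat 1) = (mat 1, 0)"
  proof -
    have "f (mat 1, 0) = mat 1" by (simp add: f_def)
    moreover have "inj_on f (K \<times> \<pp>)" using polar_bij by (simp add: f_def bij_betw_def)
    ultimately show ?thesis unfolding fi_def using K1 p0 by (metis SigmaI inv_into_f_f)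
  qed
  obtain N h where N: "open N" "mat 1 \<in> N" "\<And>k. Ck_on k h N" "\<And>y. y \<in> N \<inter> G \<Longrightarrow> h y = fi y"
    using polar_smooth G_one unfolding smooth_map_on_def fi_def f_def by metis
  have "h differentiable_on N" using N(3)[of "Suc 0"] by simp
  then have "h differentiable (at (mat 1))" using N(1,2) by (simp add: differentiable_on_eq_differentiable_at)
  then obtain D where D: "(h has_derivative D) (at (mat 1))" by (auto simp: differentiable_def)
  \<comment> \<open>the shift avoids a separate case for the scale 0\<close>
  define s where "s n = real (Suc n)" for n
  have s: "filterlim s at_top sequentially"
    unfolding s_def using filterlim_real_sequentially filterlim_sequentially_Suc by blast
  have sp: "s n > 0" for n by (simp add: s_def)
  have i0: "(\<lambda>n. 1 / s n) \<longlonglongrightarrow> 0"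
    using tendsto_inverse_0_at_top[OF s] by (simp add: inverse_eq_divide)
  define a where "a n = mexp ((1 / s n) *\<^sub>R E)" for n
  have aG: "a n \<in> G" for n unfolding a_def by (rule lie_mexp_scaleR[OF E])
  have la: "(\<lambda>n. s n *\<^sub>R (a n - mat 1)) \<longlonglongrightarrow> E"
    unfolding a_def by (rule mexp_scaled_tendsto[OF tendsto_const s])
  have "(\<lambda>n. (1 / s n) *\<^sub>R (s n *\<^sub>R (a n - mat 1)) + mat 1) \<longlonglongrightarrow> 0 *\<^sub>R E + mat 1"
    by (intro tendsto_intros i0 la)
  then have la1: "a \<longlonglongrightarrow> mat 1" using sp by (simp add: less_imp_neq[symmetric])
  define k X where "k n = fst (fi (a n))" and "X n = snd (fi (a n))" for n
  have kX: "k n \<in> K" "X n \<in> \<pp>" "a n = k n ** mexp (X n)" for n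
  proof -
    have im: "a n \<in> f ` (K \<times> \<pp>)" using aG[of n] bij_betw_imp_surj_on[OF polar_bij] by (simp add: f_def)
    have "fi (a n) \<in> K \<times> \<pp>" unfolding fi_def by (rule inv_into_into[OF im])
    then show "k n \<in> K" "X n \<in> \<pp>" by (auto simp: k_def X_def)
    have "f (fi (a n)) = a n" unfolding fi_def by (rule f_inv_into_f[OF im])
    then show "a n = k n ** mexp (X n)" by (simp add: f_def k_def X_def case_prod_beta)
  qed
  have "\<forall>\<^sub>F n in sequentially. a n \<in> N" using la1 N(1,2) by (rule topological_tendstoD)
  then have ev: "\<forall>\<^sub>F n in sequentially. s n *\<^sub>R (h (a n) - h (mat 1)) = s n *\<^sub>R ((k n, X n) - (mat 1, 0))"
  proof eventually_elim
    case (elim n)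
    have "h (mat 1) = (mat 1, 0)" using N(2,4) G_one fi1 by simp
    moreover have "h (a n) = (k n, X n)" using elim N(4) aG by (simp add: k_def X_def)
    ultimately show ?case by simp
  qed
  from Lim_transform_eventually[OF has_derivative_scaled_tendsto[OF D s la] ev]
  have lim: "(\<lambda>n. s n *\<^sub>R ((k n, X n) - (mat 1, 0))) \<longlonglongrightarrow> D E" .
  have lk: "(\<lambda>n. s n *\<^sub>R (k n - mat 1)) \<longlonglongrightarrow> fst (D E)" using tendsto_fst[OF lim] by simp
  have lX: "(\<lambda>n. s n *\<^sub>R X n) \<longlonglongrightarrow> snd (D E)" using tendsto_snd[OF lim] by simp
  have Z: "fst (D E) \<in> lie K" by (rule tangent_in_lie[OF group_K closed_K kX(1) s lk])
  have X: "snd (D E) \<in> \<pp>"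
  proof (rule closed_sequentially[OF closed_subspace[OF subspace_p] _ lX])
    show "s n *\<^sub>R X n \<in> \<pp>" for n using kX(2) subspace_p by (simp add: subspace_scale)
  qed
  have lm: "(\<lambda>n. s n *\<^sub>R (mexp (X n) - mat 1)) \<longlonglongrightarrow> snd (D E)"
    using mexp_scaled_tendsto[OF lX s] sp by (simp add: less_imp_neq[symmetric])
  have "(\<lambda>n. s n *\<^sub>R (a n - mat 1)) \<longlonglongrightarrow> fst (D E) + snd (D E)"
    unfolding kX(3) by (rule scaled_product_tendsto[OF s lk lm])
  then have "E = fst (D E) + snd (D E)" using la LIMSEQ_unique by blast
  then show ?thesis using that Z X by blast
qed

lemma B_invariant: "is_invariant_form U B"
  unfolding invariant_form_def by (rule someI_ex[OF compact_group_invariant_form[OF group_U compact_U]])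

lemma bilinear_B: "bilinear B" and B_sym: "B x y = B y x" and B_pos: "x \<noteq> 0 \<Longrightarrow> 0 < B x x"
  using B_invariant by (simp_all add: is_invariant_form_def)

lemma bounded_bilinear_B: "bounded_bilinear B"
  using bilinear_B bilinear_conv_bounded_bilinear by blast

sublocale BB: bounded_bilinear B by (rule bounded_bilinear_B)

lemma B_i: "B (mat \<i> ** x) y = - B x (mat \<i> ** y)"
proof -
  have "mat \<i> ** mat \<i> = (- mat 1 :: 'n cmat)"
    by (simp add: vec_eq_iff matrix_matrix_mult_def mat_def mult_delta_left)
  then have "mat \<i> ** (mat \<i> ** x) = - x" by (simp add: matrix_mul_assoc mm.minus_left)
  moreover have "B (mat \<i> ** (mat \<i> ** x)) (mat \<i> ** y) = B (mat \<i> ** x) y" using B_invariant by (simp add: is_invariant_form_def)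
  ultimately show ?thesis by (simp add: BB.minus_left)
qed

text \<open>
  Elements of \<open>lie U\<close> act skew-symmetrically because \<open>U\<close> acts by isometries, and multiplication by \<open>\<i>\<close> turns skew into
  symmetric operators.
\<close>

lemma B_p_left:
  assumes X: "X \<in> \<pp>"
  shows "B (X ** M) N = B M (X ** N)"
proof -
  obtain Y where Y: "Y \<in> lie U" "X = mat \<i> ** Y" using X by (auto simp: pspace_def)
  have "((\<lambda>t. B (mexp (t *\<^sub>R Y) ** M) (mexp (t *\<^sub>R Y) ** N')) has_vector_derivative
     B (mexp (0 *\<^sub>R Y) ** M) (mexp (0 *\<^sub>R Y) ** 0 + (Y ** mexp (0 *\<^sub>R Y)) ** N')
     + B (mexp (0 *\<^sub>R Y) ** 0 + (Y ** mexp (0 *\<^sub>R Y)) ** M) (mexp (0 *\<^sub>R Y) ** N')) (at 0 within UNIV)" for N'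
    by (intro BB.has_vector_derivative mm.has_vector_derivative mexp_has_vector_derivative has_vector_derivative_const)
  then have d: "((\<lambda>t. B (mexp (t *\<^sub>R Y) ** M) (mexp (t *\<^sub>R Y) ** N')) has_vector_derivative
     B M (Y ** N') + B (Y ** M) N') (at 0)" for N' by (simp add: mm.zero_right)
  have "B (mexp (t *\<^sub>R Y) ** M) (mexp (t *\<^sub>R Y) ** N') = B M N'" for t N'
    using B_invariant lie_mexp_scaleR[OF Y(1)] by (simp add: is_invariant_form_def)
  then have "((\<lambda>t. B M N') has_vector_derivative B M (Y ** N') + B (Y ** M) N') (at (0::real))" for N' using d by simp
  then have skew: "B M (Y ** N') + B (Y ** M) N' = 0" for N'
    using vector_derivative_unique_at[OF _ has_vector_derivative_const] by blast
  have "B (X ** M) N = - B (Y ** M) (mat \<i> ** N)" unfolding Y(2) by (simp add: matrix_mul_assoc[symmetric] B_i)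
  also have "\<dots> = B M (Y ** (mat \<i> ** N))" using skew[of "mat \<i> ** N"] by simp
  also have "Y ** (mat \<i> ** N) = X ** N" unfolding Y(2) by (simp add: matrix_mul_assoc mat_commute[of \<i> Y])
  finally show ?thesis .
qed

lemma B_p_right:
  assumes X: "X \<in> \<pp>"
  shows "B (M ** X) N = B M (N ** X)"
proof -
  obtain Y where Y: "Y \<in> lie U" "X = mat \<i> ** Y" using X by (auto simp: pspace_def)
  have "((\<lambda>t. B (M ** mexp (t *\<^sub>R Y)) (N' ** mexp (t *\<^sub>R Y))) has_vector_derivative
     B (M ** mexp (0 *\<^sub>R Y)) (N' ** (Y ** mexp (0 *\<^sub>R Y)) + 0 ** mexp (0 *\<^sub>R Y))
     + B (M ** (Y ** mexp (0 *\<^sub>R Y)) + 0 ** mexp (0 *\<^sub>R Y)) (N' ** mexp (0 *\<^sub>R Y))) (at 0 within UNIV)" for N'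
    by (intro BB.has_vector_derivative mm.has_vector_derivative mexp_has_vector_derivative has_vector_derivative_const)
  then have d: "((\<lambda>t. B (M ** mexp (t *\<^sub>R Y)) (N' ** mexp (t *\<^sub>R Y))) has_vector_derivative
     B M (N' ** Y) + B (M ** Y) N') (at 0)" for N' by (simp add: mm.zero_left)
  have "B (M ** mexp (t *\<^sub>R Y)) (N' ** mexp (t *\<^sub>R Y)) = B M N'" for t N'
    using B_invariant lie_mexp_scaleR[OF Y(1)] by (simp add: is_invariant_form_def)
  then have "((\<lambda>t. B M N') has_vector_derivative B M (N' ** Y) + B (M ** Y) N') (at (0::real))" for N' using d by simp
  then have skew: "B M (N' ** Y) + B (M ** Y) N' = 0" for N'
    using vector_derivative_unique_at[OF _ has_vector_derivative_const] by blast
  have "B (M ** X) N = B (mat \<i> ** (M ** Y)) N" unfolding Y(2) by (simp add: matrix_mul_assoc mat_commute[of \<i> M])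
  also have "\<dots> = - B (M ** Y) (mat \<i> ** N)" by (rule B_i)
  also have "\<dots> = B M ((mat \<i> ** N) ** Y)" using skew[of "mat \<i> ** N"] by simp
  also have "(mat \<i> ** N) ** Y = N ** X" unfolding Y(2) by (simp add: matrix_mul_assoc mat_commute[of \<i> N])
  finally show ?thesis .
qed

lemma B_mexp_p_left:
  assumes X: "X \<in> \<pp>"
  shows "B (mexp X ** M) N = B M (mexp X ** N)"
proof -
  have pow: "B (mpow X k ** M) N = B M (mpow X k ** N)" for k M N
  proof (induction k arbitrary: M N)
    case (Suc k)
    have "B (mpow X (Suc k) ** M) N = B (mpow X k ** M) (X ** N)"
      using B_p_left[OF X, of "mpow X k ** M" N] by (simp add: matrix_mul_assoc)
    also have "\<dots> = B M (mpow X k ** (X ** N))" by (rule Suc)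
    also have "mpow X k ** (X ** N) = mpow X (Suc k) ** N" by (simp add: matrix_mul_assoc mpow_intertwine[OF refl])
    finally show ?case .
  qed simp
  have "(\<lambda>k. B (((1 / fact k) *\<^sub>R mpow X k) ** M) N) sums B (mexp X ** M) N"
    by (intro bounded_linear.sums[OF BB.bounded_linear_left] bounded_linear.sums[OF mm.bounded_linear_left] mexp_sums)
  moreover have "(\<lambda>k. B M (((1 / fact k) *\<^sub>R mpow X k) ** N)) sums B M (mexp X ** N)"
    by (intro bounded_linear.sums[OF BB.bounded_linear_right] bounded_linear.sums[OF mm.bounded_linear_left] mexp_sums)
  moreover have "B (((1 / fact k) *\<^sub>R mpow X k) ** M) N = B M (((1 / fact k) *\<^sub>R mpow X k) ** N)" for k
    by (simp add: mm.scaleR_left BB.scaleR_left BB.scaleR_right pow)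
  ultimately show ?thesis using sums_unique2 by simp
qed

text \<open>
  The bracket of two symmetric elements is skew-symmetric, and as an element of \<open>\<pp>\<close> it is also symmetric.
\<close>

lemma subalgebra_of_p_commutes:
  assumes a: "lie_subalgebra \<aa> \<gg>" "\<aa> \<subseteq> \<pp>" and X: "X \<in> \<aa>" and Y: "Y \<in> \<aa>"
  shows "X ** Y = Y ** X"
proof -
  let ?Z = "bracket X Y"
  have Z: "?Z \<in> \<pp>" using a X Y by (auto simp: lie_subalgebra_def)
  have XY: "X \<in> \<pp>" "Y \<in> \<pp>" using a X Y by auto
  have "B ?Z ?Z = B (?Z ** mat 1) ?Z" by simp
  also have "\<dots> = B (mat 1) (?Z ** ?Z)" by (rule B_p_left[OF Z])
  also have "\<dots> = B (mat 1) (X ** (Y ** ?Z)) - B (mat 1) (Y ** (X ** ?Z))"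
    by (simp add: bracket_def mm.diff_left BB.diff_right[symmetric] matrix_mul_assoc)
  also have "\<dots> = B (Y ** (X ** mat 1)) ?Z - B (X ** (Y ** mat 1)) ?Z"
    by (simp only: B_p_left[OF XY(1)] B_p_left[OF XY(2)])
  also have "\<dots> = - B ?Z ?Z" by (simp add: bracket_def BB.diff_left)
  finally have "?Z = 0" using B_pos[of ?Z] by force
  then show ?thesis by (simp add: bracket_def)
qed

end

section \<open>The infinitesimal representation\<close>

lemma linear_Basis_expansion:
  fixes f :: "'a::euclidean_space \<Rightarrow> 'b::real_vector"
  assumes "linear f"
  shows "f y = (\<Sum>b\<in>Basis. (y \<bullet> b) *\<^sub>R f b)"
proof -
  have "f (\<Sum>b\<in>Basis. (y \<bullet> b) *\<^sub>R b) = (\<Sum>b\<in>Basis. (y \<bullet> b) *\<^sub>R f b)"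
    by (simp add: linear_sum[OF assms] linear_scale[OF assms])
  then show ?thesis by (simp add: euclidean_representation)
qed

context reductive_rep
begin

abbreviation "\<pi> \<equiv> drep \<tau>"

lemma \<tau>_linear: "g \<in> G \<Longrightarrow> linear (\<tau> g)" and \<tau>_one: "\<tau> (mat 1) v = v"
  and \<tau>_mult: "g \<in> G \<Longrightarrow> h \<in> G \<Longrightarrow> \<tau> (g ** h) v = \<tau> g (\<tau> h v)"
  using rational by (simp_all add: rational_representation_def representation_def)

lemma \<tau>_inv: "g \<in> G \<Longrightarrow> \<tau> (matrix_inv g) (\<tau> g v) = v"
  using G_inv \<tau>_mult[of "matrix_inv g" g v] by (simp add: \<tau>_one)

lemma \<tau>_eq_0: "g \<in> G \<Longrightarrow> \<tau> g v = 0 \<longleftrightarrow> v = 0"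
  by (metis \<tau>_inv \<tau>_linear linear_0 G_inv(1))

lemma \<tau>_mexp_add: "X \<in> \<gg> \<Longrightarrow> \<tau> (mexp ((s + t) *\<^sub>R X)) v = \<tau> (mexp (s *\<^sub>R X)) (\<tau> (mexp (t *\<^sub>R X)) v)"
  by (simp add: mexp_add_scaleR \<tau>_mult lie_mexp_scaleR)

text \<open>
  As \<open>G\<close> is not an open set of matrices, the orbit map of \<open>v\<close> is differentiated through its extension by a rational
  function.
\<close>

lemma \<tau>_extends:
  "\<exists>\<Phi>. (\<forall>g. invertible g \<longrightarrow> \<Phi> differentiable (at g)) \<and> (\<forall>g\<in>G. \<tau> g v = \<Phi> g)"
proof -
  have "\<forall>y. \<exists>q :: 'n cmat \<times> complex \<Rightarrow> real. real_polynomial_function q \<and> (\<forall>g\<in>G. \<tau> g v \<bullet> y = q (g, 1 / det g))"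
    using rational by (simp add: rational_representation_def)
  then obtain q :: "'v \<Rightarrow> 'n cmat \<times> complex \<Rightarrow> real"
    where q: "\<forall>y. real_polynomial_function (q y) \<and> (\<forall>g\<in>G. \<tau> g v \<bullet> y = q y (g, 1 / det g))"
    by metis
  define \<Phi> where "\<Phi> g = (\<Sum>b\<in>Basis. q b (g, 1 / det g) *\<^sub>R b)" for g
  have d: "\<Phi> differentiable (at g)" if "invertible g" for g
  proof -
    have "det g \<noteq> 0" using that invertible_det_nz by blast
    then have "(\<lambda>g. (g, 1 / det g)) differentiable (at g)"
      by (intro differentiable_Pair differentiable_ident differentiable_divide differentiable_const det_differentiable)
    moreover have "q b differentiable (at (g, 1 / det g))" for b
      using q by (intro differentiable_at_real_polynomial_function) blast
    ultimately have "(q b \<circ> (\<lambda>g. (g, 1 / det g))) differentiable (at g)" for b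
      by (intro differentiable_chain_at) simp_all
    then have "(\<lambda>g. q b (g, 1 / det g)) differentiable (at g)" for b by (simp add: o_def)
    then show ?thesis unfolding \<Phi>_def by (intro differentiable_sum differentiable_scaleR differentiable_const) auto
  qed
  have e: "\<tau> g v = \<Phi> g" if "g \<in> G" for g
  proof -
    have "\<tau> g v = (\<Sum>b\<in>Basis. (\<tau> g v \<bullet> b) *\<^sub>R b)" by (simp add: euclidean_representation)
    then show ?thesis using q that by (simp add: \<Phi>_def)
  qed
  show ?thesis using d e by blast
qed

lemma \<tau>_tendsto:
  assumes g: "\<And>n. g n \<in> G" "(g \<longlongrightarrow> h) F" "h \<in> G" and v: "(x \<longlongrightarrow> v) F"
  shows "((\<lambda>n. \<tau> (g n) (x n)) \<longlongrightarrow> \<tau> h v) F"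
proof -
  have b: "((\<lambda>n. \<tau> (g n) b) \<longlongrightarrow> \<tau> h b) F" for b
  proof -
    obtain \<Phi> where \<Phi>: "\<forall>g. invertible g \<longrightarrow> \<Phi> differentiable (at g)" "\<forall>g\<in>G. \<tau> g b = \<Phi> g"
      using \<tau>_extends by blast
    have "invertible h" using g(3) group_G by (simp add: matrix_group_def)
    then have "isCont \<Phi> h" using \<Phi>(1) differentiable_imp_continuous_within by blast
    from isCont_tendsto_compose[OF this g(2)] show ?thesis using \<Phi>(2) g by simp
  qed
  note e = linear_Basis_expansion[OF \<tau>_linear]
  have "((\<lambda>n. \<Sum>b\<in>Basis. (x n \<bullet> b) *\<^sub>R \<tau> (g n) b) \<longlongrightarrow> (\<Sum>b\<in>Basis. (v \<bullet> b) *\<^sub>R \<tau> h b)) F"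
    by (intro tendsto_intros b v)
  moreover have e1: "\<tau> (g n) (x n) = (\<Sum>b\<in>Basis. (x n \<bullet> b) *\<^sub>R \<tau> (g n) b)" for n by (rule e[OF g(1)])
  moreover have e3: "\<tau> h v = (\<Sum>b\<in>Basis. (v \<bullet> b) *\<^sub>R \<tau> h b)" by (rule e[OF g(3)])
  ultimately show ?thesis unfolding e1 e3 by blast
qed

text \<open>
  One linear map \<open>D\<close> computes \<open>\<pi> X v\<close> for all \<open>X\<close>, whence the linearity of \<open>\<pi> X v\<close> in \<open>X\<close>.
\<close>

lemma orbit_map_derivative:
  "\<exists>\<Phi> D. (\<Phi> has_derivative D) (at (mat 1)) \<and> (\<forall>g\<in>G. \<tau> g v = \<Phi> g)
      \<and> (\<forall>X\<in>\<gg>. ((\<lambda>t. \<tau> (mexp (t *\<^sub>R X)) v) has_vector_derivative D X) (at 0) \<and> \<pi> X v = D X)"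
proof -
  obtain \<Phi> where \<Phi>: "\<forall>g. invertible g \<longrightarrow> \<Phi> differentiable (at g)" "\<forall>g\<in>G. \<tau> g v = \<Phi> g"
    using \<tau>_extends by blast
  have "invertible (mat 1 :: 'n cmat)" using group_G by (simp add: matrix_group_def)
  then obtain D where D: "(\<Phi> has_derivative D) (at (mat 1))" using \<Phi>(1) by (auto simp: differentiable_def)
  interpret D: bounded_linear D using D by (rule has_derivative_bounded_linear)
  have "((\<lambda>t. \<tau> (mexp (t *\<^sub>R X)) v) has_vector_derivative D X) (at 0) \<and> \<pi> X v = D X" if X: "X \<in> \<gg>" for X
  proof -
    have m: "((\<lambda>t. mexp (t *\<^sub>R X)) has_derivative (\<lambda>h. h *\<^sub>R X)) (at 0)"
      using mexp_has_vector_derivative[of X 0 UNIV] by (simp add: has_vector_derivative_def)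
    have "((\<lambda>t. \<Phi> (mexp (t *\<^sub>R X))) has_derivative (\<lambda>h. D (h *\<^sub>R X))) (at 0)"
      by (rule has_derivative_compose[OF m]) (use D in simp)
    moreover have "\<Phi> (mexp (t *\<^sub>R X)) = \<tau> (mexp (t *\<^sub>R X)) v" for t
      using \<Phi>(2) lie_mexp_scaleR[OF X] by simp
    ultimately have "((\<lambda>t. \<tau> (mexp (t *\<^sub>R X)) v) has_vector_derivative D X) (at 0)"
      by (simp add: has_vector_derivative_def D.scaleR)
    then show ?thesis unfolding drep_def by (simp add: vector_derivative_at)
  qed
  then show ?thesis using D \<Phi>(2) by blast
qed

lemma \<pi>_has_vector_derivative_0:
  "X \<in> \<gg> \<Longrightarrow> ((\<lambda>t. \<tau> (mexp (t *\<^sub>R X)) v) has_vector_derivative \<pi> X v) (at 0)"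
  using orbit_map_derivative[of v] by auto

lemma \<pi>_add: "X \<in> \<gg> \<Longrightarrow> Y \<in> \<gg> \<Longrightarrow> \<pi> (X + Y) v = \<pi> X v + \<pi> Y v"
  and \<pi>_scaleR: "X \<in> \<gg> \<Longrightarrow> \<pi> (c *\<^sub>R X) v = c *\<^sub>R \<pi> X v"
proof -
  obtain \<Phi> D where D: "(\<Phi> has_derivative D) (at (mat 1))" "\<forall>X\<in>\<gg>. \<pi> X v = D X"
    using orbit_map_derivative[of v] by blast
  interpret D: bounded_linear D using D(1) by (rule has_derivative_bounded_linear)
  show "X \<in> \<gg> \<Longrightarrow> Y \<in> \<gg> \<Longrightarrow> \<pi> (X + Y) v = \<pi> X v + \<pi> Y v" "X \<in> \<gg> \<Longrightarrow> \<pi> (c *\<^sub>R X) v = c *\<^sub>R \<pi> X v"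
    using D(2) subspace_g by (simp_all add: subspace_add subspace_scale D.add D.scaleR)
qed

lemma \<pi>_linear:
  assumes X: "X \<in> \<gg>"
  shows "linear (\<pi> X)"
proof (rule linearI)
  note d = \<pi>_has_vector_derivative_0[OF X]
  have l: "linear (\<tau> (mexp (t *\<^sub>R X)))" for t by (rule \<tau>_linear[OF lie_mexp_scaleR[OF X]])
  show "\<pi> X (v + w) = \<pi> X v + \<pi> X w" for v w
    using vector_derivative_unique_at[OF d[of "v + w"]] has_vector_derivative_add[OF d[of v] d[of w]]
    by (simp add: linear_add[OF l])
  show "\<pi> X (c *\<^sub>R v) = c *\<^sub>R \<pi> X v" for c v
    using vector_derivative_unique_at[OF d[of "c *\<^sub>R v"]] has_vector_derivative_scaleR[OF DERIV_const d[of v], of c]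
    by (simp add: linear_scale[OF l])
qed

lemma \<pi>_bounded_linear: "X \<in> \<gg> \<Longrightarrow> bounded_linear (\<pi> X)"
  using \<pi>_linear linear_conv_bounded_linear by blast

text \<open>
  Unlike in the definition of \<open>\<pi>\<close>, the vector moves together with the group element.
\<close>

lemma \<tau>_first_order:
  assumes g: "\<And>n. g n \<in> G" and s: "filterlim s at_top F"
    and l: "((\<lambda>n. s n *\<^sub>R (g n - mat 1)) \<longlongrightarrow> E) F" and E: "E \<in> \<gg>" and x: "(x \<longlongrightarrow> v) F"
  shows "((\<lambda>n. s n *\<^sub>R (\<tau> (g n) (x n) - x n)) \<longlongrightarrow> \<pi> E v) F"
proof -
  have b: "((\<lambda>n. s n *\<^sub>R (\<tau> (g n) b - b)) \<longlongrightarrow> \<pi> E b) F" for b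
  proof -
    obtain \<Phi> D where D: "(\<Phi> has_derivative D) (at (mat 1))" "\<forall>X\<in>\<gg>. \<pi> X b = D X" "\<forall>g\<in>G. \<tau> g b = \<Phi> g"
      using orbit_map_derivative[of b] by blast
    have "\<Phi> (mat 1) = b" using D(3) G_one \<tau>_one by metis
    then show ?thesis using has_derivative_scaled_tendsto[OF D(1) s l] D(2,3) E g by simp
  qed
  note e = linear_Basis_expansion[OF \<tau>_linear]
  have e2: "s n *\<^sub>R (\<tau> (g n) (x n) - x n) = (\<Sum>b\<in>Basis. (x n \<bullet> b) *\<^sub>R (s n *\<^sub>R (\<tau> (g n) b - b)))" for n
  proof -
    define y where "y = x n"
    have "\<tau> (g n) y - y = \<tau> (g n) y - (\<Sum>b\<in>Basis. (y \<bullet> b) *\<^sub>R b)" by (simp add: euclidean_representation)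
    also have "\<dots> = (\<Sum>b\<in>Basis. (y \<bullet> b) *\<^sub>R (\<tau> (g n) b - b))"
      by (subst e[OF g]) (simp add: sum_subtractf scaleR_diff_right)
    finally show ?thesis by (simp add: scaleR_sum_right mult.commute y_def)
  qed
  have "((\<lambda>n. \<Sum>b\<in>Basis. (x n \<bullet> b) *\<^sub>R (s n *\<^sub>R (\<tau> (g n) b - b))) \<longlongrightarrow> (\<Sum>b\<in>Basis. (v \<bullet> b) *\<^sub>R \<pi> E b)) F"
    by (intro tendsto_sum tendsto_scaleR tendsto_inner x tendsto_const b)
  moreover have "(\<Sum>b\<in>Basis. (v \<bullet> b) *\<^sub>R \<pi> E b) = \<pi> E v" by (rule linear_Basis_expansion[OF \<pi>_linear[OF E], symmetric])
  ultimately show ?thesis unfolding e2 by simp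
qed

lemma \<tau>_curve_derivative:
  assumes X: "X \<in> \<gg>"
  shows "((\<lambda>t. \<tau> (mexp (t *\<^sub>R X)) v) has_vector_derivative \<pi> X (\<tau> (mexp (t *\<^sub>R X)) v)) (at t)"
    and "\<pi> X (\<tau> (mexp (t *\<^sub>R X)) v) = \<tau> (mexp (t *\<^sub>R X)) (\<pi> X v)"
proof -
  let ?c = "\<lambda>t. \<tau> (mexp (t *\<^sub>R X)) v"
  have sh: "((\<lambda>s. s - t) has_vector_derivative 1) (at t)" by (auto intro!: derivative_eq_intros)
  have "((\<lambda>s. \<tau> (mexp ((s - t) *\<^sub>R X)) (?c t)) has_vector_derivative 1 *\<^sub>R \<pi> X (?c t)) (at t)"
    using vector_diff_chain_at[OF sh, of "\<lambda>t'. \<tau> (mexp (t' *\<^sub>R X)) (?c t)"] \<pi>_has_vector_derivative_0[OF X, of "?c t"]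
    by (simp add: o_def)
  moreover have "\<tau> (mexp ((s - t) *\<^sub>R X)) (?c t) = ?c s" for s
    using \<tau>_mexp_add[OF X, of "s - t" t v] by simp
  ultimately show 1: "(?c has_vector_derivative \<pi> X (?c t)) (at t)" by simp
  have "bounded_linear (\<tau> (mexp (t *\<^sub>R X)))"
    using \<tau>_linear[OF lie_mexp_scaleR[OF X]] linear_conv_bounded_linear by blast
  from bounded_linear.has_vector_derivative[OF this \<pi>_has_vector_derivative_0[OF X, of v]]
  have "((\<lambda>s. \<tau> (mexp (t *\<^sub>R X)) (?c s)) has_vector_derivative \<tau> (mexp (t *\<^sub>R X)) (\<pi> X v)) (at 0)" .
  moreover have "\<tau> (mexp (t *\<^sub>R X)) (?c s) = \<tau> (mexp (s *\<^sub>R X)) (?c t)" for s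
    using \<tau>_mexp_add[OF X, of s t v] \<tau>_mexp_add[OF X, of t s v] by (simp add: add.commute)
  ultimately have "((\<lambda>s. \<tau> (mexp (s *\<^sub>R X)) (?c t)) has_vector_derivative \<tau> (mexp (t *\<^sub>R X)) (\<pi> X v)) (at 0)" by simp
  from vector_derivative_unique_at[OF this \<pi>_has_vector_derivative_0[OF X]]
  show "\<pi> X (?c t) = \<tau> (mexp (t *\<^sub>R X)) (\<pi> X v)" by simp
qed

lemma \<tau>_eigen:
  assumes X: "X \<in> \<gg>" and e: "\<pi> X v = c *\<^sub>R v"
  shows "\<tau> (mexp (t *\<^sub>R X)) v = exp (t * c) *\<^sub>R v"
proof -
  define f where "f t = exp (- (t * c)) *\<^sub>R \<tau> (mexp (t *\<^sub>R X)) v" for t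
  have d2: "((\<lambda>t. exp (- (t * c))) has_real_derivative - c * exp (- (t * c))) (at t)" for t
    by (auto intro!: derivative_eq_intros)
  have "(f has_vector_derivative 0) (at t within UNIV)" for t
  proof -
    have "(f has_vector_derivative exp (- (t * c)) *\<^sub>R \<pi> X (\<tau> (mexp (t *\<^sub>R X)) v)
        + (- c * exp (- (t * c))) *\<^sub>R \<tau> (mexp (t *\<^sub>R X)) v) (at t)"
      unfolding f_def by (intro has_vector_derivative_scaleR \<tau>_curve_derivative(1)[OF X] d2)
    moreover have "\<pi> X (\<tau> (mexp (t *\<^sub>R X)) v) = c *\<^sub>R \<tau> (mexp (t *\<^sub>R X)) v"
      using linear_scale[OF \<tau>_linear[OF lie_mexp_scaleR[OF X]]] by (simp add: \<tau>_curve_derivative(2)[OF X] e)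
    ultimately show ?thesis by (simp add: mult.commute)
  qed
  then have "f t = f 0" using has_vector_derivative_zero_constant[of UNIV f] by (metis UNIV_I convex_UNIV)
  then have "exp (t * c) *\<^sub>R f t = exp (t * c) *\<^sub>R v" by (simp add: f_def \<tau>_one)
  then show ?thesis by (simp add: f_def exp_minus)
qed

text \<open>
  Differentiate \<open>\<tau> g (\<tau> (mexp (t X)) v) = \<tau> (mexp (t Y)) (\<tau> g v)\<close>. The hypothesis covers the adjoint action as
  well as elements \<open>g = mexp H\<close> that scale \<open>X\<close> by conjugation.
\<close>

lemma \<pi>_equivariant:
  assumes g: "g \<in> G" and X: "X \<in> \<gg>" and Y: "Y \<in> \<gg>" and c: "Y ** g = g ** X"
  shows "\<pi> Y (\<tau> g v) = \<tau> g (\<pi> X v)"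
proof -
  have "bounded_linear (\<tau> g)" using \<tau>_linear[OF g] linear_conv_bounded_linear by blast
  from bounded_linear.has_vector_derivative[OF this \<pi>_has_vector_derivative_0[OF X, of v]]
  have "((\<lambda>t. \<tau> g (\<tau> (mexp (t *\<^sub>R X)) v)) has_vector_derivative \<tau> g (\<pi> X v)) (at 0)" .
  moreover have "\<tau> g (\<tau> (mexp (t *\<^sub>R X)) v) = \<tau> (mexp (t *\<^sub>R Y)) (\<tau> g v)" for t
  proof -
    have "mexp (t *\<^sub>R Y) ** g = g ** mexp (t *\<^sub>R X)"
      by (rule mexp_intertwine) (simp add: mm.scaleR_left mm.scaleR_right c)
    then show ?thesis
      by (simp only: \<tau>_mult[OF g lie_mexp_scaleR[OF X], symmetric] \<tau>_mult[OF lie_mexp_scaleR[OF Y] g, symmetric])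
  qed
  ultimately have "((\<lambda>t. \<tau> (mexp (t *\<^sub>R Y)) (\<tau> g v)) has_vector_derivative \<tau> g (\<pi> X v)) (at 0)" by simp
  from vector_derivative_unique_at[OF this \<pi>_has_vector_derivative_0[OF Y]] show ?thesis by simp
qed

lemma \<pi>_commute:
  assumes X: "X \<in> \<gg>" and Y: "Y \<in> \<gg>" and c: "X ** Y = Y ** X"
  shows "\<pi> X (\<pi> Y v) = \<pi> Y (\<pi> X v)"
proof -
  have 1: "\<pi> Y (\<tau> (mexp (t *\<^sub>R X)) v) = \<tau> (mexp (t *\<^sub>R X)) (\<pi> Y v)" for t
    by (rule \<pi>_equivariant[OF lie_mexp_scaleR[OF X] Y Y], rule mexp_intertwine[symmetric])
      (simp add: mm.scaleR_left mm.scaleR_right c)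
  have "((\<lambda>t. \<pi> Y (\<tau> (mexp (t *\<^sub>R X)) v)) has_vector_derivative \<pi> Y (\<pi> X v)) (at 0)"
    by (rule bounded_linear.has_vector_derivative[OF \<pi>_bounded_linear[OF Y] \<pi>_has_vector_derivative_0[OF X]])
  then have "((\<lambda>t. \<tau> (mexp (t *\<^sub>R X)) (\<pi> Y v)) has_vector_derivative \<pi> Y (\<pi> X v)) (at 0)" by (simp only: 1)
  from vector_derivative_unique_at[OF this \<pi>_has_vector_derivative_0[OF X]] show ?thesis by simp
qed

lemma \<tau>_\<pi>_bracket:
  assumes X: "X \<in> \<gg>" and E: "E \<in> \<gg>" and b: "bracket X E = c *\<^sub>R E"
  shows "\<tau> (mexp X) (\<pi> E v) = exp c *\<^sub>R \<pi> E (\<tau> (mexp X) v)"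
proof -
  have "\<pi> (exp c *\<^sub>R E) (\<tau> (mexp X) v) = \<tau> (mexp X) (\<pi> E v)"
    by (rule \<pi>_equivariant[OF lie_mexp[OF X] E lie_scaleR[OF E]])
      (use mexp_bracket_eigen[OF b, of 1] in \<open>simp add: mm.scaleR_left mm.scaleR_right\<close>)
  then show ?thesis by (simp add: \<pi>_scaleR[OF E])
qed

lemma K_isometry: "k \<in> K \<Longrightarrow> \<tau> k v \<bullet> \<tau> k w = v \<bullet> w" and \<pi>_sym: "X \<in> \<pp> \<Longrightarrow> \<pi> X v \<bullet> w = v \<bullet> \<pi> X w"
  using compatV by (simp_all add: compatible_inner_on_V_def)

lemma lie_K_g: "Z \<in> lie K \<Longrightarrow> Z \<in> \<gg>"
  by (auto simp: lie_def kgroup_def)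

lemma \<pi>_skew:
  assumes Z: "Z \<in> lie K"
  shows "\<pi> Z v \<bullet> v = 0"
proof -
  note d = \<pi>_has_vector_derivative_0[OF lie_K_g[OF Z], of v]
  have "((\<lambda>t. \<tau> (mexp (t *\<^sub>R Z)) v \<bullet> \<tau> (mexp (t *\<^sub>R Z)) v) has_vector_derivative
     \<tau> (mexp (0 *\<^sub>R Z)) v \<bullet> \<pi> Z v + \<pi> Z v \<bullet> \<tau> (mexp (0 *\<^sub>R Z)) v) (at 0)"
    by (rule bounded_bilinear.has_vector_derivative[OF bounded_bilinear_inner d d])
  then have "((\<lambda>t::real. v \<bullet> v) has_vector_derivative 2 * (\<pi> Z v \<bullet> v)) (at 0)"
    by (simp add: K_isometry lie_mexp_scaleR[OF Z] \<tau>_one inner_commute)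
  from vector_derivative_unique_at[OF this has_vector_derivative_const] show ?thesis by simp
qed

text \<open>
  The product of \<open>\<tau> (mexp (t X)) v\<close> and \<open>\<tau> (mexp ((1 - t) X)) w\<close> does not depend on \<open>t\<close>.
\<close>

lemma \<tau>_mexp_p_sym:
  assumes X: "X \<in> \<pp>"
  shows "\<tau> (mexp X) v \<bullet> w = v \<bullet> \<tau> (mexp X) w"
proof -
  note Xg = p_g[OF X]
  define f where "f t = \<tau> (mexp (t *\<^sub>R X)) v \<bullet> \<tau> (mexp ((1 - t) *\<^sub>R X)) w" for t
  have sh: "((\<lambda>s. 1 - s) has_vector_derivative -1) (at t)" for t :: real by (auto intro!: derivative_eq_intros)
  have d1: "((\<lambda>s. \<tau> (mexp ((1 - s) *\<^sub>R X)) w) has_vector_derivative - \<pi> X (\<tau> (mexp ((1 - t) *\<^sub>R X)) w)) (at t)" for t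
    using vector_diff_chain_at[OF sh \<tau>_curve_derivative(1)[OF Xg]] by (simp add: o_def)
  have "(f has_vector_derivative 0) (at t within UNIV)" for t
  proof -
    have "(f has_vector_derivative \<tau> (mexp (t *\<^sub>R X)) v \<bullet> (- \<pi> X (\<tau> (mexp ((1 - t) *\<^sub>R X)) w))
        + \<pi> X (\<tau> (mexp (t *\<^sub>R X)) v) \<bullet> \<tau> (mexp ((1 - t) *\<^sub>R X)) w) (at t)"
      unfolding f_def by (rule bounded_bilinear.has_vector_derivative[OF bounded_bilinear_inner \<tau>_curve_derivative(1)[OF Xg] d1])
    then show ?thesis by (simp add: \<pi>_sym[OF X])
  qed
  then have "f 1 = f 0" using has_vector_derivative_zero_constant[of UNIV f] by (metis UNIV_I convex_UNIV)
  then show ?thesis by (simp add: f_def \<tau>_one)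
qed

end

section \<open>The moment map\<close>

context reductive_rep
begin

definition lie_proj :: "'n cmat \<Rightarrow> 'n cmat" where
  "lie_proj = (SOME P. linear P \<and> (\<forall>X. P X \<in> \<gg>) \<and> (\<forall>X\<in>\<gg>. P X = X))"

lemma lie_proj: "linear lie_proj" "lie_proj X \<in> \<gg>" "X \<in> \<gg> \<Longrightarrow> lie_proj X = X"
proof -
  have "\<exists>g. g ` UNIV \<subseteq> \<gg> \<and> linear g \<and> (\<forall>v\<in>\<gg>. g (id v) = v)"
    by (rule linear_exists_left_inverse_on[OF linear_id subspace_g]) simp
  then have "\<exists>P. linear P \<and> (\<forall>X. P X \<in> \<gg>) \<and> (\<forall>X\<in>\<gg>. P X = X)" by auto
  then have "linear lie_proj \<and> (\<forall>X. lie_proj X \<in> \<gg>) \<and> (\<forall>X\<in>\<gg>. lie_proj X = X)"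
    unfolding lie_proj_def by (rule someI_ex)
  then show "linear lie_proj" "lie_proj X \<in> \<gg>" "X \<in> \<gg> \<Longrightarrow> lie_proj X = X" by auto
qed

text \<open>
  The inner product \<open>ip\<close> is bilinear on \<open>lie G\<close> only. Composed with a projection onto \<open>lie G\<close> it is a
  bilinear form on all matrices.
\<close>

definition ipx :: "'n cmat \<Rightarrow> 'n cmat \<Rightarrow> real" where
  "ipx X Y = ip (lie_proj X) (lie_proj Y)"

lemma ipx_eq: "X \<in> \<gg> \<Longrightarrow> Y \<in> \<gg> \<Longrightarrow> ipx X Y = ip X Y"
  by (simp add: ipx_def lie_proj)

lemma ip_ax: "inner_product_on \<gg> ip"
  using compatg by (simp add: compatible_inner_on_lie_def)

lemma ipx_sym: "ipx X Y = ipx Y X"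
  using ip_ax lie_proj(2) by (simp add: ipx_def inner_product_on_def)

lemma bilinear_ipx: "bilinear ipx"
proof -
  have 1: "ipx (X + Y) Z = ipx X Z + ipx Y Z" for X Y Z
    using ip_ax lie_proj(2) by (simp add: ipx_def inner_product_on_def linear_add[OF lie_proj(1)])
  have 2: "ipx (c *\<^sub>R X) Z = c *\<^sub>R ipx X Z" for c X Z
    using ip_ax lie_proj(2) by (simp add: ipx_def inner_product_on_def linear_scale[OF lie_proj(1)])
  show ?thesis
    unfolding bilinear_def
  proof (intro conjI allI)
    show "linear (\<lambda>y. ipx x y)" for x
      by (rule linearI) (simp_all add: ipx_sym[of x] 1 2)
    show "linear (\<lambda>x. ipx x y)" for y
      by (rule linearI) (simp_all add: 1 2)
  qed
qed

lemma bounded_bilinear_ipx: "bounded_bilinear ipx"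
  using bilinear_ipx bilinear_conv_bounded_bilinear by blast

sublocale IP: bounded_bilinear ipx by (rule bounded_bilinear_ipx)

lemma ipx_pos: "X \<in> \<gg> \<Longrightarrow> X \<noteq> 0 \<Longrightarrow> 0 < ipx X X"
  using ip_ax by (simp add: ipx_eq inner_product_on_def)

lemma ipx_nonneg: "X \<in> \<gg> \<Longrightarrow> 0 \<le> ipx X X"
  using ipx_pos[of X] by (cases "X = 0") (auto simp: IP.zero_left)

lemma ipx_eq_0: "X \<in> \<gg> \<Longrightarrow> ipx X X = 0 \<longleftrightarrow> X = 0"
  using ipx_pos[of X] by (cases "X = 0") (auto simp: IP.zero_left)

lemma ipx_diff_sq: "ipx (X - Y) (X - Y) = ipx X X - 2 * ipx X Y + ipx Y Y"
  by (simp add: IP.diff_left IP.diff_right ipx_sym[of Y X])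

lemma ipx_bracket: "Z \<in> \<pp> \<Longrightarrow> X \<in> \<gg> \<Longrightarrow> Y \<in> \<gg> \<Longrightarrow> bracket Z X \<in> \<gg> \<Longrightarrow> bracket Z Y \<in> \<gg>
    \<Longrightarrow> ipx (bracket Z X) Y = ipx X (bracket Z Y)"
  using compatg by (simp add: ipx_eq compatible_inner_on_lie_def)

lemma ipx_k_p: "Z \<in> lie K \<Longrightarrow> X \<in> \<pp> \<Longrightarrow> ipx Z X = 0"
  using compatg by (simp add: ipx_eq compatible_inner_on_lie_def p_g lie_K_g)

lemma orthogonal_basis_exists:
  assumes S: "subspace S" "S \<subseteq> \<gg>"
  shows "\<exists>D. finite D \<and> D \<subseteq> S \<and> 0 \<notin> D \<and> span D = S \<and> (\<forall>x\<in>D. \<forall>y\<in>D. x \<noteq> y \<longrightarrow> ipx x y = 0)"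
proof -
  have "\<exists>D. finite D \<and> D \<subseteq> S \<and> 0 \<notin> D \<and> span D = S
           \<and> (\<forall>x\<in>D. \<forall>y\<in>D. x \<noteq> y \<longrightarrow> ipx x y = 0)
           \<and> (\<forall>x\<in>D. \<forall>i\<in>({} :: nat set). \<exists>c. (\<lambda>i x. x) i x = c *\<^sub>R x)"
    by (rule form_joint_eigenbasis[OF bilinear_ipx ipx_sym]) (use S ipx_pos in auto)
  then show ?thesis by auto
qed

lemma riesz:
  assumes S: "subspace S" "S \<subseteq> \<gg>" and f: "linear (f :: 'n cmat \<Rightarrow> real)"
  shows "\<exists>Y\<in>S. \<forall>X\<in>S. ipx Y X = f X"
proof -
  obtain D where D: "finite D" "D \<subseteq> S" "0 \<notin> D" "span D = S" and o: "\<forall>x\<in>D. \<forall>y\<in>D. x \<noteq> y \<longrightarrow> ipx x y = 0"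
    using orthogonal_basis_exists[OF S] by blast
  have pos: "0 < ipx d d" if "d \<in> D" for d using that D S by (intro ipx_pos) auto
  define Y where "Y = (\<Sum>d\<in>D. (f d / ipx d d) *\<^sub>R d)"
  have Y: "Y \<in> S" unfolding Y_def using D S(1) by (intro subspace_sum subspace_scale) auto
  have "ipx Y X = f X" if X: "X \<in> S" for X
  proof -
    have e: "X = (\<Sum>d\<in>D. (ipx X d / ipx d d) *\<^sub>R d)"
      by (rule orthogonal_expansion[OF bilinear_ipx D(1)]) (use o pos X D in auto)
    have "f X = (\<Sum>d\<in>D. (ipx X d / ipx d d) * f d)"
      by (subst e) (simp add: linear_sum[OF f] linear_scale[OF f])
    also have "\<dots> = ipx Y X" unfolding Y_def by (simp add: IP.sum_left IP.scaleR_left ipx_sym[of X] mult.commute)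
    finally show ?thesis by simp
  qed
  then show ?thesis using Y by blast
qed

abbreviation "\<mm> \<equiv> moment_map U G \<tau> ip"
abbreviation "F \<equiv> moment_norm_sq U G \<tau> ip"

text \<open>
  For \<open>X \<in> \<pp>\<close> this is the product of \<open>X\<close> with the moment map at \<open>v\<close>.
\<close>

definition rayleigh :: "'n cmat \<Rightarrow> 'v \<Rightarrow> real" where
  "rayleigh X v = (\<pi> X v \<bullet> v) / (v \<bullet> v)"

lemma rayleigh_add: "X \<in> \<gg> \<Longrightarrow> Y \<in> \<gg> \<Longrightarrow> rayleigh (X + Y) v = rayleigh X v + rayleigh Y v"
  and rayleigh_scaleR: "X \<in> \<gg> \<Longrightarrow> rayleigh (c *\<^sub>R X) v = c * rayleigh X v"
  by (simp_all add: rayleigh_def \<pi>_add \<pi>_scaleR inner_add_left add_divide_distrib)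

lemma moment_map_unique_exists: "\<exists>!Y. Y \<in> \<pp> \<and> (\<forall>X\<in>\<pp>. ip Y X = 1 / (norm v)\<^sup>2 * (\<pi> X v \<bullet> v))"
proof -
  have sub: "\<pp> \<subseteq> \<gg>" using p_g by blast
  have "linear (\<lambda>X. rayleigh (lie_proj X) v)"
    by (rule linearI) (simp_all add: rayleigh_add rayleigh_scaleR lie_proj linear_add[OF lie_proj(1)] linear_scale[OF lie_proj(1)])
  then obtain Y where Y: "Y \<in> \<pp>" "\<forall>X\<in>\<pp>. ipx Y X = rayleigh (lie_proj X) v"
    using riesz[OF subspace_p sub] by blast
  have e: "1 / (norm v)\<^sup>2 * (\<pi> X v \<bullet> v) = rayleigh X v" for X by (simp add: rayleigh_def power2_norm_eq_inner)
  have "Y \<in> \<pp> \<and> (\<forall>X\<in>\<pp>. ip Y X = 1 / (norm v)\<^sup>2 * (\<pi> X v \<bullet> v))"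
    using Y unfolding e by (simp add: ipx_eq[symmetric] p_g lie_proj(3))
  moreover have "Y' = Y" if Y': "Y' \<in> \<pp> \<and> (\<forall>X\<in>\<pp>. ip Y' X = 1 / (norm v)\<^sup>2 * (\<pi> X v \<bullet> v))" for Y'
  proof -
    have d: "Y' - Y \<in> \<pp>" using Y Y' subspace_p by (simp add: subspace_diff)
    have "ipx Y' X = ipx Y X" if "X \<in> \<pp>" for X using Y' Y that unfolding e by (simp add: ipx_eq p_g lie_proj(3))
    then have "ipx (Y' - Y) (Y' - Y) = 0" using d by (simp add: IP.diff_left)
    then show ?thesis using ipx_eq_0[OF p_g[OF d]] by simp
  qed
  ultimately show ?thesis by blast
qed

lemma moment_p: "\<mm> v \<in> \<pp>" and moment_rayleigh: "X \<in> \<pp> \<Longrightarrow> ipx (\<mm> v) X = rayleigh X v"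
proof -
  have "\<mm> v \<in> \<pp> \<and> (\<forall>X\<in>\<pp>. ip (\<mm> v) X = 1 / (norm v)\<^sup>2 * (\<pi> X v \<bullet> v))"
    unfolding moment_map_def by (rule theI'[OF moment_map_unique_exists])
  then show "\<mm> v \<in> \<pp>" "X \<in> \<pp> \<Longrightarrow> ipx (\<mm> v) X = rayleigh X v"
    by (simp_all add: ipx_eq p_g rayleigh_def power2_norm_eq_inner)
qed

lemma moment_eqI:
  assumes Y: "Y \<in> \<pp>" and e: "\<And>X. X \<in> \<pp> \<Longrightarrow> ipx Y X = rayleigh X v"
  shows "\<mm> v = Y"
proof -
  have d: "\<mm> v - Y \<in> \<pp>" using Y moment_p subspace_p by (simp add: subspace_diff)
  have "ipx (\<mm> v - Y) (\<mm> v - Y) = 0" using d by (simp add: IP.diff_left e moment_rayleigh)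
  then show ?thesis using ipx_eq_0[OF p_g[OF d]] by simp
qed

lemma F_eq: "F v = ipx (\<mm> v) (\<mm> v)"
  by (simp add: moment_norm_sq_def ipx_eq p_g moment_p)

lemma rayleigh_has_derivative:
  assumes X: "X \<in> \<pp>" and v: "v \<noteq> 0"
  shows "(rayleigh X has_derivative (\<lambda>x. (2 / (v \<bullet> v)) * ((\<pi> X v - rayleigh X v *\<^sub>R v) \<bullet> x))) (at v)"
proof -
  note d = bounded_linear.has_derivative[OF \<pi>_bounded_linear[OF p_g[OF X]] has_derivative_ident]
  have "(rayleigh X has_derivative (\<lambda>x. ((\<pi> X v \<bullet> x + \<pi> X x \<bullet> v) * (v \<bullet> v) - (\<pi> X v \<bullet> v) * (v \<bullet> x + x \<bullet> v)) / ((v \<bullet> v) * (v \<bullet> v)))) (at v)"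
    unfolding rayleigh_def[abs_def]
    by (rule has_derivative_divide'[OF has_derivative_inner[OF d has_derivative_ident] has_derivative_inner[OF has_derivative_ident has_derivative_ident]])
      (use v in simp)
  then show ?thesis
  proof (rule has_derivative_eq_rhs, intro ext)
    fix x
    have s: "\<pi> X x \<bullet> v = \<pi> X v \<bullet> x" using \<pi>_sym[OF X, of x v] by (simp add: inner_commute)
    have nz: "v \<bullet> v \<noteq> 0" using v by simp
    show "((\<pi> X v \<bullet> x + \<pi> X x \<bullet> v) * (v \<bullet> v) - (\<pi> X v \<bullet> v) * (v \<bullet> x + x \<bullet> v)) / ((v \<bullet> v) * (v \<bullet> v))
        = (2 / (v \<bullet> v)) * ((\<pi> X v - rayleigh X v *\<^sub>R v) \<bullet> x)"
      unfolding s rayleigh_def using nz by (simp add: inner_diff_left inner_commute[of x v] field_simps)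
  qed
qed

text \<open>
  In an orthogonal basis of \<open>\<pp>\<close>, \<open>F\<close> is a sum of squares of Rayleigh quotients; the gradient comes out as
  \<open>4 / \<parallel>v\<parallel>\<^sup>2\<close> times \<open>\<pi>(m(v)) v - F(v) v\<close>.
\<close>

lemma critical_iff:
  assumes v: "v \<noteq> 0"
  shows "critical_point F v \<longleftrightarrow> \<pi> (\<mm> v) v = F v *\<^sub>R v"
proof -
  obtain D where D: "finite D" "D \<subseteq> \<pp>" "0 \<notin> D" "span D = \<pp>" and o: "\<forall>x\<in>D. \<forall>y\<in>D. x \<noteq> y \<longrightarrow> ipx x y = 0"
    using orthogonal_basis_exists[OF subspace_p] p_g by blast
  have pos: "0 < ipx d d" if "d \<in> D" for d using that D p_g by (intro ipx_pos) auto
  have me: "\<mm> y = (\<Sum>d\<in>D. (rayleigh d y / ipx d d) *\<^sub>R d)" for y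
  proof -
    have "\<mm> y = (\<Sum>d\<in>D. (ipx (\<mm> y) d / ipx d d) *\<^sub>R d)"
      by (rule orthogonal_expansion[OF bilinear_ipx D(1)]) (use o pos moment_p D in auto)
    also have "\<dots> = (\<Sum>d\<in>D. (rayleigh d y / ipx d d) *\<^sub>R d)" by (rule sum.cong) (use D(2) moment_rayleigh in auto)
    finally show ?thesis .
  qed
  have Fe: "F y = (\<Sum>d\<in>D. (rayleigh d y)\<^sup>2 / ipx d d)" for y
  proof -
    have "F y = ipx (\<mm> y) (\<mm> y)" by (rule F_eq)
    also have "\<dots> = (\<Sum>d\<in>D. (rayleigh d y / ipx d d) * ipx (\<mm> y) d)"
      by (subst (2) me) (simp add: IP.sum_right IP.scaleR_right)
    also have "\<dots> = (\<Sum>d\<in>D. (rayleigh d y)\<^sup>2 / ipx d d)"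
      by (rule sum.cong) (use D(2) moment_rayleigh in \<open>auto simp: power2_eq_square\<close>)
    finally show ?thesis .
  qed
  have \<pi>m: "\<pi> (\<mm> v) v = (\<Sum>d\<in>D. (rayleigh d v / ipx d d) *\<^sub>R \<pi> d v)"
  proof -
    have "\<pi> (\<Sum>d\<in>D'. (rayleigh d v / ipx d d) *\<^sub>R d) v = (\<Sum>d\<in>D'. (rayleigh d v / ipx d d) *\<^sub>R \<pi> d v)" if "D' \<subseteq> D" "finite D'" for D'
      using that(2,1)
    proof (induction D' rule: finite_induct)
      case empty
      have "\<pi> (0 *\<^sub>R 0) v = 0 *\<^sub>R \<pi> 0 v" by (rule \<pi>_scaleR) (simp add: subspace_0[OF subspace_g])
      then show ?case by simp
    next
      case (insert d D')
      have s: "(\<Sum>d\<in>D'. (rayleigh d v / ipx d d) *\<^sub>R d) \<in> \<gg>"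
        using insert.prems D(2) p_g subspace_g by (intro subspace_sum subspace_scale) auto
      have dg: "d \<in> \<gg>" using insert.prems D(2) p_g by auto
      show ?case using insert s dg by (simp add: \<pi>_add \<pi>_scaleR lie_scaleR)
    qed
    then show ?thesis using D(1) by (subst me) blast
  qed
  have der: "(F has_derivative (\<lambda>x. (4 / (v \<bullet> v)) * ((\<pi> (\<mm> v) v - F v *\<^sub>R v) \<bullet> x))) (at v)"
  proof -
    have "((\<lambda>y. \<Sum>d\<in>D. (rayleigh d y)\<^sup>2 / ipx d d) has_derivative
       (\<lambda>x. \<Sum>d\<in>D. (2 * rayleigh d v / ipx d d) * ((2 / (v \<bullet> v)) * ((\<pi> d v - rayleigh d v *\<^sub>R v) \<bullet> x)))) (at v)"
    proof (rule has_derivative_sum)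
      fix d assume "d \<in> D"
      then have Rd: "(rayleigh d has_derivative (\<lambda>x. (2 / (v \<bullet> v)) * ((\<pi> d v - rayleigh d v *\<^sub>R v) \<bullet> x))) (at v)"
        using D(2) by (intro rayleigh_has_derivative v) auto
      have "((\<lambda>y. (1 / ipx d d) * (rayleigh d y * rayleigh d y)) has_derivative
         (\<lambda>x. (1 / ipx d d) * (rayleigh d v * ((2 / (v \<bullet> v)) * ((\<pi> d v - rayleigh d v *\<^sub>R v) \<bullet> x)) + ((2 / (v \<bullet> v)) * ((\<pi> d v - rayleigh d v *\<^sub>R v) \<bullet> x)) * rayleigh d v))) (at v)"
        by (intro has_derivative_mult_right has_derivative_mult Rd)
      then show "((\<lambda>y. (rayleigh d y)\<^sup>2 / ipx d d) has_derivative (\<lambda>x. (2 * rayleigh d v / ipx d d) * ((2 / (v \<bullet> v)) * ((\<pi> d v - rayleigh d v *\<^sub>R v) \<bullet> x)))) (at v)"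
        by (simp add: power2_eq_square mult_ac)
    qed
    then have "(F has_derivative (\<lambda>x. \<Sum>d\<in>D. (2 * rayleigh d v / ipx d d) * ((2 / (v \<bullet> v)) * ((\<pi> d v - rayleigh d v *\<^sub>R v) \<bullet> x)))) (at v)"
      by (simp only: Fe[abs_def])
    then show ?thesis
    proof (rule has_derivative_eq_rhs, intro ext)
      fix x
      have "(\<Sum>d\<in>D. (2 * rayleigh d v / ipx d d) * ((2 / (v \<bullet> v)) * ((\<pi> d v - rayleigh d v *\<^sub>R v) \<bullet> x)))
        = (4 / (v \<bullet> v)) * (\<Sum>d\<in>D. (rayleigh d v / ipx d d) * (\<pi> d v \<bullet> x) - ((rayleigh d v)\<^sup>2 / ipx d d) * (v \<bullet> x))"
        unfolding sum_distrib_left by (rule sum.cong) (simp_all add: inner_diff_left power2_eq_square algebra_simps)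
      also have "(\<Sum>d\<in>D. (rayleigh d v / ipx d d) * (\<pi> d v \<bullet> x) - ((rayleigh d v)\<^sup>2 / ipx d d) * (v \<bullet> x))
        = (\<pi> (\<mm> v) v - F v *\<^sub>R v) \<bullet> x"
        by (simp add: \<pi>m Fe inner_diff_left inner_sum_left sum_subtractf sum_distrib_right)
      finally show "(\<Sum>d\<in>D. (2 * rayleigh d v / ipx d d) * ((2 / (v \<bullet> v)) * ((\<pi> d v - rayleigh d v *\<^sub>R v) \<bullet> x)))
        = (4 / (v \<bullet> v)) * ((\<pi> (\<mm> v) v - F v *\<^sub>R v) \<bullet> x)" .
    qed
  qed
  show ?thesis
  proof
    assume "critical_point F v"
    then have "(F has_derivative (\<lambda>_. 0)) (at v)" by (simp add: critical_point_def)
    from has_derivative_unique[OF this der]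
    have "0 = (4 / (v \<bullet> v)) * ((\<pi> (\<mm> v) v - F v *\<^sub>R v) \<bullet> (\<pi> (\<mm> v) v - F v *\<^sub>R v))" by (rule fun_cong)
    then show "\<pi> (\<mm> v) v = F v *\<^sub>R v" using v by simp
  next
    assume "\<pi> (\<mm> v) v = F v *\<^sub>R v"
    then show "critical_point F v" using der v by (simp add: critical_point_def)
  qed
qed

lemma Ad_mexp:
  assumes g: "g \<in> G"
  shows "mexp (t *\<^sub>R (g ** X ** matrix_inv g)) = g ** mexp (t *\<^sub>R X) ** matrix_inv g"
proof -
  have "mexp (t *\<^sub>R (g ** X ** matrix_inv g)) ** g = g ** mexp (t *\<^sub>R X)"
    by (rule mexp_intertwine) (simp add: mm.scaleR_left mm.scaleR_right matrix_mul_assoc[symmetric] G_inv[OF g])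
  then have "g ** mexp (t *\<^sub>R X) ** matrix_inv g = mexp (t *\<^sub>R (g ** X ** matrix_inv g)) ** (g ** matrix_inv g)"
    by (simp add: matrix_mul_assoc)
  then show ?thesis by (simp add: G_inv[OF g])
qed

lemma Ad_g: "g \<in> G \<Longrightarrow> X \<in> \<gg> \<Longrightarrow> g ** X ** matrix_inv g \<in> \<gg>"
  unfolding lie_def by (auto simp: Ad_mexp G_mult G_inv)

lemma Ad_p: 
  assumes k: "k \<in> K" and X: "X \<in> \<pp>"
  shows "k ** X ** matrix_inv k \<in> \<pp>"
proof -
  obtain Y where Y: "Y \<in> lie U" "X = mat \<i> ** Y" using X by (auto simp: pspace_def)
  have "k ** Y ** matrix_inv k \<in> lie U"
    unfolding lie_def using Y(1) K_U[OF k] K_U[OF K_inv(1)[OF k]] group_U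
    by (auto simp: Ad_mexp[OF K_G[OF k]] matrix_group_def lie_def)
  moreover have "k ** X ** matrix_inv k = mat \<i> ** (k ** Y ** matrix_inv k)"
    unfolding Y(2) by (simp add: matrix_mul_assoc mat_commute[of \<i> k])
  ultimately show ?thesis using Ad_g[OF K_G[OF k] p_g[OF X]] by (simp add: pspace_def)
qed

lemma \<pi>_Ad:
  assumes g: "g \<in> G" and X: "X \<in> \<gg>"
  shows "\<pi> (g ** X ** matrix_inv g) (\<tau> g v) = \<tau> g (\<pi> X v)"
  by (rule \<pi>_equivariant[OF g X Ad_g[OF g X]]) (simp add: matrix_mul_assoc[symmetric] G_inv[OF g])

text \<open>
  The moment map intertwines \<open>\<tau> k\<close> with the adjoint action of \<open>k\<close>, which is isometric.
\<close>

lemma F_K_invariant: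
  assumes k: "k \<in> K"
  shows "F (\<tau> k v) = F v"
proof -
  note kG = K_G[OF k]
  have Ad_ip: "ipx (k ** X ** matrix_inv k) (k ** Y ** matrix_inv k) = ipx X Y" if "X \<in> \<gg>" "Y \<in> \<gg>" for X Y
    using compatg k that by (simp add: ipx_eq Ad_g kG compatible_inner_on_lie_def)
  have "\<mm> (\<tau> k v) = k ** \<mm> v ** matrix_inv k"
  proof (rule moment_eqI)
    show "k ** \<mm> v ** matrix_inv k \<in> \<pp>" by (rule Ad_p[OF k moment_p])
    fix X assume X: "X \<in> \<pp>"
    have ik: "matrix_inv (matrix_inv k) = k" by (rule matrix_inv_unique) (simp_all add: K_inv[OF k])
    define Y where "Y = matrix_inv k ** X ** k"
    have Y: "Y \<in> \<pp>" using Ad_p[OF K_inv(1)[OF k] X] by (simp add: ik Y_def)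
    have XY: "X = k ** Y ** matrix_inv k"
    proof -
      have "k ** Y ** matrix_inv k = (k ** matrix_inv k) ** X ** (k ** matrix_inv k)"
        unfolding Y_def by (simp only: matrix_mul_assoc)
      then show ?thesis by (simp add: K_inv[OF k])
    qed
    have "ipx (k ** \<mm> v ** matrix_inv k) X = ipx (\<mm> v) Y"
      unfolding XY by (rule Ad_ip[OF p_g[OF moment_p] p_g[OF Y]])
    also have "\<dots> = rayleigh Y v" by (rule moment_rayleigh[OF Y])
    also have "\<dots> = rayleigh X (\<tau> k v)"
      unfolding rayleigh_def XY \<pi>_Ad[OF kG p_g[OF Y]] by (simp add: K_isometry[OF k])
    finally show "ipx (k ** \<mm> v ** matrix_inv k) X = rayleigh X (\<tau> k v)" .
  qed
  then show ?thesis by (simp add: F_eq Ad_ip p_g moment_p)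
qed

text \<open>
  The components of \<open>x\<close> in the eigenspaces of \<open>\<pi> Y\<close> for eigenvalues below \<open>c\<close> would decay too slowly, so they vanish.
  This is how the behaviour at infinity of a one-parameter group bounds the moment map at \<open>x\<close>.
\<close>

lemma decay_bound:
  assumes Y: "Y \<in> \<pp>" and x: "x \<noteq> 0"
    and bd: "\<And>n. norm (\<tau> (mexp ((- real n) *\<^sub>R Y)) x) \<le> C * exp (- (real n * c))"
  shows "c \<le> rayleigh Y x" and "rayleigh Y x = c \<Longrightarrow> \<pi> Y x = c *\<^sub>R x"
proof -
  note Yg = p_g[OF Y]
  interpret L: linear "\<pi> Y" by (rule \<pi>_linear[OF Yg])
  have "\<exists>D. finite D \<and> D \<subseteq> UNIV \<and> 0 \<notin> D \<and> span D = (UNIV :: 'v set)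
           \<and> (\<forall>x\<in>D. \<forall>y\<in>D. x \<noteq> y \<longrightarrow> x \<bullet> y = 0)
           \<and> (\<forall>x\<in>D. \<forall>i\<in>{Y}. \<exists>c. \<pi> i x = c *\<^sub>R x)"
    by (rule form_joint_eigenbasis[where B = "(\<bullet>)", OF _ inner_commute])
      (auto simp: bilinear_conv_bounded_bilinear bounded_bilinear_inner L.linear_axioms \<pi>_sym[OF Y])
  then obtain D where D: "finite D" "0 \<notin> D" "span D = (UNIV :: 'v set)"
    and o: "\<forall>x\<in>D. \<forall>y\<in>D. x \<noteq> y \<longrightarrow> x \<bullet> y = 0"
    and ev: "\<forall>x\<in>D. \<exists>c. \<pi> Y x = c *\<^sub>R x" by auto
  obtain l where l: "\<forall>d\<in>D. \<pi> Y d = l d *\<^sub>R d" using ev by metis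
  have pos: "0 < d \<bullet> d" if "d \<in> D" for d using that D(2) by auto
  define a where "a d = (x \<bullet> d) / (d \<bullet> d)" for d
  have xe: "x = (\<Sum>d\<in>D. a d *\<^sub>R d)" unfolding a_def
    by (rule orthogonal_expansion[where B = "(\<bullet>)"])
      (use D o pos in \<open>auto simp: bilinear_conv_bounded_bilinear bounded_bilinear_inner\<close>)
  have small: "a d = 0" if d: "d \<in> D" and lt: "l d < c" for d
  proof (rule ccontr)
    assume "a d \<noteq> 0"
    then have xd: "0 < \<bar>x \<bullet> d\<bar>" by (auto simp: a_def)
    have b: "\<bar>x \<bullet> d\<bar> * exp (real n * (c - l d)) \<le> C * norm d" for n
    proof -
      have "\<tau> (mexp ((- real n) *\<^sub>R Y)) d = exp ((- real n) * l d) *\<^sub>R d" by (rule \<tau>_eigen[OF Yg]) (use l d in simp)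
      then have "\<tau> (mexp ((- real n) *\<^sub>R Y)) x \<bullet> d = exp (- (real n * l d)) * (x \<bullet> d)"
        using \<tau>_mexp_p_sym[OF subspace_scale[OF subspace_p Y, of "- real n"], of x d] by simp
      then have "exp (- (real n * l d)) * \<bar>x \<bullet> d\<bar> = \<bar>\<tau> (mexp ((- real n) *\<^sub>R Y)) x \<bullet> d\<bar>" by (simp add: abs_mult)
      also have "\<dots> \<le> norm (\<tau> (mexp ((- real n) *\<^sub>R Y)) x) * norm d" by (rule Cauchy_Schwarz_ineq2)
      also have "\<dots> \<le> C * exp (- (real n * c)) * norm d" by (intro mult_right_mono bd) simp
      finally have "exp (real n * c) * (exp (- (real n * l d)) * \<bar>x \<bullet> d\<bar>) \<le> exp (real n * c) * (C * exp (- (real n * c)) * norm d)"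
        by (intro mult_left_mono) auto
      also have "\<dots> = (exp (real n * c) * exp (- (real n * c))) * (C * norm d)" by (simp add: mult_ac)
      also have "\<dots> = C * norm d" by (simp add: exp_minus)
      finally show ?thesis by (simp add: right_diff_distrib exp_diff exp_minus field_simps)
    qed
    have "filterlim (\<lambda>n. real n * (c - l d)) at_top sequentially"
      by (rule filterlim_at_top_mult_tendsto_pos[OF tendsto_const _ filterlim_real_sequentially]) (use lt in simp)
    then have "filterlim (\<lambda>n. exp (real n * (c - l d))) at_top sequentially"
      by (rule filterlim_compose[OF exp_at_top])
    then have "\<forall>\<^sub>F n in sequentially. C * norm d / \<bar>x \<bullet> d\<bar> < exp (real n * (c - l d))"
      by (simp add: filterlim_at_top_dense)
    then obtain n where "C * norm d / \<bar>x \<bullet> d\<bar> < exp (real n * (c - l d))" by (auto simp: eventually_sequentially)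
    then have "C * norm d < \<bar>x \<bullet> d\<bar> * exp (real n * (c - l d))" using xd by (simp add: field_simps)
    then show False using b[of n] by simp
  qed
  have px: "\<pi> Y x = (\<Sum>d\<in>D. (a d * l d) *\<^sub>R d)"
  proof -
    have "\<pi> Y x = (\<Sum>d\<in>D. a d *\<^sub>R \<pi> Y d)" by (subst xe) (simp add: L.sum L.scaleR)
    also have "\<dots> = (\<Sum>d\<in>D. (a d * l d) *\<^sub>R d)" by (rule sum.cong) (use l in auto)
    finally show ?thesis .
  qed
  have key: "\<pi> Y x \<bullet> x - c * (x \<bullet> x) = (\<Sum>d\<in>D. (l d - c) * ((a d)\<^sup>2 * (d \<bullet> d)))"
  proof -
    have xd: "d \<bullet> x = a d * (d \<bullet> d)" if "d \<in> D" for d using pos[OF that] by (simp add: a_def inner_commute)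
    have 1: "\<pi> Y x \<bullet> x = (\<Sum>d\<in>D. (a d * l d) * (d \<bullet> x))" by (subst px) (simp add: inner_sum_left)
    have 2: "x \<bullet> x = (\<Sum>d\<in>D. a d * (d \<bullet> x))" by (subst (1) xe) (simp add: inner_sum_left)
    show ?thesis unfolding 1 2 sum_distrib_left sum_subtractf[symmetric]
      by (rule sum.cong) (simp_all add: xd power2_eq_square algebra_simps)
  qed
  have nn: "0 \<le> (l d - c) * ((a d)\<^sup>2 * (d \<bullet> d))" if "d \<in> D" for d
    using small[OF that] by (cases "l d < c") auto
  have xx: "0 < x \<bullet> x" using x by simp
  have "0 \<le> \<pi> Y x \<bullet> x - c * (x \<bullet> x)" unfolding key by (rule sum_nonneg) (rule nn)
  then show "c \<le> rayleigh Y x" using xx by (simp add: rayleigh_def field_simps)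
  show "\<pi> Y x = c *\<^sub>R x" if "rayleigh Y x = c"
  proof -
    have "\<pi> Y x \<bullet> x - c * (x \<bullet> x) = 0" using that xx by (simp add: rayleigh_def field_simps)
    then have "\<forall>d\<in>D. (l d - c) * ((a d)\<^sup>2 * (d \<bullet> d)) = 0"
      unfolding key by (subst (asm) sum_nonneg_eq_0_iff[OF D(1) nn])
    then have "l d = c \<or> a d = 0" if "d \<in> D" for d using pos[OF that] that by fastforce
    then have "a d * l d = c * a d" if "d \<in> D" for d using that by auto
    then have "\<pi> Y x = (\<Sum>d\<in>D. (c * a d) *\<^sub>R d)" unfolding px by (intro sum.cong) auto
    also have "\<dots> = c *\<^sub>R (\<Sum>d\<in>D. a d *\<^sub>R d)" by (simp add: scaleR_sum_right)
    finally show ?thesis using xe by simp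
  qed
qed

end

section \<open>Minimal convex combinations\<close>

context reductive_rep
begin

lemma convex_hull_in_g: "\<Phi> \<subseteq> \<gg> \<Longrightarrow> convex hull \<Phi> \<subseteq> \<gg>"
  by (rule hull_minimal) (auto simp: subspace_imp_convex[OF subspace_g])

text \<open>
  The inequality is the variational characterisation of the closest point of a convex set.
\<close>

lemma mcc_properties:
  assumes fin: "finite \<Phi>" "\<Phi> \<noteq> {}" and sub: "\<Phi> \<subseteq> \<gg>"
  shows "mcc ip \<Phi> \<in> convex hull \<Phi>"
    and "\<And>\<gamma>. \<gamma> \<in> convex hull \<Phi> \<Longrightarrow> ipx (mcc ip \<Phi>) (mcc ip \<Phi>) \<le> ipx (mcc ip \<Phi>) \<gamma>"
proof -
  note hg = convex_hull_in_g[OF sub]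
  have cc: "compact (convex hull \<Phi>)" using fin(1) by (rule finite_imp_compact_convex_hull)
  have ne: "convex hull \<Phi> \<noteq> {}" using fin(2) by simp
  have ct: "continuous_on (convex hull \<Phi>) (\<lambda>\<gamma>. ipx \<gamma> \<gamma>)" by (intro IP.continuous_on continuous_on_id)
  obtain \<beta> where \<beta>: "\<beta> \<in> convex hull \<Phi>" "\<And>\<gamma>. \<gamma> \<in> convex hull \<Phi> \<Longrightarrow> ipx \<beta> \<beta> \<le> ipx \<gamma> \<gamma>"
    using continuous_attains_inf[OF cc ne ct] by blast
  have uniq: "\<gamma> = \<beta>" if \<gamma>: "\<gamma> \<in> convex hull \<Phi>" and le: "ipx \<gamma> \<gamma> \<le> ipx \<beta> \<beta>" for \<gamma>
  proof -
    have "(1/2) *\<^sub>R \<beta> + (1/2) *\<^sub>R \<gamma> \<in> convex hull \<Phi>"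
      using convexD[OF convex_convex_hull \<beta>(1) \<gamma>] by simp
    note mid = \<beta>(2)[OF this]
    have "ipx ((1/2) *\<^sub>R \<beta> + (1/2) *\<^sub>R \<gamma>) ((1/2) *\<^sub>R \<beta> + (1/2) *\<^sub>R \<gamma>)
        = (ipx \<beta> \<beta> + 2 * ipx \<beta> \<gamma> + ipx \<gamma> \<gamma>) / 4"
      by (simp add: IP.add_left IP.add_right IP.scaleR_left IP.scaleR_right ipx_sym[of \<gamma> \<beta>] field_simps)
    with mid have "ipx \<beta> \<beta> \<le> (ipx \<beta> \<beta> + 2 * ipx \<beta> \<gamma> + ipx \<gamma> \<gamma>) / 4" by (simp only:)
    then have "4 * ipx \<beta> \<beta> \<le> ipx \<beta> \<beta> + 2 * ipx \<beta> \<gamma> + ipx \<gamma> \<gamma>" by (simp only: le_divide_eq) simp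
    then have "ipx (\<beta> - \<gamma>) (\<beta> - \<gamma>) \<le> 0" using le by (simp add: ipx_diff_sq)
    moreover have "\<beta> - \<gamma> \<in> \<gg>" using \<beta>(1) \<gamma> hg subspace_g by (blast intro: subspace_diff)
    ultimately show ?thesis using ipx_pos[of "\<beta> - \<gamma>"] by force
  qed
  have ix: "ip \<gamma> \<gamma> = ipx \<gamma> \<gamma>" if "\<gamma> \<in> convex hull \<Phi>" for \<gamma> using that hg by (intro ipx_eq[symmetric]) auto
  have "mcc ip \<Phi> = \<beta>"
    unfolding mcc_def is_arg_min_def
  proof (rule the_equality)
    show "\<beta> \<in> convex hull \<Phi> \<and> (\<nexists>y. y \<in> convex hull \<Phi> \<and> sqrt (ip y y) < sqrt (ip \<beta> \<beta>))"
      using \<beta> ix by (force simp: not_less)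
    fix \<gamma> assume \<gamma>: "\<gamma> \<in> convex hull \<Phi> \<and> (\<nexists>y. y \<in> convex hull \<Phi> \<and> sqrt (ip y y) < sqrt (ip \<gamma> \<gamma>))"
    then have "\<not> sqrt (ip \<beta> \<beta>) < sqrt (ip \<gamma> \<gamma>)" using \<beta>(1) by blast
    then have "ipx \<gamma> \<gamma> \<le> ipx \<beta> \<beta>" using \<gamma> \<beta>(1) by (simp add: ix)
    then show "\<gamma> = \<beta>" using uniq \<gamma> by blast
  qed
  moreover have "ipx \<beta> \<beta> \<le> ipx \<beta> \<gamma>" if \<gamma>: "\<gamma> \<in> convex hull \<Phi>" for \<gamma>
  proof (rule ccontr)
    assume n: "\<not> ipx \<beta> \<beta> \<le> ipx \<beta> \<gamma>"
    define q where "q = ipx \<beta> \<beta> - ipx \<beta> \<gamma>"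
    define r where "r = ipx (\<gamma> - \<beta>) (\<gamma> - \<beta>)"
    have q: "q > 0" using n by (simp add: q_def)
    have gb: "\<gamma> - \<beta> \<in> \<gg>" using \<beta>(1) \<gamma> hg subspace_g by (blast intro: subspace_diff)
    then have r: "r \<ge> 0" unfolding r_def by (rule ipx_nonneg)
    \<comment> \<open>short enough for the linear gain \<open>2 s q\<close> to exceed the quadratic loss \<open>s\<^sup>2 r\<close>\<close>
    define s where "s = min 1 (q / (r + 1))"
    have s: "0 < s" "s \<le> 1" using q r by (auto simp: s_def)
    have sr: "s * r < 2 * q"
    proof -
      have "s * r \<le> (q / (r + 1)) * r" using r by (intro mult_right_mono) (auto simp: s_def)
      also have "\<dots> \<le> q" using q r by (simp add: field_simps)
      finally show ?thesis using q by linarith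
    qed
    have "(1 - s) *\<^sub>R \<beta> + s *\<^sub>R \<gamma> \<in> convex hull \<Phi>"
      using convexD[OF convex_convex_hull \<beta>(1) \<gamma>, of "1 - s" s] s by simp
    moreover have "(1 - s) *\<^sub>R \<beta> + s *\<^sub>R \<gamma> = \<beta> + s *\<^sub>R (\<gamma> - \<beta>)" by (simp add: algebra_simps)
    ultimately have "ipx \<beta> \<beta> \<le> ipx (\<beta> + s *\<^sub>R (\<gamma> - \<beta>)) (\<beta> + s *\<^sub>R (\<gamma> - \<beta>))" using \<beta>(2) by metis
    also have "\<dots> = ipx \<beta> \<beta> + s * (s * r - 2 * q)"
      by (simp add: r_def q_def IP.add_left IP.add_right IP.scaleR_left IP.scaleR_right IP.diff_left IP.diff_right
          ipx_sym[of \<gamma> \<beta>] algebra_simps)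
    finally have "0 \<le> s * (s * r - 2 * q)" by simp
    then show False using s sr by (simp add: zero_le_mult_iff)
  qed
  ultimately show "mcc ip \<Phi> \<in> convex hull \<Phi>"
    "\<And>\<gamma>. \<gamma> \<in> convex hull \<Phi> \<Longrightarrow> ipx (mcc ip \<Phi>) (mcc ip \<Phi>) \<le> ipx (mcc ip \<Phi>) \<gamma>" using \<beta>(1) by simp_all
qed

text \<open>
  From a relatively interior point \<open>z\<close> one can move a little further away from \<open>\<alpha>\<close> inside the convex hull, where
  the functional would drop below its minimum if it were larger at \<open>\<alpha>\<close> than at \<open>z\<close>.
\<close>

lemma affine_min_rel_interior:
  assumes z: "z \<in> rel_interior (convex hull \<Phi>)" and le: "\<And>\<gamma>. \<gamma> \<in> \<Phi> \<Longrightarrow> ipx Y z \<le> ipx Y \<gamma>"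
    and \<alpha>: "\<alpha> \<in> \<Phi>"
  shows "ipx Y \<alpha> = ipx Y z"
proof -
  have conv: "convex {\<gamma>. ipx Y z \<le> ipx Y \<gamma>}"
    using convex_linear_vimage[OF bounded_linear.linear[OF IP.bounded_linear_right], of "{ipx Y z..}" Y]
    by (simp add: vimage_def)
  have all: "ipx Y z \<le> ipx Y \<gamma>" if "\<gamma> \<in> convex hull \<Phi>" for \<gamma>
    using hull_minimal[of \<Phi> "{\<gamma>. ipx Y z \<le> ipx Y \<gamma>}" convex] le conv that by blast
  have \<alpha>h: "\<alpha> \<in> convex hull \<Phi>" using \<alpha> by (rule hull_inc)
  have "\<exists>e>1. (1 - e) *\<^sub>R \<alpha> + e *\<^sub>R z \<in> convex hull \<Phi>"
    using convex_rel_interior_if[OF convex_convex_hull z] \<alpha>h hull_subset[of "convex hull \<Phi>" affine] by blast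
  then obtain e where e: "e > 1" "(1 - e) *\<^sub>R \<alpha> + e *\<^sub>R z \<in> convex hull \<Phi>" by blast
  have "ipx Y ((1 - e) *\<^sub>R \<alpha> + e *\<^sub>R z) = (1 - e) * ipx Y \<alpha> + e * ipx Y z"
    by (simp only: IP.add_right IP.scaleR_right real_scaleR_def)
  with all[OF e(2)] have "ipx Y z \<le> (1 - e) * ipx Y \<alpha> + e * ipx Y z" by (simp only:)
  then have "0 \<le> (e - 1) * (ipx Y z - ipx Y \<alpha>)" by (simp add: algebra_simps)
  then have "ipx Y \<alpha> \<le> ipx Y z" using e(1) by (simp add: zero_le_mult_iff)
  then show ?thesis using le[OF \<alpha>] by simp
qed

text \<open>
  The equation says that \<open>X\<close> is a critical point of \<open>\<psi> X = \<Sum>\<^sub>\<alpha> c \<alpha> exp (2\<langle>X, \<alpha> - z\<rangle>)\<close>. On the span of the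
  differences \<open>\<alpha> - z\<close> every direction has positive product with one of them, because \<open>z\<close> is relatively interior;
  so \<open>\<psi>\<close> grows at infinity and has a minimum there. This is the description of the moment image of a torus orbit.
\<close>

lemma exponential_barycentre:
  assumes a: "subspace a" "a \<subseteq> \<gg>" and fin: "finite \<Phi>" "\<Phi> \<noteq> {}" and sub: "\<Phi> \<subseteq> a"
    and z: "z \<in> rel_interior (convex hull \<Phi>)" and c: "\<And>\<alpha>. \<alpha> \<in> \<Phi> \<Longrightarrow> 0 < c \<alpha>"
  shows "\<exists>X\<in>a. (\<Sum>\<alpha>\<in>\<Phi>. (c \<alpha> * exp (2 * ipx X \<alpha>)) *\<^sub>R (\<alpha> - z)) = 0"
proof -
  have za: "z \<in> a"
  proof -
    have "convex hull \<Phi> \<subseteq> a" using sub a(1) by (intro hull_minimal) (auto simp: subspace_imp_convex)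
    then show ?thesis using z rel_interior_subset by blast
  qed
  define L where "L = span ((\<lambda>\<alpha>. \<alpha> - z) ` \<Phi>)"
  have sL: "subspace L" unfolding L_def by (rule subspace_span)
  have La: "L \<subseteq> a" unfolding L_def using sub za a(1) by (intro span_minimal) (auto intro: subspace_diff)
  have \<Phi>L: "\<alpha> - z \<in> L" if "\<alpha> \<in> \<Phi>" for \<alpha> unfolding L_def using that by (intro span_base) auto
  define \<psi> where "\<psi> X = (\<Sum>\<alpha>\<in>\<Phi>. c \<alpha> * exp (2 * ipx X (\<alpha> - z)))" for X
  have pos_dir: "\<exists>\<alpha>\<in>\<Phi>. 0 < ipx Y (\<alpha> - z)" if Y: "Y \<in> L" "Y \<noteq> 0" for Y
  proof (rule ccontr)
    assume "\<not> ?thesis"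
    then have le: "ipx Y (\<alpha> - z) \<le> 0" if "\<alpha> \<in> \<Phi>" for \<alpha> using that by force
    have "ipx (- Y) \<alpha> = ipx (- Y) z" if "\<alpha> \<in> \<Phi>" for \<alpha>
      by (rule affine_min_rel_interior[OF z _ that]) (use le in \<open>simp add: IP.minus_left IP.diff_right\<close>)
    then have 0: "ipx Y (\<alpha> - z) = 0" if "\<alpha> \<in> \<Phi>" for \<alpha> using that by (simp add: IP.minus_left IP.diff_right)
    have "ipx Y W = 0" if "W \<in> L" for W
      using that unfolding L_def
    proof (induction W rule: span_induct)
      show "subspace {W. ipx Y W = 0}"
        by (auto simp: subspace_def IP.add_right IP.scaleR_right IP.zero_right)
    qed (use 0 in auto)
    then have "ipx Y Y = 0" using Y by blast
    then show False using ipx_pos[of Y] Y La a(2) by force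
  qed
  have cont\<psi>: "continuous_on S \<psi>" for S
    unfolding \<psi>_def by (intro continuous_intros IP.continuous_on)
  have bounded_min: "\<exists>r>0. \<forall>Y\<in>L. r < norm Y \<longrightarrow> \<psi> 0 \<le> \<psi> Y"
  proof (cases "\<exists>Y\<in>L. Y \<noteq> 0")
    case False
    then show ?thesis by (intro exI[of _ 1]) auto
  next
    case True
    let ?S = "L \<inter> sphere 0 1"
    \<comment> \<open>\<open>h\<close> is positive on the unit sphere, so its minimum bounds some product from below uniformly\<close>
    define h where "h Y = (\<Sum>\<alpha>\<in>\<Phi>. max 0 (ipx Y (\<alpha> - z)))" for Y
    have cS: "compact ?S" by (meson sL closed_Int_compact closed_subspace compact_sphere)
    obtain Y0 where Y0: "Y0 \<in> L" "Y0 \<noteq> 0" using True by blast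
    then have "(1 / norm Y0) *\<^sub>R Y0 \<in> ?S" using sL by (simp add: subspace_scale)
    then have neS: "?S \<noteq> {}" by blast
    have "continuous_on ?S h" unfolding h_def by (intro continuous_intros IP.continuous_on)
    then obtain Y1 where Y1: "Y1 \<in> ?S" "\<And>Y. Y \<in> ?S \<Longrightarrow> h Y1 \<le> h Y"
      using continuous_attains_inf[OF cS neS] by blast
    have "0 < h Y1"
    proof -
      have "Y1 \<noteq> 0" using Y1(1) by auto
      then obtain \<alpha> where \<alpha>: "\<alpha> \<in> \<Phi>" "0 < ipx Y1 (\<alpha> - z)" using pos_dir Y1(1) by blast
      show ?thesis unfolding h_def by (rule sum_pos2[OF fin(1) \<alpha>(1)]) (use \<alpha>(2) in auto)
    qed
    define \<delta> where "\<delta> = h Y1 / card \<Phi>"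
    have cardp: "0 < card \<Phi>" using fin by (simp add: card_gt_0_iff)
    have \<delta>: "0 < \<delta>" using \<open>0 < h Y1\<close> cardp by (simp add: \<delta>_def)
    have big: "\<exists>\<alpha>\<in>\<Phi>. \<delta> \<le> ipx Y (\<alpha> - z)" if Y: "Y \<in> ?S" for Y
    proof (rule ccontr)
      assume n: "\<not> ?thesis"
      have "h Y < (\<Sum>\<alpha>\<in>\<Phi>. \<delta>)" unfolding h_def by (rule sum_strict_mono[OF fin]) (use n \<delta> in auto)
      also have "\<dots> = h Y1" using cardp by (simp add: \<delta>_def)
      finally show False using Y1(2)[OF Y] by simp
    qed
    define m where "m = Min (c ` \<Phi>)"
    have m: "0 < m" unfolding m_def using fin c by (subst Min_gr_iff) auto
    have mle: "m \<le> c \<alpha>" if "\<alpha> \<in> \<Phi>" for \<alpha> unfolding m_def using fin that by (intro Min_le) auto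
    \<comment> \<open>beyond this radius a single exponential term already exceeds \<open>\<psi> 0\<close>\<close>
    define r where "r = max 1 (ln (max 1 (\<psi> 0 / m)) / (2 * \<delta>))"
    have "\<psi> 0 \<le> \<psi> Y" if Y: "Y \<in> L" "r < norm Y" for Y
    proof -
      have n0: "0 < norm Y" using Y(2) by (auto simp: r_def)
      then have "(1 / norm Y) *\<^sub>R Y \<in> ?S" using sL Y(1) by (simp add: subspace_scale)
      then obtain \<alpha> where \<alpha>: "\<alpha> \<in> \<Phi>" "\<delta> \<le> ipx ((1 / norm Y) *\<^sub>R Y) (\<alpha> - z)" using big by blast
      then have ge: "\<delta> * norm Y \<le> ipx Y (\<alpha> - z)" using n0 by (simp add: IP.scaleR_left field_simps)
      have "ln (max 1 (\<psi> 0 / m)) / (2 * \<delta>) \<le> norm Y" using Y(2) by (simp add: r_def)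
      then have "ln (max 1 (\<psi> 0 / m)) \<le> 2 * (\<delta> * norm Y)" using \<delta> by (simp add: field_simps)
      also have "\<dots> \<le> 2 * ipx Y (\<alpha> - z)" using ge by simp
      finally have le: "exp (ln (max 1 (\<psi> 0 / m))) \<le> exp (2 * ipx Y (\<alpha> - z))" by (simp only: exp_le_cancel_iff)
      have "\<psi> 0 / m \<le> max 1 (\<psi> 0 / m)" by simp
      also have "\<dots> = exp (ln (max 1 (\<psi> 0 / m)))" by (subst exp_ln) auto
      also note le
      finally have "\<psi> 0 / m \<le> exp (2 * ipx Y (\<alpha> - z))" .
      then have "\<psi> 0 \<le> m * exp (2 * ipx Y (\<alpha> - z))" using m by (simp add: field_simps)
      also have "\<dots> \<le> c \<alpha> * exp (2 * ipx Y (\<alpha> - z))" using mle[OF \<alpha>(1)] by (intro mult_right_mono) auto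
      also have "\<dots> \<le> \<psi> Y" unfolding \<psi>_def
        by (rule member_le_sum[OF \<alpha>(1) _ fin(1), of "\<lambda>\<alpha>. c \<alpha> * exp (2 * ipx Y (\<alpha> - z))"]) (use c in \<open>auto simp: less_imp_le\<close>)
      finally show ?thesis .
    qed
    then show ?thesis by (intro exI[of _ r]) (auto simp: r_def)
  qed
  then obtain r where r: "r > 0" "\<And>Y. Y \<in> L \<Longrightarrow> r < norm Y \<Longrightarrow> \<psi> 0 \<le> \<psi> Y" by blast
  have cB: "compact (L \<inter> cball 0 r)" by (meson sL closed_Int_compact closed_subspace compact_cball)
  have 0: "0 \<in> L \<inter> cball 0 r" using r sL by (simp add: subspace_0)
  then obtain X where X: "X \<in> L \<inter> cball 0 r" "\<And>Y. Y \<in> L \<inter> cball 0 r \<Longrightarrow> \<psi> X \<le> \<psi> Y"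
    using continuous_attains_inf[OF cB _ cont\<psi>] by blast
  have min: "\<psi> X \<le> \<psi> Y" if "Y \<in> L" for Y
    using X(2)[of Y] X(2)[OF 0] r(2)[OF that] that by (cases "norm Y \<le> r") auto
  define \<xi> where "\<xi> = (\<Sum>\<alpha>\<in>\<Phi>. (c \<alpha> * exp (2 * ipx X (\<alpha> - z))) *\<^sub>R (\<alpha> - z))"
  have \<xi>L: "\<xi> \<in> L" unfolding \<xi>_def using \<Phi>L by (intro subspace_sum[OF sL] subspace_scale[OF sL])
  have XL: "X \<in> L" using X by simp
  have "((\<lambda>t. \<psi> (X + t *\<^sub>R \<xi>)) has_real_derivative (\<Sum>\<alpha>\<in>\<Phi>. c \<alpha> * (exp (2 * ipx X (\<alpha> - z)) * (2 * ipx \<xi> (\<alpha> - z))))) (at 0)"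
    unfolding \<psi>_def IP.add_left IP.scaleR_left by (auto intro!: derivative_eq_intros sum.cong)
  moreover have "(\<Sum>\<alpha>\<in>\<Phi>. c \<alpha> * (exp (2 * ipx X (\<alpha> - z)) * (2 * ipx \<xi> (\<alpha> - z)))) = 2 * ipx \<xi> \<xi>"
    by (subst (2) \<xi>_def) (simp add: IP.sum_right IP.scaleR_right sum_distrib_left mult_ac)
  ultimately have d: "((\<lambda>t. \<psi> (X + t *\<^sub>R \<xi>)) has_real_derivative 2 * ipx \<xi> \<xi>) (at 0)" by simp
  have "2 * ipx \<xi> \<xi> = 0"
    by (rule DERIV_local_min[OF d zero_less_one]) (use min XL \<xi>L sL in \<open>auto intro!: min subspace_add subspace_scale\<close>)
  then have "\<xi> = 0" using ipx_eq_0 \<xi>L La a(2) by (simp add: subset_iff)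
  moreover have "(\<Sum>\<alpha>\<in>\<Phi>. (c \<alpha> * exp (2 * ipx X \<alpha>)) *\<^sub>R (\<alpha> - z)) = exp (2 * ipx X z) *\<^sub>R \<xi>"
    unfolding \<xi>_def scaleR_sum_right
    by (rule sum.cong) (simp_all add: IP.diff_right right_diff_distrib exp_diff)
  ultimately show ?thesis using XL La by auto
qed

end

section \<open>Weights and nice vectors\<close>

locale reductive_weights = reductive_rep U G \<tau> ip
  for U G :: "'n::finite cmat set" and \<tau> :: "'n cmat \<Rightarrow> 'v::euclidean_space \<Rightarrow> 'v" and ip +
  fixes \<aa> :: "'n cmat set"
  assumes a_subalgebra: "lie_subalgebra \<aa> (lie G)" and a_p: "\<aa> \<subseteq> pspace U G"
begin

lemma subspace_a: "subspace \<aa>" and a_g: "\<aa> \<subseteq> \<gg>"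
  using a_subalgebra by (simp_all add: lie_subalgebra_def)

lemma in_a_p: "X \<in> \<aa> \<Longrightarrow> X \<in> \<pp>" and in_a_g: "X \<in> \<aa> \<Longrightarrow> X \<in> \<gg>"
  using a_p a_g by auto

lemma a_commute: "X \<in> \<aa> \<Longrightarrow> Y \<in> \<aa> \<Longrightarrow> X ** Y = Y ** X"
  by (rule subalgebra_of_p_commutes[OF a_subalgebra a_p])

abbreviation "Vw \<equiv> weight_space \<tau> ip \<aa>"
abbreviation "Wt \<equiv> weights \<tau> ip \<aa>"
abbreviation "wc \<equiv> weight_components \<tau> ip \<aa>"
abbreviation "supp \<equiv> weight_support \<tau> ip \<aa>"

lemma Wt_a: "Wt \<subseteq> \<aa>"
  by (auto simp: weights_def)

lemma Vw_iff: "\<alpha> \<in> \<aa> \<Longrightarrow> v \<in> Vw \<alpha> \<longleftrightarrow> (\<forall>X\<in>\<aa>. \<pi> X v = ipx X \<alpha> *\<^sub>R v)"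
  by (auto simp: weight_space_def ipx_eq in_a_g)

lemma subspace_Vw: "\<alpha> \<in> \<aa> \<Longrightarrow> subspace (Vw \<alpha>)"
  unfolding subspace_def
  by (auto simp: Vw_iff linear_add[OF \<pi>_linear] linear_scale[OF \<pi>_linear] linear_0[OF \<pi>_linear] in_a_g algebra_simps)

lemma Vw_orthogonal:
  assumes "\<alpha> \<in> \<aa>" "\<beta> \<in> \<aa>" "\<alpha> \<noteq> \<beta>" "v \<in> Vw \<alpha>" "u \<in> Vw \<beta>"
  shows "v \<bullet> u = 0"
proof -
  let ?X = "\<alpha> - \<beta>"
  have X: "?X \<in> \<aa>" using assms subspace_a by (simp add: subspace_diff)
  have "\<pi> ?X v = ipx ?X \<alpha> *\<^sub>R v" "\<pi> ?X u = ipx ?X \<beta> *\<^sub>R u" using assms X by (simp_all add: Vw_iff)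
  then have "ipx ?X \<alpha> * (v \<bullet> u) = ipx ?X \<beta> * (v \<bullet> u)" using \<pi>_sym[OF in_a_p[OF X], of v u] by simp
  then have "ipx ?X ?X * (v \<bullet> u) = 0" by (simp add: IP.diff_right[of ?X \<alpha> \<beta>] left_diff_distrib)
  moreover have "0 < ipx ?X ?X" using in_a_g[OF X] assms(3) by (intro ipx_pos) auto
  ultimately show ?thesis by simp
qed

text \<open>
  The eigenvalues of a joint eigenvector depend linearly on \<open>X \<in> \<aa>\<close> and are therefore given by a weight.
\<close>

lemma weight_basis:
  "\<exists>D wt. finite D \<and> span D = (UNIV :: 'v set) \<and> 0 \<notin> D \<and> (\<forall>d\<in>D. wt d \<in> \<aa> \<and> d \<in> Vw (wt d))"
proof -
  have "\<exists>D. finite D \<and> D \<subseteq> UNIV \<and> 0 \<notin> D \<and> span D = (UNIV :: 'v set)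
           \<and> (\<forall>x\<in>D. \<forall>y\<in>D. x \<noteq> y \<longrightarrow> x \<bullet> y = 0)
           \<and> (\<forall>x\<in>D. \<forall>i\<in>\<aa>. \<exists>c. \<pi> i x = c *\<^sub>R x)"
    by (rule form_joint_eigenbasis[where B = "(\<bullet>)", OF _ inner_commute])
      (auto simp: bilinear_conv_bounded_bilinear bounded_bilinear_inner \<pi>_linear in_a_g \<pi>_sym[OF in_a_p]
         intro!: \<pi>_commute a_commute)
  then obtain D where D: "finite D" "0 \<notin> D" "span D = (UNIV :: 'v set)" and ev: "\<forall>x\<in>D. \<forall>i\<in>\<aa>. \<exists>c. \<pi> i x = c *\<^sub>R x"
    by auto
  have "\<exists>\<alpha>\<in>\<aa>. d \<in> Vw \<alpha>" if d: "d \<in> D" for d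
  proof -
    have "linear (\<lambda>X. rayleigh (lie_proj X) d)"
      by (rule linearI) (simp_all add: rayleigh_add rayleigh_scaleR lie_proj linear_add[OF lie_proj(1)] linear_scale[OF lie_proj(1)])
    then obtain \<alpha> where \<alpha>: "\<alpha> \<in> \<aa>" "\<forall>X\<in>\<aa>. ipx \<alpha> X = rayleigh (lie_proj X) d" using riesz[OF subspace_a a_g] by blast
    have "\<pi> X d = ipx X \<alpha> *\<^sub>R d" if X: "X \<in> \<aa>" for X
    proof -
      obtain c where c: "\<pi> X d = c *\<^sub>R d" using ev d X by blast
      have "d \<bullet> d \<noteq> 0" using d D(2) by auto
      then have "rayleigh X d = c" by (simp add: rayleigh_def c)
      then have "ipx X \<alpha> = c" using \<alpha>(2) X by (simp add: lie_proj(3) in_a_g ipx_sym[of X])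
      then show ?thesis using c by simp
    qed
    then show ?thesis using \<alpha>(1) by (auto simp: Vw_iff)
  qed
  then obtain wt where "\<forall>d\<in>D. wt d \<in> \<aa> \<and> d \<in> Vw (wt d)" by metis
  then show ?thesis using D by blast
qed

lemma finite_Wt: "finite Wt"
proof -
  obtain D wt where D: "finite D" "span D = (UNIV :: 'v set)" and wt: "\<forall>d\<in>D. wt d \<in> \<aa> \<and> d \<in> Vw (wt d)"
    using weight_basis by blast
  have "\<alpha> \<in> wt ` D" if \<alpha>: "\<alpha> \<in> Wt" for \<alpha>
  proof (rule ccontr)
    assume n: "\<alpha> \<notin> wt ` D"
    have \<alpha>a: "\<alpha> \<in> \<aa>" using \<alpha> Wt_a by blast
    obtain v where v: "v \<in> Vw \<alpha>" "v \<noteq> 0"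
      using \<alpha> subspace_0[OF subspace_Vw[OF \<alpha>a]] unfolding weights_def by blast
    have o: "v \<bullet> d = 0" if "d \<in> D" for d using Vw_orthogonal[OF \<alpha>a _ _ v(1)] wt n that by blast
    have "v \<bullet> u = 0" if "u \<in> span D" for u
      using that
    proof (induction u rule: span_induct)
      show "subspace {u. v \<bullet> u = 0}" by (simp add: subspace_hyperplane)
    qed (use o in auto)
    then have "v \<bullet> v = 0" using D(2) by simp
    then show False using v(2) by simp
  qed
  then show ?thesis using finite_subset[of Wt "wt ` D"] D(1) by blast
qed

lemma weight_components:
  shows "\<And>\<alpha>. \<alpha> \<in> Wt \<Longrightarrow> wc v \<alpha> \<in> Vw \<alpha>" and "v = (\<Sum>\<alpha>\<in>Wt. wc v \<alpha>)"
proof -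
  obtain D wt where D: "finite D" "span D = (UNIV :: 'v set)" "0 \<notin> D" and wt: "\<forall>d\<in>D. wt d \<in> \<aa> \<and> d \<in> Vw (wt d)"
    using weight_basis by blast
  have wtW: "wt d \<in> Wt" if "d \<in> D" for d
  proof -
    have "wt d \<in> \<aa>" "d \<in> Vw (wt d)" "d \<noteq> 0" using wt that D(3) by auto
    then show ?thesis unfolding weights_def by blast
  qed
  obtain a where a: "v = (\<Sum>d\<in>D. a d *\<^sub>R d)" using span_finite[OF D(1)] D(2) by (metis (no_types, lifting) UNIV_I imageE)
  define c where "c \<alpha> = (if \<alpha> \<in> Wt then \<Sum>d\<in>{d\<in>D. wt d = \<alpha>}. a d *\<^sub>R d else 0)" for \<alpha>
  have c1: "c \<alpha> \<in> Vw \<alpha>" if "\<alpha> \<in> Wt" for \<alpha>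
  proof -
    have s: "subspace (Vw \<alpha>)" using that Wt_a by (intro subspace_Vw) auto
    have "(\<Sum>d\<in>{d\<in>D. wt d = \<alpha>}. a d *\<^sub>R d) \<in> Vw \<alpha>"
      by (rule subspace_sum[OF s]) (use wt subspace_scale[OF s] in auto)
    then show ?thesis using that by (simp add: c_def)
  qed
  have c3: "v = (\<Sum>\<alpha>\<in>Wt. c \<alpha>)"
  proof -
    have "(\<Sum>\<alpha>\<in>Wt. c \<alpha>) = (\<Sum>\<alpha>\<in>Wt. \<Sum>d\<in>{d\<in>D. wt d = \<alpha>}. a d *\<^sub>R d)" by (rule sum.cong) (auto simp: c_def)
    also have "\<dots> = (\<Sum>d\<in>D. a d *\<^sub>R d)" by (rule sum.group[OF D(1) finite_Wt]) (use wtW in auto)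
    finally show ?thesis using a by simp
  qed
  let ?P = "\<lambda>c. (\<forall>\<alpha>\<in>Wt. c \<alpha> \<in> Vw \<alpha>) \<and> (\<forall>\<alpha>. \<alpha> \<notin> Wt \<longrightarrow> c \<alpha> = 0) \<and> v = (\<Sum>\<alpha>\<in>Wt. c \<alpha>)"
  have Pc: "?P c" using c1 c3 by (auto simp: c_def)
  have uniq: "c' = c" if c': "?P c'" for c'
  proof
    fix \<beta>
    show "c' \<beta> = c \<beta>"
    proof (cases "\<beta> \<in> Wt")
      case True
      have \<beta>a: "\<beta> \<in> \<aa>" using True Wt_a by blast
      define e where "e \<alpha> = c' \<alpha> - c \<alpha>" for \<alpha>
      have eV: "e \<alpha> \<in> Vw \<alpha>" if "\<alpha> \<in> Wt" for \<alpha>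
        unfolding e_def using that c' Pc Wt_a by (intro subspace_diff[OF subspace_Vw]) auto
      have "(\<Sum>\<alpha>\<in>Wt. e \<alpha>) = 0" using c' Pc by (simp add: e_def sum_subtractf)
      then have "0 = (\<Sum>\<alpha>\<in>Wt. e \<alpha>) \<bullet> e \<beta>" by simp
      also have "\<dots> = (\<Sum>\<alpha>\<in>Wt. if \<alpha> = \<beta> then e \<beta> \<bullet> e \<beta> else 0)"
        unfolding inner_sum_left
        by (rule sum.cong) (use Vw_orthogonal[OF _ \<beta>a _ eV eV[OF True]] Wt_a in auto)
      also have "\<dots> = e \<beta> \<bullet> e \<beta>" using True finite_Wt by simp
      finally show ?thesis by (simp add: e_def)
    next
      case False then show ?thesis using c' Pc by simp
    qed
  qed
  have "wc v = c" unfolding weight_components_def by (rule the_equality, rule Pc, erule uniq)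
  then show "\<And>\<alpha>. \<alpha> \<in> Wt \<Longrightarrow> wc v \<alpha> \<in> Vw \<alpha>" "v = (\<Sum>\<alpha>\<in>Wt. wc v \<alpha>)" using Pc by auto
qed

lemma supp_a: "supp v \<subseteq> \<aa>" and finite_supp: "finite (supp v)"
  using Wt_a finite_Wt by (auto simp: weight_support_def)

lemma convex_hull_supp_a: "convex hull (supp v) \<subseteq> \<aa>"
  using supp_a by (rule hull_minimal) (rule subspace_imp_convex[OF subspace_a])

lemma supp_sum: "v = (\<Sum>\<alpha>\<in>supp v. wc v \<alpha>)"
proof -
  have "(\<Sum>\<alpha>\<in>supp v. wc v \<alpha>) = (\<Sum>\<alpha>\<in>Wt. wc v \<alpha>)"
    by (rule sum.mono_neutral_left[OF finite_Wt]) (auto simp: weight_support_def)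
  then show ?thesis using weight_components(2) by simp
qed

lemma supp_nonzero: "\<alpha> \<in> supp v \<Longrightarrow> wc v \<alpha> \<noteq> 0" and supp_Vw: "\<alpha> \<in> supp v \<Longrightarrow> wc v \<alpha> \<in> Vw \<alpha>"
  using weight_components(1) by (auto simp: weight_support_def)

lemma supp_nonempty: "v \<noteq> 0 \<Longrightarrow> supp v \<noteq> {}"
  using supp_sum[of v] by auto

lemma \<pi>_wc: "X \<in> \<aa> \<Longrightarrow> \<alpha> \<in> supp v \<Longrightarrow> \<pi> X (wc v \<alpha>) = ipx X \<alpha> *\<^sub>R wc v \<alpha>"
proof -
  assume X: "X \<in> \<aa>" and \<alpha>: "\<alpha> \<in> supp v"
  have "\<alpha> \<in> \<aa>" using \<alpha> supp_a by blast
  then show ?thesis using supp_Vw[OF \<alpha>] X by (simp add: Vw_iff)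
qed

lemma \<tau>_supp: "X \<in> \<aa> \<Longrightarrow> \<tau> (mexp (t *\<^sub>R X)) v = (\<Sum>\<alpha>\<in>supp v. exp (t * ipx X \<alpha>) *\<^sub>R wc v \<alpha>)"
proof -
  assume X: "X \<in> \<aa>"
  have "\<tau> (mexp (t *\<^sub>R X)) (\<Sum>\<alpha>\<in>supp v. wc v \<alpha>) = (\<Sum>\<alpha>\<in>supp v. \<tau> (mexp (t *\<^sub>R X)) (wc v \<alpha>))"
    by (rule linear_sum[OF \<tau>_linear[OF lie_mexp_scaleR[OF in_a_g[OF X]]]])
  then have "\<tau> (mexp (t *\<^sub>R X)) v = (\<Sum>\<alpha>\<in>supp v. \<tau> (mexp (t *\<^sub>R X)) (wc v \<alpha>))"
    by (simp only: supp_sum[symmetric])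
  also have "\<dots> = (\<Sum>\<alpha>\<in>supp v. exp (t * ipx X \<alpha>) *\<^sub>R wc v \<alpha>)"
    by (rule sum.cong) (use X \<pi>_wc \<tau>_eigen[OF in_a_g[OF X]] in auto)
  finally show ?thesis .
qed

lemma wc_orthogonal: "\<alpha> \<in> supp v \<Longrightarrow> \<beta> \<in> supp v \<Longrightarrow> \<alpha> \<noteq> \<beta> \<Longrightarrow> wc v \<alpha> \<bullet> wc v \<beta> = 0"
  using Vw_orthogonal supp_Vw supp_a by blast

lemma inner_supp_wc:
  assumes \<alpha>: "\<alpha> \<in> supp v"
  shows "(\<Sum>\<beta>\<in>supp v. f \<beta> *\<^sub>R wc v \<beta>) \<bullet> wc v \<alpha> = f \<alpha> * (wc v \<alpha> \<bullet> wc v \<alpha>)"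
proof -
  have "(\<Sum>\<beta>\<in>supp v. f \<beta> *\<^sub>R wc v \<beta>) \<bullet> wc v \<alpha>
    = (\<Sum>\<beta>\<in>supp v. if \<beta> = \<alpha> then f \<alpha> * (wc v \<alpha> \<bullet> wc v \<alpha>) else 0)"
    unfolding inner_sum_left by (rule sum.cong) (use wc_orthogonal[OF _ \<alpha>] in auto)
  then show ?thesis using \<alpha> finite_supp by simp
qed

lemma inner_supp: "(\<Sum>\<alpha>\<in>supp v. f \<alpha> *\<^sub>R wc v \<alpha>) \<bullet> (\<Sum>\<alpha>\<in>supp v. g \<alpha> *\<^sub>R wc v \<alpha>)
    = (\<Sum>\<alpha>\<in>supp v. f \<alpha> * g \<alpha> * (wc v \<alpha> \<bullet> wc v \<alpha>))"
  unfolding inner_sum_right by (rule sum.cong) (simp_all add: inner_supp_wc)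

lemma nice_moment:
  assumes W: "nice_space U G \<tau> ip \<aa> W" "w \<in> W" and X: "X \<in> \<aa>" and w: "w \<noteq> 0"
  shows "\<tau> (mexp X) w \<in> W" "\<tau> (mexp X) w \<noteq> 0" "\<mm> (\<tau> (mexp X) w) \<in> \<aa>"
proof -
  show 1: "\<tau> (mexp X) w \<in> W" using W X unfolding nice_space_def by blast
  show 2: "\<tau> (mexp X) w \<noteq> 0" using w \<tau>_eq_0[OF lie_mexp[OF in_a_g[OF X]]] by simp
  show "\<mm> (\<tau> (mexp X) w) \<in> \<aa>" using W 1 2 unfolding nice_space_def by blast
qed

text \<open>
  On \<open>\<tau> (mexp \<aa>) w\<close> the moment map has values in \<open>\<aa>\<close> by niceness, and there it is the barycentre of the weights with
  masses \<open>exp (2\<langle>X, \<alpha>\<rangle>) \<parallel>w\<^sub>\<alpha>\<parallel>\<^sup>2\<close>.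
\<close>

lemma moment_attains:
  assumes W: "nice_space U G \<tau> ip \<aa> W" "w \<in> W" and w: "w \<noteq> 0"
    and z: "z \<in> rel_interior (convex hull (supp w))"
  shows "\<exists>X\<in>\<aa>. \<mm> (\<tau> (mexp X) w) = z"
proof -
  define c where "c \<alpha> = wc w \<alpha> \<bullet> wc w \<alpha>" for \<alpha>
  have cpos: "0 < c \<alpha>" if "\<alpha> \<in> supp w" for \<alpha> using supp_nonzero[OF that] by (simp add: c_def)
  have za: "z \<in> \<aa>" using z rel_interior_subset convex_hull_supp_a by blast
  obtain X where X: "X \<in> \<aa>" "(\<Sum>\<alpha>\<in>supp w. (c \<alpha> * exp (2 * ipx X \<alpha>)) *\<^sub>R (\<alpha> - z)) = 0"
    using exponential_barycentre[where c = c, OF subspace_a a_g finite_supp supp_nonempty[OF w] supp_a z cpos] by blast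
  let ?x = "\<tau> (mexp X) w"
  note nm = nice_moment[OF W X(1) w]
  have xe: "?x = (\<Sum>\<alpha>\<in>supp w. exp (ipx X \<alpha>) *\<^sub>R wc w \<alpha>)" using \<tau>_supp[OF X(1), of 1 w] by simp
  have rayleigh: "rayleigh Y ?x = ipx z Y" if Y: "Y \<in> \<aa>" for Y
  proof -
    have "\<pi> Y ?x = (\<Sum>\<alpha>\<in>supp w. \<pi> Y (exp (ipx X \<alpha>) *\<^sub>R wc w \<alpha>))"
      unfolding xe by (rule linear_sum[OF \<pi>_linear[OF in_a_g[OF Y]]])
    also have "\<dots> = (\<Sum>\<alpha>\<in>supp w. (exp (ipx X \<alpha>) * ipx Y \<alpha>) *\<^sub>R wc w \<alpha>)"
      by (rule sum.cong) (simp_all add: linear_scale[OF \<pi>_linear[OF in_a_g[OF Y]]] \<pi>_wc[OF Y])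
    finally have n: "\<pi> Y ?x \<bullet> ?x = (\<Sum>\<alpha>\<in>supp w. (exp (ipx X \<alpha>) * ipx Y \<alpha>) * exp (ipx X \<alpha>) * c \<alpha>)"
      unfolding xe by (simp only: inner_supp c_def)
    have d: "?x \<bullet> ?x = (\<Sum>\<alpha>\<in>supp w. exp (ipx X \<alpha>) * exp (ipx X \<alpha>) * c \<alpha>)"
      unfolding xe by (simp only: inner_supp c_def)
    have e2: "exp (2 * ipx X \<alpha>) = exp (ipx X \<alpha>) * exp (ipx X \<alpha>)" for \<alpha> by (simp add: exp_add[symmetric])
    have "0 = ipx Y (\<Sum>\<alpha>\<in>supp w. (c \<alpha> * exp (2 * ipx X \<alpha>)) *\<^sub>R (\<alpha> - z))" by (simp add: X(2) IP.zero_right)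
    also have "\<dots> = (\<Sum>\<alpha>\<in>supp w. (exp (ipx X \<alpha>) * ipx Y \<alpha>) * exp (ipx X \<alpha>) * c \<alpha>
        - ipx Y z * (exp (ipx X \<alpha>) * exp (ipx X \<alpha>) * c \<alpha>))"
      unfolding IP.sum_right IP.scaleR_right IP.diff_right e2
      by (rule sum.cong) (simp_all add: algebra_simps)
    also have "\<dots> = \<pi> Y ?x \<bullet> ?x - ipx Y z * (?x \<bullet> ?x)"
      unfolding n d by (simp add: sum_subtractf sum_distrib_left)
    finally have "\<pi> Y ?x \<bullet> ?x = ipx Y z * (?x \<bullet> ?x)" by simp
    then show ?thesis using nm(2) by (simp add: rayleigh_def ipx_sym[of Y])
  qed
  have "\<mm> ?x = z"
  proof -
    have d: "\<mm> ?x - z \<in> \<aa>" using nm(3) za subspace_a by (simp add: subspace_diff)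
    have "ipx (\<mm> ?x - z) (\<mm> ?x - z) = 0"
      using rayleigh[OF d] moment_rayleigh[OF in_a_p[OF d], of ?x] by (simp add: IP.diff_left[of "\<mm> ?x" z])
    then show ?thesis using ipx_eq_0[OF in_a_g[OF d]] by simp
  qed
  then show ?thesis using X(1) by blast
qed

text \<open>
  All weights of \<open>w\<close> have product \<open>\<parallel>\<beta>\<parallel>\<^sup>2\<close> with the minimal convex combination \<open>\<beta>\<close>, so \<open>\<pi> \<beta>\<close> is scalar on
  the orbit of \<open>w\<close> under \<open>mexp \<aa>\<close>.
\<close>

lemma mcc_interior_imp_critical:
  assumes W: "nice_space U G \<tau> ip \<aa> W" "w \<in> W" and w: "w \<noteq> 0"
    and z: "mcc ip (supp w) \<in> rel_interior (convex hull (supp w))"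
  shows "\<exists>X\<in>\<aa>. critical_point F (\<tau> (mexp X) w)"
proof -
  let ?\<beta> = "mcc ip (supp w)"
  have sg: "supp w \<subseteq> \<gg>" using supp_a a_g by blast
  obtain X where X: "X \<in> \<aa>" "\<mm> (\<tau> (mexp X) w) = ?\<beta>" using moment_attains[OF W w z] by blast
  let ?x = "\<tau> (mexp X) w"
  have \<beta>a: "?\<beta> \<in> \<aa>" using nice_moment(3)[OF W X(1) w] X(2) by simp
  have eq: "ipx ?\<beta> \<alpha> = ipx ?\<beta> ?\<beta>" if "\<alpha> \<in> supp w" for \<alpha>
    by (rule affine_min_rel_interior[OF z _ that])
      (rule mcc_properties(2)[OF finite_supp supp_nonempty[OF w] sg], rule hull_inc)
  have xe: "?x = (\<Sum>\<alpha>\<in>supp w. exp (ipx X \<alpha>) *\<^sub>R wc w \<alpha>)" using \<tau>_supp[OF X(1), of 1 w] by simp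
  have "\<pi> ?\<beta> ?x = (\<Sum>\<alpha>\<in>supp w. \<pi> ?\<beta> (exp (ipx X \<alpha>) *\<^sub>R wc w \<alpha>))"
    unfolding xe by (rule linear_sum[OF \<pi>_linear[OF in_a_g[OF \<beta>a]]])
  also have "\<dots> = (\<Sum>\<alpha>\<in>supp w. ipx ?\<beta> ?\<beta> *\<^sub>R (exp (ipx X \<alpha>) *\<^sub>R wc w \<alpha>))"
    by (rule sum.cong) (simp_all add: linear_scale[OF \<pi>_linear[OF in_a_g[OF \<beta>a]]] \<pi>_wc[OF \<beta>a] eq)
  also have "\<dots> = ipx ?\<beta> ?\<beta> *\<^sub>R ?x" unfolding xe by (simp add: scaleR_sum_right)
  finally have "\<pi> (\<mm> ?x) ?x = F ?x *\<^sub>R ?x" by (simp add: F_eq X(2))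
  then show ?thesis using critical_iff[OF nice_moment(2)[OF W X(1) w]] X(1) by blast
qed

end

section \<open>Parabolic subgroups\<close>

text \<open>
  Conjugation by \<open>mexp (- n X)\<close>. An eigenvector of \<open>ad X\<close> for \<open>c\<close> is multiplied by \<open>exp (- n c)\<close>, so for large
  \<open>n\<close> this contracts the components of positive eigenvalue.
\<close>

definition flow :: "'n::finite cmat \<Rightarrow> nat \<Rightarrow> 'n cmat \<Rightarrow> 'n cmat" where
  "flow X n M = mexp ((- real n) *\<^sub>R X) ** M ** mexp (real n *\<^sub>R X)"

lemma mexp_nat_inverse: "mexp (real n *\<^sub>R X) ** mexp ((- real n) *\<^sub>R X) = mat 1"
  "mexp ((- real n) *\<^sub>R X) ** mexp (real n *\<^sub>R X) = mat 1"
  using mexp_minus[of "real n *\<^sub>R X"] by simp_all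

lemma flow_shift: "flow X n M ** mexp ((- real n) *\<^sub>R X) = mexp ((- real n) *\<^sub>R X) ** M"
  by (simp only: flow_def matrix_mul_assoc[symmetric] mexp_nat_inverse matrix_mul_rid)

lemma flow_mult: "flow X n (M ** N) = flow X n M ** flow X n N"
proof -
  have "flow X n M ** flow X n N
     = mexp ((- real n) *\<^sub>R X) ** M ** (mexp (real n *\<^sub>R X) ** mexp ((- real n) *\<^sub>R X)) ** N ** mexp (real n *\<^sub>R X)"
    unfolding flow_def by (simp only: matrix_mul_assoc)
  also have "\<dots> = mexp ((- real n) *\<^sub>R X) ** M ** N ** mexp (real n *\<^sub>R X)"
    by (simp only: mexp_nat_inverse matrix_mul_rid)
  finally show ?thesis by (simp only: flow_def matrix_mul_assoc)
qed

lemma linear_flow: "linear (flow X n)"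
  by (rule linearI) (simp_all add: flow_def mm.add_left mm.add_right mm.scaleR_left mm.scaleR_right)

lemma flow_commuting:
  assumes "X ** M = M ** X"
  shows "flow X n M = M"
proof -
  have "mexp ((- real n) *\<^sub>R X) ** M = M ** mexp ((- real n) *\<^sub>R X)"
    by (rule mexp_intertwine) (simp only: mm.scaleR_left mm.scaleR_right assms)
  then have "flow X n M = M ** (mexp ((- real n) *\<^sub>R X) ** mexp (real n *\<^sub>R X))"
    by (simp add: flow_def matrix_mul_assoc)
  then show ?thesis by (simp only: mexp_nat_inverse matrix_mul_rid)
qed

lemma flow_eigen:
  assumes "bracket X A = c *\<^sub>R A"
  shows "flow X n A = exp (- (real n * c)) *\<^sub>R A"
proof -
  have "flow X n A = exp (- (real n * c)) *\<^sub>R (A ** (mexp ((- real n) *\<^sub>R X) ** mexp (real n *\<^sub>R X)))"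
    using mexp_bracket_eigen[OF assms, of "- real n"] by (simp add: flow_def mm.scaleR_left matrix_mul_assoc)
  then show ?thesis by (simp only: mexp_nat_inverse matrix_mul_rid)
qed

lemma flow_diff_one: "flow X n M - mat 1 = flow X n (M - mat 1)"
  using flow_commuting[of X "mat 1" n] by (simp add: linear_diff[OF linear_flow])

lemma det_flow: "det (flow X n M) = det M"
proof -
  have "det (mexp ((- real n) *\<^sub>R X)) * det (mexp (real n *\<^sub>R X)) = 1"
    using arg_cong[OF mexp_nat_inverse(2)[of n X], of det] by (simp only: det_mul det_I)
  then show ?thesis by (simp add: flow_def det_mul mult_ac)
qed

context reductive_rep
begin

text \<open>
  A basis of the matrix space that diagonalises \<open>ad X\<close> for all \<open>X \<in> C\<close>, with eigenvalues \<open>ev A X\<close>. An element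
  \<open>p \<in> G\<close> is in the parabolic subgroup of \<open>X\<close> iff its components along the \<open>A\<close> with \<open>ev A X < 0\<close> vanish, that is,
  \<open>B p A = 0\<close>; in this form the condition is used below.
\<close>

definition ad_basis :: "'n cmat set \<Rightarrow> 'n cmat set \<Rightarrow> ('n cmat \<Rightarrow> 'n cmat \<Rightarrow> real) \<Rightarrow> bool" where
  "ad_basis C D ev \<longleftrightarrow> finite D \<and> span D = UNIV \<and> 0 \<notin> D \<and> (\<forall>x\<in>D. \<forall>y\<in>D. x \<noteq> y \<longrightarrow> B x y = 0)
     \<and> (\<forall>A\<in>D. \<forall>X\<in>C. bracket X A = ev A X *\<^sub>R A)"

lemma ad_basis_exists:
  assumes C: "C \<subseteq> \<pp>" and comm: "\<And>X Y. X \<in> C \<Longrightarrow> Y \<in> C \<Longrightarrow> X ** Y = Y ** X"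
  shows "\<exists>D ev. ad_basis C D ev"
proof -
  have "\<exists>D. finite D \<and> D \<subseteq> UNIV \<and> 0 \<notin> D \<and> span D = (UNIV :: 'n cmat set)
           \<and> (\<forall>x\<in>D. \<forall>y\<in>D. x \<noteq> y \<longrightarrow> B x y = 0)
           \<and> (\<forall>x\<in>D. \<forall>i\<in>C. \<exists>c. bracket i x = c *\<^sub>R x)"
  proof (rule form_joint_eigenbasis[OF bilinear_B B_sym])
    show "linear (bracket X)" for X :: "'n cmat"
      by (rule linearI) (simp_all add: bracket_def mm.add_left mm.add_right mm.scaleR_left mm.scaleR_right algebra_simps)
    show "bracket X (bracket Y A) = bracket Y (bracket X A)" if "X \<in> C" "Y \<in> C" for X Y A
    proof -
      have "X ** (Y ** A) = Y ** (X ** A)" using comm[OF that] by (simp add: matrix_mul_assoc)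
      moreover have "(A ** Y) ** X = (A ** X) ** Y" using comm[OF that] by (simp add: matrix_mul_assoc[symmetric])
      ultimately show ?thesis
        by (simp add: bracket_def mm.diff_left mm.diff_right matrix_mul_assoc algebra_simps)
    qed
    show "B (bracket X M) N = B M (bracket X N)" if "X \<in> C" for X M N
    proof -
      have "X \<in> \<pp>" using that C by blast
      then show ?thesis by (simp add: bracket_def BB.diff_left BB.diff_right B_p_left B_p_right)
    qed
  qed (auto simp: B_pos)
  then obtain D where D: "finite D" "0 \<notin> D" "span D = (UNIV :: 'n cmat set)"
      "\<forall>x\<in>D. \<forall>y\<in>D. x \<noteq> y \<longrightarrow> B x y = 0" and e: "\<forall>x\<in>D. \<forall>i\<in>C. \<exists>c. bracket i x = c *\<^sub>R x" by auto
  obtain ev where "\<forall>x\<in>D. \<forall>i\<in>C. bracket i x = ev x i *\<^sub>R x" using e by metis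
  then have "ad_basis C D ev" using D by (simp add: ad_basis_def)
  then show ?thesis by blast
qed

lemma ad_basis_props:
  assumes "ad_basis C D ev"
  shows "finite D" "A \<in> D \<Longrightarrow> 0 < B A A" "A \<in> D \<Longrightarrow> X \<in> C \<Longrightarrow> bracket X A = ev A X *\<^sub>R A"
    and "M = (\<Sum>A\<in>D. (B M A / B A A) *\<^sub>R A)"
proof -
  show f: "finite D" using assms by (simp add: ad_basis_def)
  have p: "0 < B A A" if "A \<in> D" for A using assms that by (intro B_pos) (auto simp: ad_basis_def)
  then show "A \<in> D \<Longrightarrow> 0 < B A A" .
  show "A \<in> D \<Longrightarrow> X \<in> C \<Longrightarrow> bracket X A = ev A X *\<^sub>R A" using assms by (simp add: ad_basis_def)
  show "M = (\<Sum>A\<in>D. (B M A / B A A) *\<^sub>R A)"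
    by (rule orthogonal_expansion[OF bilinear_B f]) (use assms p in \<open>auto simp: ad_basis_def\<close>)
qed

lemma flow_expansion:
  assumes D: "ad_basis C D ev" and X: "X \<in> C"
  shows "flow X n M = (\<Sum>A\<in>D. (exp (- (real n * ev A X)) * (B M A / B A A)) *\<^sub>R A)"
proof -
  note b = ad_basis_props[OF D]
  have "flow X n (\<Sum>A\<in>D. (B M A / B A A) *\<^sub>R A) = (\<Sum>A\<in>D. (B M A / B A A) *\<^sub>R flow X n A)"
    by (simp add: linear_sum[OF linear_flow] linear_scale[OF linear_flow])
  also have "\<dots> = (\<Sum>A\<in>D. (exp (- (real n * ev A X)) * (B M A / B A A)) *\<^sub>R A)"
    by (rule sum.cong) (simp_all add: flow_eigen[OF b(3)[OF _ X]])
  finally show ?thesis using b(4)[of M] by simp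
qed

lemma B_flow:
  assumes D: "ad_basis C D ev" and X: "X \<in> C" and A: "A \<in> D"
  shows "B (flow X n M) A = exp (- (real n * ev A X)) * B M A"
proof -
  note b = ad_basis_props[OF D]
  have "B (flow X n M) A = (\<Sum>A'\<in>D. (exp (- (real n * ev A' X)) * (B M A' / B A' A')) * B A' A)"
    unfolding flow_expansion[OF D X] by (simp add: BB.sum_left BB.scaleR_left)
  also have "\<dots> = (\<Sum>A'\<in>D. if A' = A then exp (- (real n * ev A X)) * B M A else 0)"
    by (rule sum.cong) (use D A b(2)[OF A] in \<open>auto simp: ad_basis_def\<close>)
  finally show ?thesis using A b(1) by simp
qed

lemma flow_component_vanishes:
  assumes D: "ad_basis C D ev" and X: "X \<in> C" and A: "A \<in> D" and le: "ev A X \<le> l"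
    and lim: "(\<lambda>n. exp (real n * l) *\<^sub>R flow X n M) \<longlonglongrightarrow> 0"
  shows "B M A = 0"
proof -
  have "(\<lambda>n. B (exp (real n * l) *\<^sub>R flow X n M) A) \<longlonglongrightarrow> B 0 A" by (intro BB.tendsto lim tendsto_const)
  then have z: "(\<lambda>n. norm (B (exp (real n * l) *\<^sub>R flow X n M) A)) \<longlonglongrightarrow> 0"
    by (simp only: BB.zero_left) (rule tendsto_norm_zero)
  have "norm (B M A) \<le> 0"
  proof (rule LIMSEQ_le[OF tendsto_const z], intro exI[of _ 0] allI impI)
    fix n :: nat
    have "real n * ev A X \<le> real n * l" using le by (rule mult_left_mono) simp
    then have "1 \<le> exp (real n * l - real n * ev A X)" by simp
    then have "1 \<le> exp (real n * l) * exp (- (real n * ev A X))" by (simp only: exp_add[symmetric] add_uminus_conv_diff)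
    from mult_right_mono[OF this, of "norm (B M A)"]
    show "norm (B M A) \<le> norm (B (exp (real n * l) *\<^sub>R flow X n M) A)"
      by (simp add: BB.scaleR_left B_flow[OF D X A] abs_mult)
  qed
  then show ?thesis by simp
qed

lemma flow_G: "X \<in> \<gg> \<Longrightarrow> p \<in> G \<Longrightarrow> flow X n p \<in> G"
  unfolding flow_def by (intro G_mult lie_mexp_scaleR)

lemma exp_neg_tendsto: "c < 0 \<Longrightarrow> (\<lambda>n. exp (real n * c)) \<longlonglongrightarrow> 0"
proof -
  assume c: "c < 0"
  have "filterlim (\<lambda>n. - c * real n) at_top sequentially"
    by (rule filterlim_tendsto_pos_mult_at_top[OF tendsto_const _ filterlim_real_sequentially]) (use c in simp)
  then have "filterlim (\<lambda>n. - (- c * real n)) at_bot sequentially" by (simp add: filterlim_uminus_at_bot)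
  from filterlim_compose[OF exp_at_bot this] show ?thesis by (simp add: mult.commute)
qed

text \<open>
  For each \<open>n\<close> the polar decomposition gives \<open>k\<^sub>n \<in> K\<close> for which \<open>k\<^sub>n g mexp(nX)\<close> is symmetric. Then
  \<open>mexp(-nX) (k\<^sub>n g) mexp(nX)\<close> is the adjoint of \<open>k\<^sub>n g\<close> for the invariant form, hence bounded in \<open>n\<close>. Its components of
  negative eigenvalue are those of \<open>k\<^sub>n g\<close> multiplied by growing exponentials, so they vanish for a limit of the \<open>k\<^sub>n g\<close>.
\<close>

lemma parabolic_decomposition:
  assumes D: "ad_basis C D ev" and C: "C \<subseteq> \<pp>" and X: "X \<in> C" and g: "g \<in> G"
  shows "\<exists>k\<in>K. \<exists>p\<in>G. g = k ** p \<and> (\<forall>A\<in>D. ev A X < 0 \<longrightarrow> B p A = 0)"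
proof -
  have Xp: "X \<in> \<pp>" using X C by blast
  note Xg = p_g[OF Xp]
  have ex: "\<exists>q. fst q \<in> K \<and> snd q \<in> \<pp> \<and> fst q ** g ** mexp (real n *\<^sub>R X) = mexp (snd q)" for n
  proof -
    have "g ** mexp (real n *\<^sub>R X) \<in> G" by (intro G_mult g lie_mexp_scaleR Xg)
    then obtain k Y where kY: "k \<in> K" "Y \<in> \<pp>" "g ** mexp (real n *\<^sub>R X) = k ** mexp Y" by (rule polar)
    have "matrix_inv k ** g ** mexp (real n *\<^sub>R X) = matrix_inv k ** (k ** mexp Y)"
      by (simp add: kY(3)[symmetric] matrix_mul_assoc)
    also have "\<dots> = mexp Y" by (simp add: matrix_mul_assoc K_inv[OF kY(1)])
    finally show ?thesis using kY(2) K_inv(1)[OF kY(1)] by (intro exI[of _ "(matrix_inv k, Y)"]) simp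
  qed
  have "\<exists>q. \<forall>n. fst (q n) \<in> K \<and> snd (q n) \<in> \<pp> \<and> fst (q n) ** g ** mexp (real n *\<^sub>R X) = mexp (snd (q n))"
    by (rule choice) (use ex in blast)
  then obtain q where q: "\<forall>n. fst (q n) \<in> K \<and> snd (q n) \<in> \<pp> \<and> fst (q n) ** g ** mexp (real n *\<^sub>R X) = mexp (snd (q n))"
    by blast
  define k Y where "k n = fst (q n)" and "Y n = snd (q n)" for n
  have kY: "k n \<in> K" "Y n \<in> \<pp>" "k n ** g ** mexp (real n *\<^sub>R X) = mexp (Y n)" for n
    using q by (simp_all add: k_def Y_def)
  define p where "p n = k n ** g" for n
  have pm: "p n ** mexp (real n *\<^sub>R X) = mexp (Y n)" for n using kY(3) by (simp add: p_def)
  obtain l r where l: "l \<in> K" and r: "strict_mono (r :: nat \<Rightarrow> nat)" and lim: "(k \<circ> r) \<longlonglongrightarrow> l"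
    using K_sequentially_compact[of k] kY(1) by metis
  have limp: "(\<lambda>n. p (r n)) \<longlonglongrightarrow> l ** g"
    unfolding p_def using mm.tendsto[OF lim[unfolded o_def] tendsto_const] .
  have key: "exp (- (real n * ev A X)) * B (p n) A = B (mat 1) (p n ** A)" if A: "A \<in> D" for n A
  proof -
    have "flow X n (p n) = mexp ((- real n) *\<^sub>R X) ** (mexp (Y n) ** mat 1)"
      by (simp add: flow_def pm[symmetric] matrix_mul_assoc)
    then have "B (flow X n (p n)) A = B (mat 1) (mexp (Y n) ** (mexp ((- real n) *\<^sub>R X) ** A))"
      by (simp only: B_mexp_p_left[OF subspace_scale[OF subspace_p Xp]] B_mexp_p_left[OF kY(2)])
    also have "mexp (Y n) ** (mexp ((- real n) *\<^sub>R X) ** A) = p n ** (mexp (real n *\<^sub>R X) ** mexp ((- real n) *\<^sub>R X)) ** A"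
      by (simp only: pm[symmetric] matrix_mul_assoc)
    finally show ?thesis using B_flow[OF D X A, of n "p n"] by (simp only: mexp_nat_inverse matrix_mul_rid)
  qed
  have "B (l ** g) A = 0" if A: "A \<in> D" and neg: "ev A X < 0" for A
  proof -
    have e: "B (p n) A = exp (real n * ev A X) * B (mat 1) (p n ** A)" for n
      unfolding key[OF A, symmetric] by (simp add: exp_minus)
    have "(\<lambda>n. exp (real (r n) * ev A X)) \<longlonglongrightarrow> 0"
      using LIMSEQ_subseq_LIMSEQ[OF exp_neg_tendsto[OF neg] r] by (simp add: o_def)
    then have "(\<lambda>n. exp (real (r n) * ev A X) * B (mat 1) (p (r n) ** A)) \<longlonglongrightarrow> 0 * B (mat 1) (l ** g ** A)"
      by (intro tendsto_mult BB.tendsto mm.tendsto limp tendsto_const)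
    then have "(\<lambda>n. B (p (r n)) A) \<longlonglongrightarrow> 0" by (simp add: e)
    moreover have "(\<lambda>n. B (p (r n)) A) \<longlonglongrightarrow> B (l ** g) A" by (intro BB.tendsto limp tendsto_const)
    ultimately show ?thesis using LIMSEQ_unique by blast
  qed
  moreover have "g = matrix_inv l ** (l ** g)" by (simp add: matrix_mul_assoc K_inv[OF l])
  moreover have "l ** g \<in> G" by (intro G_mult g K_G l)
  ultimately show ?thesis using K_inv(1)[OF l] by blast
qed

text \<open>
  Conjugation kills the components of positive eigenvalue and keeps those of eigenvalue zero. The determinant is
  constant along the way, so the limit is invertible and lies in \<open>G\<close>.
\<close>

lemma parabolic_limit:
  assumes D: "ad_basis C D ev" and C: "C \<subseteq> \<pp>" and X: "X \<in> C" and p: "p \<in> G"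
    and par: "\<And>A. A \<in> D \<Longrightarrow> ev A X < 0 \<Longrightarrow> B p A = 0"
  shows "\<exists>z\<in>G. (\<lambda>n. flow X n p) \<longlonglongrightarrow> z \<and> X ** z = z ** X"
proof -
  note b = ad_basis_props[OF D]
  have Xg: "X \<in> \<gg>" using X C p_g by blast
  define z where "z = (\<Sum>A\<in>D. (if ev A X = 0 then B p A / B A A else 0) *\<^sub>R A)"
  have lim: "(\<lambda>n. flow X n p) \<longlonglongrightarrow> z"
    unfolding flow_expansion[OF D X] z_def
  proof (intro tendsto_sum tendsto_scaleR tendsto_const)
    fix A assume A: "A \<in> D"
    consider "ev A X < 0" | "ev A X = 0" | "0 < ev A X" by linarith
    then show "(\<lambda>n. exp (- (real n * ev A X)) * (B p A / B A A)) \<longlonglongrightarrow> (if ev A X = 0 then B p A / B A A else 0)"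
    proof cases
      case 3
      have "(\<lambda>n. exp (real n * (- ev A X)) * (B p A / B A A)) \<longlonglongrightarrow> 0 * (B p A / B A A)"
        by (intro tendsto_mult exp_neg_tendsto tendsto_const) (use 3 in simp)
      then show ?thesis using 3 by simp
    qed (use par[OF A] in auto)
  qed
  have "X ** z - z ** X = (\<Sum>A\<in>D. (if ev A X = 0 then B p A / B A A else 0) *\<^sub>R bracket X A)"
    unfolding z_def
    by (simp add: mm.sum_left mm.sum_right mm.scaleR_left mm.scaleR_right sum_subtractf[symmetric] bracket_def scaleR_diff_right)
  also have "\<dots> = 0" by (rule sum.neutral) (use b(3) X in auto)
  finally have comm: "X ** z = z ** X" by simp
  have "isCont det z" using det_differentiable differentiable_imp_continuous_within by blast
  from isCont_tendsto_compose[OF this lim] have "det z = det p" by (simp add: det_flow LIMSEQ_const_iff)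
  moreover have "invertible p" using p group_G by (simp add: matrix_group_def)
  ultimately have "invertible z" by (simp add: invertible_det_nz)
  then have "z \<in> G"
    using closed_G[unfolded closed_in_GL_def, rule_format, of "\<lambda>n. flow X n p" z] lim flow_G[OF Xg p] by blast
  then show ?thesis using lim comm by blast
qed

lemma \<tau>_flow:
  assumes X: "X \<in> \<gg>" and p: "p \<in> G"
  shows "\<tau> (mexp ((- real n) *\<^sub>R X)) (\<tau> p v) = \<tau> (flow X n p) (\<tau> (mexp ((- real n) *\<^sub>R X)) v)"
proof -
  note m = lie_mexp_scaleR[OF X, of "- real n"]
  have "\<tau> (mexp ((- real n) *\<^sub>R X)) (\<tau> p v) = \<tau> (mexp ((- real n) *\<^sub>R X) ** p) v" by (rule \<tau>_mult[OF m p, symmetric])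
  also have "\<dots> = \<tau> (flow X n p ** mexp ((- real n) *\<^sub>R X)) v" by (simp only: flow_shift)
  also have "\<dots> = \<tau> (flow X n p) (\<tau> (mexp ((- real n) *\<^sub>R X)) v)" by (rule \<tau>_mult[OF flow_G[OF X p] m])
  finally show ?thesis .
qed

lemma parabolic_rescaled_limit:
  assumes X: "X \<in> \<gg>" and p: "p \<in> G" and z: "z \<in> G" "(\<lambda>n. flow X n p) \<longlonglongrightarrow> z"
    and lim: "(\<lambda>n. exp (real n * c) *\<^sub>R \<tau> (mexp ((- real n) *\<^sub>R X)) v) \<longlonglongrightarrow> u"
  shows "(\<lambda>n. exp (real n * c) *\<^sub>R \<tau> (mexp ((- real n) *\<^sub>R X)) (\<tau> p v)) \<longlonglongrightarrow> \<tau> z u"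
proof -
  have "(\<lambda>n. \<tau> (flow X n p) (exp (real n * c) *\<^sub>R \<tau> (mexp ((- real n) *\<^sub>R X)) v)) \<longlonglongrightarrow> \<tau> z u"
    by (rule \<tau>_tendsto[OF flow_G[OF X p] z(2) z(1) lim])
  then show ?thesis by (simp only: linear_scale[OF \<tau>_linear[OF flow_G[OF X p]]] \<tau>_flow[OF X p])
qed

text \<open>
  Applying a parabolic element preserves the decay rate, because it is conjugated to a convergent sequence.
\<close>

lemma parabolic_slope:
  assumes D: "ad_basis C D ev" and C: "C \<subseteq> \<pp>" and X: "X \<in> C" and p: "p \<in> G"
    and par: "\<And>A. A \<in> D \<Longrightarrow> ev A X < 0 \<Longrightarrow> B p A = 0" and v: "v \<noteq> 0"
    and lim: "(\<lambda>n. exp (real n * c) *\<^sub>R \<tau> (mexp ((- real n) *\<^sub>R X)) v) \<longlonglongrightarrow> u"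
  shows "c \<le> rayleigh X (\<tau> p v)" and "rayleigh X (\<tau> p v) = c \<Longrightarrow> \<pi> X (\<tau> p v) = c *\<^sub>R \<tau> p v"
proof -
  have Xp: "X \<in> \<pp>" using X C by blast
  have x: "\<tau> p v \<noteq> 0" using v \<tau>_eq_0[OF p] by simp
  obtain z where z: "z \<in> G" "(\<lambda>n. flow X n p) \<longlonglongrightarrow> z" using parabolic_limit[OF D C X p par] by blast
  from parabolic_rescaled_limit[OF p_g[OF Xp] p z lim]
  have "Bseq (\<lambda>n. exp (real n * c) *\<^sub>R \<tau> (mexp ((- real n) *\<^sub>R X)) (\<tau> p v))" by (intro convergent_imp_Bseq convergentI)
  then obtain M where M: "\<And>n. norm (exp (real n * c) *\<^sub>R \<tau> (mexp ((- real n) *\<^sub>R X)) (\<tau> p v)) \<le> M" unfolding Bseq_def by blast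
  have bd: "norm (\<tau> (mexp ((- real n) *\<^sub>R X)) (\<tau> p v)) \<le> M * exp (- (real n * c))" for n
    using M[of n] by (simp add: exp_minus field_simps)
  show "c \<le> rayleigh X (\<tau> p v)" by (rule decay_bound(1)[OF Xp x bd])
  show "rayleigh X (\<tau> p v) = c \<Longrightarrow> \<pi> X (\<tau> p v) = c *\<^sub>R \<tau> p v" by (rule decay_bound(2)[OF Xp x bd])
qed

text \<open>
  In particular a critical point minimises \<open>F\<close> on its orbit. The vector \<open>v\<close> decays under \<open>mexp (- t \<gamma>)\<close> exactly with
  rate \<open>\<parallel>\<gamma>\<parallel>\<^sup>2\<close>; up to an element of \<open>K\<close>, \<open>h\<close> is in the parabolic subgroup of \<open>\<gamma>\<close> and keeps this rate.
\<close>

lemma eigenvector_moment_bound: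
  assumes \<gamma>: "\<gamma> \<in> \<pp>" and v: "v \<noteq> 0" and e: "\<pi> \<gamma> v = ipx \<gamma> \<gamma> *\<^sub>R v" and h: "h \<in> G"
  shows "ipx \<gamma> \<gamma> \<le> F (\<tau> h v)"
proof -
  have C: "{\<gamma>} \<subseteq> \<pp>" using \<gamma> by simp
  obtain D ev where D: "ad_basis {\<gamma>} D ev" using ad_basis_exists[OF C] by auto
  obtain k p where k: "k \<in> K" and p: "p \<in> G" "h = k ** p" and par: "\<forall>A\<in>D. ev A \<gamma> < 0 \<longrightarrow> B p A = 0"
    using parabolic_decomposition[OF D C singletonI h] by blast
  let ?x = "\<tau> p v"
  have "exp (real n * ipx \<gamma> \<gamma>) *\<^sub>R \<tau> (mexp ((- real n) *\<^sub>R \<gamma>)) v = v" for n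
    by (simp only: \<tau>_eigen[OF p_g[OF \<gamma>] e]) (simp add: exp_minus)
  then have lim: "(\<lambda>n. exp (real n * ipx \<gamma> \<gamma>) *\<^sub>R \<tau> (mexp ((- real n) *\<^sub>R \<gamma>)) v) \<longlonglongrightarrow> v" by simp
  have "ipx \<gamma> \<gamma> \<le> rayleigh \<gamma> ?x"
    by (rule parabolic_slope(1)[OF D C singletonI p(1) _ v lim]) (use par in blast)
  then have "ipx \<gamma> \<gamma> \<le> ipx (\<mm> ?x) \<gamma>" by (simp add: moment_rayleigh[OF \<gamma>])
  moreover have "0 \<le> ipx (\<mm> ?x - \<gamma>) (\<mm> ?x - \<gamma>)"
    by (intro ipx_nonneg subspace_diff[OF subspace_g] p_g \<gamma> moment_p)
  ultimately have "ipx \<gamma> \<gamma> \<le> F ?x" by (simp add: ipx_diff_sq F_eq)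
  also have "F ?x = F (\<tau> h v)" by (simp add: p(2) \<tau>_mult[OF K_G[OF k] p(1)] F_K_invariant[OF k])
  finally show ?thesis .
qed

end

section \<open>Distinguished orbits of nice vectors\<close>

context reductive_weights
begin

text \<open>
  Only the \<open>\<pp>\<close>-part of \<open>E\<close> contributes to \<open>\<langle>\<pi> E y, y\<rangle>\<close>, which is thus a multiple of \<open>\<langle>E, m(y)\<rangle>\<close>; and as an
  eigenvector of \<open>ad H\<close> for \<open>l \<noteq> 0\<close>, \<open>E\<close> is orthogonal to \<open>\<aa>\<close>, where \<open>m(y)\<close> lies.
\<close>

lemma nice_root_orthogonal:
  assumes W: "nice_space U G \<tau> ip \<aa> W" "y \<in> W" and H: "H \<in> \<aa>" and E: "E \<in> \<gg>"
    and b: "bracket H E = l *\<^sub>R E" and l: "l \<noteq> 0"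
  shows "\<pi> E y \<bullet> y = 0"
proof (cases "y = 0")
  case False
  have m: "\<mm> y \<in> \<aa>" using W False unfolding nice_space_def by blast
  obtain Z X where ZX: "Z \<in> lie K" "X \<in> \<pp>" "E = Z + X" using cartan_decomposition[OF E] by blast
  have "\<pi> E y \<bullet> y = \<pi> X y \<bullet> y"
    using \<pi>_skew[OF ZX(1)] by (simp add: ZX(3) \<pi>_add lie_K_g[OF ZX(1)] p_g[OF ZX(2)] inner_add_left)
  also have "\<dots> = (y \<bullet> y) * ipx (\<mm> y) X" using False by (simp add: moment_rayleigh[OF ZX(2)] rayleigh_def)
  also have "ipx (\<mm> y) X = ipx E (\<mm> y)"
    using ipx_k_p[OF ZX(1) in_a_p[OF m]] by (simp add: ZX(3) IP.add_left ipx_sym[of X])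
  also have "ipx E (\<mm> y) = 0"
  proof -
    have bm: "bracket H (\<mm> y) = 0" using a_commute[OF H m] by (simp add: bracket_def)
    have "ipx (bracket H E) (\<mm> y) = ipx E (bracket H (\<mm> y))"
      by (rule ipx_bracket[OF in_a_p[OF H] E in_a_g[OF m]])
        (simp_all add: b bm lie_scaleR[OF E] subspace_0[OF subspace_g])
    then show ?thesis using l by (simp add: b bm IP.scaleR_left IP.zero_right)
  qed
  finally show ?thesis by simp
qed simp

text \<open>
  Polarising \<open>nice_root_orthogonal\<close> at \<open>u\<close> and \<open>\<pi> E u\<close> gives \<open>\<parallel>\<pi> E u\<parallel>\<^sup>2 + \<langle>\<pi> E (\<pi> E u), u\<rangle> = 0\<close>, and
  the second term is a product of eigenvectors of \<open>\<pi> H\<close> for the different eigenvalues \<open>c + 2l\<close> and \<open>c\<close>.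
\<close>

lemma root_fixes_nice_limit:
  assumes W: "nice_space U G \<tau> ip \<aa> W" "u \<in> W" "\<pi> E u \<in> W" and H: "H \<in> \<aa>" and E: "E \<in> \<gg>"
    and b: "bracket H E = l *\<^sub>R E" and l: "l \<noteq> 0" and u: "\<pi> H u = c *\<^sub>R u"
  shows "\<pi> E u = 0"
proof -
  have sW: "subspace W" using W(1) by (simp add: nice_space_def)
  interpret E: linear "\<pi> E" by (rule \<pi>_linear[OF E])
  let ?D = "\<pi> E u"
  have q: "\<pi> E y \<bullet> y = 0" if "y \<in> W" for y by (rule nice_root_orthogonal[OF W(1) that H E b l])
  have "\<pi> E (u + ?D) \<bullet> (u + ?D) = 0" using W sW by (intro q subspace_add)
  then have 1: "?D \<bullet> ?D + \<pi> E ?D \<bullet> u = 0"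
    using q[OF W(2)] q[OF W(3)] by (simp add: E.add inner_add_left inner_add_right)
  let ?P = "\<tau> (mexp H)"
  note Hg = in_a_g[OF H]
  interpret P: linear ?P by (rule \<tau>_linear[OF lie_mexp[OF Hg]])
  have Pu: "?P u = exp c *\<^sub>R u" using \<tau>_eigen[OF Hg u, of 1] by simp
  have PE: "?P (\<pi> E y) = exp l *\<^sub>R \<pi> E (?P y)" for y by (rule \<tau>_\<pi>_bracket[OF Hg E b])
  have PEE: "?P (\<pi> E ?D) = (exp l * exp l * exp c) *\<^sub>R \<pi> E ?D"
    by (simp add: PE Pu E.scaleR)
  have "?P (\<pi> E ?D) \<bullet> u = \<pi> E ?D \<bullet> ?P u" by (rule \<tau>_mexp_p_sym[OF in_a_p[OF H]])
  then have "(exp l * exp l * exp c) * (\<pi> E ?D \<bullet> u) = exp c * (\<pi> E ?D \<bullet> u)" by (simp add: PEE Pu)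
  then have "exp c * ((exp l * exp l) * (\<pi> E ?D \<bullet> u)) = exp c * (\<pi> E ?D \<bullet> u)" by (simp only: mult_ac)
  then have "(exp l * exp l) * (\<pi> E ?D \<bullet> u) = \<pi> E ?D \<bullet> u" by (simp only: mult_cancel_left exp_not_eq_zero simp_thms)
  then have "exp (l + l) * (\<pi> E ?D \<bullet> u) = exp 0 * (\<pi> E ?D \<bullet> u)" by (simp only: exp_add exp_zero mult_1)
  moreover have "exp (l + l) \<noteq> exp 0" unfolding exp_inj_iff using l by simp
  ultimately have "\<pi> E ?D \<bullet> u = 0" by (simp only: mult_cancel_right) blast
  then show ?thesis using 1 by simp
qed

lemma flow_mexp_root:
  assumes b: "bracket H E = l *\<^sub>R E"
  shows "flow H n (mexp (s *\<^sub>R E)) = mexp ((exp (- (real n * l)) * s) *\<^sub>R E)"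
proof -
  have "mexp ((- real n) *\<^sub>R H) ** E = exp ((- real n) * l) *\<^sub>R (E ** mexp ((- real n) *\<^sub>R H))"
    by (rule mexp_bracket_eigen[OF b])
  then have "mexp ((exp (- (real n * l)) * s) *\<^sub>R E) ** mexp ((- real n) *\<^sub>R H) = mexp ((- real n) *\<^sub>R H) ** mexp (s *\<^sub>R E)"
    by (intro mexp_intertwine) (simp add: mm.scaleR_left mm.scaleR_right mult.commute)
  then have "flow H n (mexp (s *\<^sub>R E)) = mexp ((exp (- (real n * l)) * s) *\<^sub>R E) ** (mexp ((- real n) *\<^sub>R H) ** mexp (real n *\<^sub>R H))"
    by (simp add: flow_def matrix_mul_assoc)
  then show ?thesis by (simp only: mexp_nat_inverse matrix_mul_rid)
qed

text \<open>
  Induction on the number of eigenvalues of \<open>ad H\<close> above \<open>l0\<close>. The part \<open>E\<close> of \<open>r - 1\<close> for the lowest of them, \<open>l\<close>, is the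
  limit of \<open>exp(n l) (mexp(-nH) r mexp(nH) - 1)\<close>, so it lies in \<open>lie G\<close>, and \<open>\<pi> E u\<close> is the limit of multiples of
  \<open>u - w\<^sub>n\<close>, where \<open>w\<^sub>n\<close> are the rescaled vectors of the nice space. Hence \<open>\<pi> E u\<close> is in the nice space and vanishes by
  \<open>root_fixes_nice_limit\<close>. So \<open>mexp (- E)\<close> fixes \<open>u\<close>, and \<open>mexp (- E) r\<close> still maps \<open>w\<close> to \<open>u\<close> but has only
  components above \<open>l\<close>.
\<close>

lemma unipotent_rigidity:
  assumes W: "nice_space U G \<tau> ip \<aa> W" and H: "H \<in> \<aa>" and D: "ad_basis \<aa> D ev"
    and wW: "\<And>n. exp (real n * c) *\<^sub>R \<tau> (mexp ((- real n) *\<^sub>R H)) w \<in> W"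
    and lim: "(\<lambda>n. exp (real n * c) *\<^sub>R \<tau> (mexp ((- real n) *\<^sub>R H)) w) \<longlonglongrightarrow> u"
    and u: "\<pi> H u = c *\<^sub>R u"
    and l0: "0 \<le> l0" and r: "r \<in> G" "\<tau> r w = u" and rD: "\<And>A. A \<in> D \<Longrightarrow> ev A H \<le> l0 \<Longrightarrow> B (r - mat 1) A = 0"
  shows "u = w"
  using l0 r rD
proof (induction "card {l \<in> (\<lambda>A. ev A H) ` D. l > l0}" arbitrary: l0 r rule: less_induct)
  case less
  note b = ad_basis_props[OF D]
  note Hg = in_a_g[OF H]
  let ?L = "\<lambda>l0. {l \<in> (\<lambda>A. ev A H) ` D. l > l0}"
  have fL: "finite (?L l0)" for l0 using b(1) by simp
  have cW: "closed W" using W by (simp add: nice_space_def closed_subspace)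
  have sW: "subspace W" using W by (simp add: nice_space_def)
  have uW: "u \<in> W" using closed_sequentially[OF cW _ lim] wW by blast
  show ?case
  proof (cases "?L l0 = {}")
    case True
    have "B (r - mat 1) A = 0" if "A \<in> D" for A using less.prems(4)[OF that] True that by force
    then have "r - mat 1 = 0" using b(4)[of "r - mat 1"] by simp
    then show ?thesis using less.prems(3) \<tau>_one by simp
  next
    case False
    define l where "l = Min (?L l0)"
    have l: "l \<in> ?L l0" unfolding l_def by (rule Min_in[OF fL False])
    have lmin: "l \<le> l'" if "l' \<in> ?L l0" for l' unfolding l_def by (rule Min_le[OF fL that])
    have lpos: "0 < l" using l less.prems(1) by auto
    have low: "B (r - mat 1) A = 0" if "A \<in> D" "ev A H < l" for A
      using less.prems(4)[OF that(1)] lmin[of "ev A H"] that by force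
    \<comment> \<open>the scale at which the component of eigenvalue \<open>l\<close> is stationary while the higher ones vanish\<close>
    define s where "s n = exp (real n * l)" for n
    have s: "filterlim s at_top sequentially"
    proof -
      have "filterlim (\<lambda>n. l * real n) at_top sequentially"
        by (rule filterlim_tendsto_pos_mult_at_top[OF tendsto_const lpos filterlim_real_sequentially])
      from filterlim_compose[OF exp_at_top this] show ?thesis by (simp add: s_def[abs_def] mult.commute)
    qed
    define E where "E = (\<Sum>A\<in>D. (if ev A H = l then B (r - mat 1) A / B A A else 0) *\<^sub>R A)"
    have bE: "bracket H E = l *\<^sub>R E"
    proof -
      have "bracket H E = (\<Sum>A\<in>D. (if ev A H = l then B (r - mat 1) A / B A A else 0) *\<^sub>R bracket H A)"
        unfolding E_def
        by (simp add: mm.sum_left mm.sum_right mm.scaleR_left mm.scaleR_right sum_subtractf[symmetric] bracket_def scaleR_diff_right)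
      also have "\<dots> = l *\<^sub>R E" unfolding E_def scaleR_sum_right
        by (rule sum.cong) (simp_all add: b(3)[OF _ H])
      finally show ?thesis .
    qed
    have limE: "(\<lambda>n. s n *\<^sub>R (flow H n r - mat 1)) \<longlonglongrightarrow> E"
    proof -
      have e: "s n *\<^sub>R (flow H n r - mat 1) = (\<Sum>A\<in>D. (exp (real n * (l - ev A H)) * (B (r - mat 1) A / B A A)) *\<^sub>R A)" for n
      proof -
        show ?thesis
          unfolding s_def flow_diff_one unfolding flow_expansion[OF D H]
          by (simp add: scaleR_sum_right right_diff_distrib exp_diff exp_minus field_simps)
      qed
      show ?thesis unfolding e E_def
      proof (intro tendsto_sum tendsto_scaleR tendsto_const)
        fix A assume A: "A \<in> D"
        consider "ev A H < l" | "ev A H = l" | "l < ev A H" by linarith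
        then show "(\<lambda>n. exp (real n * (l - ev A H)) * (B (r - mat 1) A / B A A)) \<longlonglongrightarrow> (if ev A H = l then B (r - mat 1) A / B A A else 0)"
        proof cases
          case 3
          have "(\<lambda>n. exp (real n * (l - ev A H)) * (B (r - mat 1) A / B A A)) \<longlonglongrightarrow> 0 * (B (r - mat 1) A / B A A)"
            by (intro tendsto_mult exp_neg_tendsto tendsto_const) (use 3 in simp)
          then show ?thesis using 3 by simp
        qed (use low[OF A] in auto)
      qed
    qed
    have Eg: "E \<in> \<gg>" by (rule tangent_in_lie[OF group_G closed_G flow_G[OF Hg less.prems(2)] s limE])
    let ?w = "\<lambda>n. exp (real n * c) *\<^sub>R \<tau> (mexp ((- real n) *\<^sub>R H)) w"
    have tw: "\<tau> (flow H n r) (?w n) = u" for n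
    proof -
      have "\<tau> (flow H n r) (?w n) = exp (real n * c) *\<^sub>R \<tau> (mexp ((- real n) *\<^sub>R H)) (\<tau> r w)"
        by (simp only: linear_scale[OF \<tau>_linear[OF flow_G[OF Hg less.prems(2)]]] \<tau>_flow[OF Hg less.prems(2)])
      also have "\<dots> = exp (real n * c) *\<^sub>R exp ((- real n) * c) *\<^sub>R u"
        by (simp only: less.prems(3) \<tau>_eigen[OF Hg u])
      also have "\<dots> = u" by (simp add: exp_minus)
      finally show ?thesis .
    qed
    have "(\<lambda>n. s n *\<^sub>R (\<tau> (flow H n r) (?w n) - ?w n)) \<longlonglongrightarrow> \<pi> E u"
      by (rule \<tau>_first_order[OF flow_G[OF Hg less.prems(2)] s limE Eg lim])
    then have "(\<lambda>n. s n *\<^sub>R (u - ?w n)) \<longlonglongrightarrow> \<pi> E u" by (simp only: tw)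
    then have EuW: "\<pi> E u \<in> W"
      by (rule closed_sequentially[OF cW, rotated]) (rule subspace_scale[OF sW subspace_diff[OF sW uW wW]])
    have Eu: "\<pi> E u = 0" by (rule root_fixes_nice_limit[OF W uW EuW H Eg bE _ u]) (use lpos in simp)
    define r' where "r' = mexp ((-1) *\<^sub>R E) ** r"
    have mE: "mexp ((-1) *\<^sub>R E) \<in> G" by (rule lie_mexp_scaleR[OF Eg])
    have r'G: "r' \<in> G" unfolding r'_def by (rule G_mult[OF mE less.prems(2)])
    have r'w: "\<tau> r' w = u"
    proof -
      have "\<tau> r' w = \<tau> (mexp ((-1) *\<^sub>R E)) u" unfolding r'_def by (simp only: \<tau>_mult[OF mE less.prems(2)] less.prems(3))
      also have "\<dots> = exp ((-1) * 0) *\<^sub>R u" by (rule \<tau>_eigen[OF Eg]) (simp add: Eu)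
      finally show ?thesis by simp
    qed
    have lim': "(\<lambda>n. s n *\<^sub>R (flow H n r' - mat 1)) \<longlonglongrightarrow> 0"
    proof -
      have f: "flow H n r' = mexp ((1 / s n) *\<^sub>R (- E)) ** flow H n r" for n
        unfolding r'_def flow_mult flow_mexp_root[OF bE] by (simp add: s_def exp_minus field_simps)
      have "(\<lambda>n. s n *\<^sub>R (flow H n r' - mat 1)) \<longlonglongrightarrow> - E + E"
        unfolding f by (intro scaled_product_tendsto mexp_scaled_tendsto tendsto_const s limE)
      then show ?thesis by simp
    qed
    have rD': "B (r' - mat 1) A = 0" if A: "A \<in> D" and le: "ev A H \<le> l" for A
      by (rule flow_component_vanishes[OF D H A le]) (use lim' in \<open>simp only: s_def flow_diff_one\<close>)
    have "?L l \<subset> ?L l0" using l by auto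
    then have "card (?L l) < card (?L l0)" by (rule psubset_card_mono[OF fL])
    then show ?thesis using less.hyps[of l r'] lpos r'G r'w rD' by auto
  qed
qed

lemma rescaled_flow_tendsto:
  assumes H: "H \<in> \<aa>" and ge: "\<And>\<alpha>. \<alpha> \<in> supp w \<Longrightarrow> c \<le> ipx H \<alpha>"
  shows "(\<lambda>n. exp (real n * c) *\<^sub>R \<tau> (mexp ((- real n) *\<^sub>R H)) w)
    \<longlonglongrightarrow> (\<Sum>\<alpha>\<in>supp w. (if ipx H \<alpha> = c then 1 else 0) *\<^sub>R wc w \<alpha>)"
proof -
  have ex: "exp (real n * c) *\<^sub>R \<tau> (mexp ((- real n) *\<^sub>R H)) w = (\<Sum>\<alpha>\<in>supp w. exp (real n * (c - ipx H \<alpha>)) *\<^sub>R wc w \<alpha>)" for n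
    unfolding \<tau>_supp[OF H] scaleR_sum_right
    by (rule sum.cong) (simp_all add: right_diff_distrib exp_diff exp_minus field_simps)
  show ?thesis unfolding ex
  proof (intro tendsto_sum tendsto_scaleR tendsto_const)
    fix \<alpha> assume "\<alpha> \<in> supp w"
    then have "c \<le> ipx H \<alpha>" by (rule ge)
    then show "(\<lambda>n. exp (real n * (c - ipx H \<alpha>))) \<longlonglongrightarrow> (if ipx H \<alpha> = c then 1 else 0)"
      using exp_neg_tendsto[of "c - ipx H \<alpha>"] by (cases "ipx H \<alpha> = c") auto
  qed
qed

text \<open>
  Let \<open>u\<close> be the component of \<open>w\<close> on which \<open>\<pi> H = c\<close>. In the limit, conjugation by \<open>mexp (- n H)\<close> moves \<open>p\<close> to some \<open>z\<close> that
  commutes with \<open>H\<close>, and \<open>\<tau> z u = \<tau> p w\<close>. So \<open>z\<^sup>-\<^sup>1 p\<close> maps \<open>w\<close> to \<open>u\<close> and is contracted to the identity.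
\<close>

lemma nice_parabolic_rigidity:
  assumes W: "nice_space U G \<tau> ip \<aa> W" "w \<in> W" and H: "H \<in> \<aa>" and D: "ad_basis \<aa> D ev"
    and p: "p \<in> G" and par: "\<And>A. A \<in> D \<Longrightarrow> ev A H < 0 \<Longrightarrow> B p A = 0"
    and e: "\<pi> H (\<tau> p w) = c *\<^sub>R \<tau> p w"
    and ge: "\<And>\<alpha>. \<alpha> \<in> supp w \<Longrightarrow> c \<le> ipx H \<alpha>" and \<alpha>: "\<alpha> \<in> supp w"
  shows "ipx H \<alpha> = c"
proof -
  note Hg = in_a_g[OF H]
  have sW: "subspace W" using W by (simp add: nice_space_def)
  let ?w = "\<lambda>n. exp (real n * c) *\<^sub>R \<tau> (mexp ((- real n) *\<^sub>R H)) w"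
  define u where "u = (\<Sum>\<alpha>\<in>supp w. (if ipx H \<alpha> = c then 1 else 0) *\<^sub>R wc w \<alpha>)"
  have wW: "?w n \<in> W" for n
  proof -
    have "mexp ((- real n) *\<^sub>R H) \<in> mexp ` \<aa>" using H subspace_a by (intro imageI subspace_scale)
    then have "\<tau> (mexp ((- real n) *\<^sub>R H)) w \<in> W" using W unfolding nice_space_def by blast
    then show ?thesis using sW by (rule subspace_scale[rotated])
  qed
  have lim: "?w \<longlonglongrightarrow> u" unfolding u_def by (rule rescaled_flow_tendsto[OF H ge])
  have u: "\<pi> H u = c *\<^sub>R u"
  proof -
    have "\<pi> H u = (\<Sum>\<alpha>\<in>supp w. (if ipx H \<alpha> = c then 1 else 0) *\<^sub>R \<pi> H (wc w \<alpha>))"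
      unfolding u_def by (simp only: linear_sum[OF \<pi>_linear[OF Hg]] linear_scale[OF \<pi>_linear[OF Hg]])
    also have "\<dots> = c *\<^sub>R u" unfolding u_def scaleR_sum_right
      by (rule sum.cong) (simp_all add: \<pi>_wc[OF H])
    finally show ?thesis .
  qed
  obtain z where z: "z \<in> G" "(\<lambda>n. flow H n p) \<longlonglongrightarrow> z" "H ** z = z ** H"
    using parabolic_limit[OF D a_p H p par] by blast
  have zu: "\<tau> z u = \<tau> p w"
  proof -
    have "exp (real n * c) *\<^sub>R \<tau> (mexp ((- real n) *\<^sub>R H)) (\<tau> p w) = \<tau> p w" for n
      by (simp only: \<tau>_eigen[OF Hg e]) (simp add: exp_minus)
    then have "(\<lambda>n. \<tau> p w) \<longlonglongrightarrow> \<tau> z u" using parabolic_rescaled_limit[OF Hg p z(1,2) lim] by (simp only:)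
    then show ?thesis by (simp add: LIMSEQ_const_iff)
  qed
  define r where "r = matrix_inv z ** p"
  have r: "r \<in> G" unfolding r_def by (intro G_mult G_inv(1) z p)
  have rw: "\<tau> r w = u"
    unfolding r_def by (simp only: \<tau>_mult[OF G_inv(1)[OF z(1)] p] zu[symmetric] \<tau>_inv[OF z(1)])
  have "u = w"
  proof (rule unipotent_rigidity[OF W(1) H D wW lim u order_refl r rw])
    fix A assume A: "A \<in> D" and le: "ev A H \<le> 0"
    have zc: "H ** matrix_inv z = matrix_inv z ** H"
    proof -
      have "H ** matrix_inv z = (matrix_inv z ** z) ** H ** matrix_inv z" by (simp add: G_inv[OF z(1)])
      also have "\<dots> = matrix_inv z ** (z ** H) ** matrix_inv z" by (simp only: matrix_mul_assoc)
      also have "\<dots> = matrix_inv z ** (H ** z) ** matrix_inv z" by (simp only: z(3))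
      also have "\<dots> = matrix_inv z ** H ** (z ** matrix_inv z)" by (simp only: matrix_mul_assoc)
      finally show ?thesis by (simp add: G_inv[OF z(1)])
    qed
    have "flow H n r = matrix_inv z ** flow H n p" for n
      unfolding r_def flow_mult by (simp only: flow_commuting[OF zc])
    then have "(\<lambda>n. flow H n r) \<longlonglongrightarrow> matrix_inv z ** z" using mm.tendsto[OF tendsto_const z(2)] by simp
    then have l1: "(\<lambda>n. flow H n r) \<longlonglongrightarrow> mat 1" by (simp add: G_inv[OF z(1)])
    have "(\<lambda>n. flow H n r - mat 1) \<longlonglongrightarrow> mat 1 - mat 1" by (intro tendsto_diff l1 tendsto_const)
    then have "(\<lambda>n. exp (real n * 0) *\<^sub>R flow H n (r - mat 1)) \<longlonglongrightarrow> 0" by (simp add: flow_diff_one)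
    then show "B (r - mat 1) A = 0" by (rule flow_component_vanishes[OF D H A le])
  qed
  then have "w \<bullet> wc w \<alpha> = (if ipx H \<alpha> = c then 1 else 0) * (wc w \<alpha> \<bullet> wc w \<alpha>)"
    using inner_supp_wc[OF \<alpha>, of "\<lambda>\<alpha>. if ipx H \<alpha> = c then 1 else 0"] by (simp only: u_def)
  moreover have "w \<bullet> wc w \<alpha> = wc w \<alpha> \<bullet> wc w \<alpha>"
    using inner_supp_wc[OF \<alpha>, of "\<lambda>_. 1"] supp_sum[of w] by simp
  ultimately show ?thesis using supp_nonzero[OF \<alpha>] by (auto split: if_splits)
qed

lemma mcc_supp:
  assumes w: "w \<noteq> 0"
  defines "\<beta> \<equiv> mcc ip (supp w)"
  shows "\<beta> \<in> convex hull (supp w)" "\<beta> \<in> \<aa>" "\<gamma> \<in> convex hull (supp w) \<Longrightarrow> ipx \<beta> \<beta> \<le> ipx \<beta> \<gamma>"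
proof -
  have sg: "supp w \<subseteq> \<gg>" using supp_a a_g by blast
  note m = mcc_properties[OF finite_supp supp_nonempty[OF w] sg]
  show 1: "\<beta> \<in> convex hull (supp w)" and "\<gamma> \<in> convex hull (supp w) \<Longrightarrow> ipx \<beta> \<beta> \<le> ipx \<beta> \<gamma>"
    unfolding \<beta>_def by (rule m(1), erule m(2))
  show "\<beta> \<in> \<aa>" using 1 convex_hull_supp_a by blast
qed

text \<open>
  Every relatively interior point of the convex hull is a value of \<open>m\<close> on the orbit, so its norm is at least
  \<open>\<parallel>\<gamma>\<parallel>\<close>; the minimal convex combination is a limit of such points.
\<close>

lemma critical_moment_le_mcc:
  assumes W: "nice_space U G \<tau> ip \<aa> W" "w \<in> W" and w: "w \<noteq> 0" and g: "g \<in> G"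
    and \<gamma>p: "\<gamma> \<in> \<pp>" and \<gamma>v: "\<pi> \<gamma> (\<tau> g w) = ipx \<gamma> \<gamma> *\<^sub>R \<tau> g w"
  shows "ipx \<gamma> \<gamma> \<le> ipx (mcc ip (supp w)) (mcc ip (supp w))"
proof -
  let ?CH = "convex hull (supp w)"
  define v where "v = \<tau> g w"
  define \<beta> where "\<beta> = mcc ip (supp w)"
  have v: "v \<noteq> 0" using w \<tau>_eq_0[OF g] by (simp add: v_def)
  note \<gamma>v = \<gamma>v[folded v_def] and \<beta>CH = mcc_supp(1)[OF w, folded \<beta>_def]
  have le_ri: "ipx \<gamma> \<gamma> \<le> ipx z z" if z: "z \<in> rel_interior ?CH" for z
  proof -
    obtain X where X: "X \<in> \<aa>" "\<mm> (\<tau> (mexp X) w) = z" using moment_attains[OF W w z] by blast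
    have mG: "mexp X \<in> G" by (rule lie_mexp[OF in_a_g[OF X(1)]])
    have "\<tau> (mexp X) w = \<tau> (mexp X ** matrix_inv g) v"
      by (simp only: v_def \<tau>_mult[OF mG G_inv(1)[OF g]] \<tau>_inv[OF g])
    then have "ipx \<gamma> \<gamma> \<le> F (\<tau> (mexp X) w)"
      using eigenvector_moment_bound[OF \<gamma>p v \<gamma>v G_mult[OF mG G_inv(1)[OF g]]] by simp
    then show ?thesis by (simp add: F_eq X(2))
  qed
  have "ipx \<gamma> \<gamma> \<le> ipx \<beta> \<beta>"
  proof -
    have "\<beta> \<in> closure (rel_interior ?CH)"
      using \<beta>CH closure_subset[of ?CH] by (subst convex_closure_rel_interior) auto
    then obtain z where z: "\<And>n. z n \<in> rel_interior ?CH" "z \<longlonglongrightarrow> \<beta>" unfolding closure_sequential by blast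
    have "(\<lambda>n. ipx (z n) (z n)) \<longlonglongrightarrow> ipx \<beta> \<beta>" by (intro IP.tendsto z)
    then show ?thesis by (rule LIMSEQ_le_const) (use le_ri z(1) in blast)
  qed
  then show ?thesis by (simp add: \<beta>_def)
qed

text \<open>
  Take \<open>X = \<beta> + e H\<close> with \<open>H\<close> orthogonal to \<open>\<beta>\<close> obtained from a supporting hyperplane at \<open>\<beta>\<close>. On the weights
  with \<open>\<langle>\<beta>, \<alpha>\<rangle> = \<parallel>\<beta>\<parallel>\<^sup>2\<close> the product with \<open>H\<close> is nonnegative. The other weights, and the negative eigenvalues of
  \<open>ad \<beta>\<close>, satisfy finitely many strict inequalities that survive for small \<open>e\<close>.
\<close>

lemma supporting_perturbation:
  assumes w: "w \<noteq> 0" and D: "ad_basis \<aa> D ev"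
  defines "\<beta> \<equiv> mcc ip (supp w)"
  assumes nri: "\<beta> \<notin> rel_interior (convex hull (supp w))"
  shows "\<exists>X\<in>\<aa>. ipx X \<beta> = ipx \<beta> \<beta> \<and> (\<forall>\<alpha>\<in>supp w. ipx \<beta> \<beta> \<le> ipx X \<alpha>) \<and> (\<exists>\<alpha>\<in>supp w. ipx \<beta> \<beta> < ipx X \<alpha>)
    \<and> (\<forall>A\<in>D. ev A \<beta> < 0 \<longrightarrow> ev A X < 0)"
proof -
  let ?CH = "convex hull (supp w)"
  note CHa = convex_hull_supp_a and \<beta>CH = mcc_supp(1)[OF w, folded \<beta>_def]
    and \<beta>a = mcc_supp(2)[OF w, folded \<beta>_def] and \<beta>min = mcc_supp(3)[OF w, folded \<beta>_def]
  obtain a where a: "\<And>y. y \<in> ?CH \<Longrightarrow> a \<bullet> \<beta> \<le> a \<bullet> y" "\<And>y. y \<in> rel_interior ?CH \<Longrightarrow> a \<bullet> \<beta> < a \<bullet> y"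
    using supporting_hyperplane_rel_boundary[OF convex_convex_hull \<beta>CH nri] by metis
  have "linear (\<lambda>X. a \<bullet> X)" by (simp add: bounded_linear.linear bounded_linear_inner_right)
  then obtain H0 where H0: "H0 \<in> \<aa>" "\<forall>X\<in>\<aa>. ipx H0 X = a \<bullet> X" using riesz[OF subspace_a a_g] by blast
  have H0ge: "ipx H0 \<beta> \<le> ipx H0 \<alpha>" if "\<alpha> \<in> ?CH" for \<alpha>
    using a(1)[OF that] H0(2) subsetD[OF CHa that] \<beta>a by simp
  have H0strict: "\<exists>\<alpha>\<in>supp w. ipx H0 \<beta> < ipx H0 \<alpha>"
  proof (rule ccontr)
    assume n: "\<not> ?thesis"
    have "convex {\<alpha>. ipx H0 \<alpha> \<le> ipx H0 \<beta>}"
      using convex_linear_vimage[OF bounded_linear.linear[OF IP.bounded_linear_right], of "{..ipx H0 \<beta>}" H0]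
      by (simp add: vimage_def)
    then have "?CH \<subseteq> {\<alpha>. ipx H0 \<alpha> \<le> ipx H0 \<beta>}" using n by (intro hull_minimal) auto
    moreover obtain y where y: "y \<in> rel_interior ?CH"
      using rel_interior_eq_empty[OF convex_convex_hull, of "supp w"] supp_nonempty[OF w] by auto
    ultimately have "ipx H0 y \<le> ipx H0 \<beta>" using rel_interior_subset by blast
    moreover have "y \<in> \<aa>" using y rel_interior_subset CHa by blast
    ultimately show False using a(2)[OF y] H0(2) \<beta>a by simp
  qed
  \<comment> \<open>for \<open>\<beta> = 0\<close> division by zero gives \<open>H = H0\<close>, which is already orthogonal to \<open>\<beta>\<close>\<close>
  define H where "H = H0 - (ipx H0 \<beta> / ipx \<beta> \<beta>) *\<^sub>R \<beta>"
  have Ha: "H \<in> \<aa>" unfolding H_def using H0 \<beta>a subspace_a by (intro subspace_diff subspace_scale)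
  have H\<beta>: "ipx H \<beta> = 0"
    using ipx_eq_0[OF in_a_g[OF \<beta>a]] by (cases "\<beta> = 0") (simp_all add: H_def IP.diff_left IP.scaleR_left IP.zero_right)
  have Hface: "ipx H \<alpha> = ipx H0 \<alpha> - ipx H0 \<beta>" if "ipx \<beta> \<alpha> = ipx \<beta> \<beta>" for \<alpha>
    using ipx_eq_0[OF in_a_g[OF \<beta>a]] that by (cases "\<beta> = 0") (simp_all add: H_def IP.diff_left IP.scaleR_left IP.zero_right IP.zero_left)
  note b = ad_basis_props[OF D]
  have ev_add: "ev A (\<beta> + e *\<^sub>R H) = ev A \<beta> + e * ev A H" if A: "A \<in> D" for A e
  proof -
    have X: "\<beta> + e *\<^sub>R H \<in> \<aa>" using \<beta>a Ha subspace_a by (intro subspace_add subspace_scale)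
    have "ev A (\<beta> + e *\<^sub>R H) *\<^sub>R A = bracket (\<beta> + e *\<^sub>R H) A" using b(3)[OF A X] by simp
    also have "\<dots> = bracket \<beta> A + e *\<^sub>R bracket H A"
      by (simp add: bracket_def mm.add_left mm.add_right mm.scaleR_left mm.scaleR_right algebra_simps)
    also have "\<dots> = (ev A \<beta> + e * ev A H) *\<^sub>R A" by (simp add: b(3)[OF A \<beta>a] b(3)[OF A Ha] scaleR_add_left)
    finally show ?thesis using b(2)[OF A] BB.zero_left by auto
  qed
  have small: "\<forall>\<^sub>F e in at_right 0. x + e * y > (0::real)" if "x > 0" for x y
  proof -
    have "((\<lambda>e. x + e * y) \<longlongrightarrow> x + 0 * y) (at_right 0)" by (intro tendsto_intros)
    then show ?thesis using order_tendstoD(1)[of _ "x + 0 * y"] that by simp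
  qed
  have "\<forall>\<^sub>F e in at_right 0. \<forall>A\<in>{A\<in>D. ev A \<beta> < 0}. - ev A \<beta> + e * (- ev A H) > 0"
    using b(1) by (intro eventually_ball_finite ballI small) auto
  moreover have "\<forall>\<^sub>F e in at_right 0. \<forall>\<alpha>\<in>{\<alpha>\<in>supp w. ipx \<beta> \<beta> < ipx \<beta> \<alpha>}. (ipx \<beta> \<alpha> - ipx \<beta> \<beta>) + e * ipx H \<alpha> > 0"
    using finite_supp by (intro eventually_ball_finite ballI small) auto
  moreover have "\<forall>\<^sub>F e in at_right 0. e > (0::real)" by (simp add: eventually_at_right_less)
  ultimately have "\<forall>\<^sub>F e in at_right 0. (\<forall>A\<in>{A\<in>D. ev A \<beta> < 0}. - ev A \<beta> + e * (- ev A H) > 0)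
     \<and> (\<forall>\<alpha>\<in>{\<alpha>\<in>supp w. ipx \<beta> \<beta> < ipx \<beta> \<alpha>}. (ipx \<beta> \<alpha> - ipx \<beta> \<beta>) + e * ipx H \<alpha> > 0) \<and> e > (0::real)"
    by (intro eventually_conj)
  then obtain e where e1: "\<forall>A\<in>{A\<in>D. ev A \<beta> < 0}. - ev A \<beta> + e * (- ev A H) > 0"
    and e2: "\<forall>\<alpha>\<in>{\<alpha>\<in>supp w. ipx \<beta> \<beta> < ipx \<beta> \<alpha>}. (ipx \<beta> \<alpha> - ipx \<beta> \<beta>) + e * ipx H \<alpha> > 0" and e0: "e > (0::real)"
    using eventually_happens'[OF trivial_limit_at_right_real] by blast
  define X where "X = \<beta> + e *\<^sub>R H"
  have Xa: "X \<in> \<aa>" unfolding X_def using \<beta>a Ha subspace_a by (intro subspace_add subspace_scale)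
  have X\<alpha>: "ipx X \<alpha> = ipx \<beta> \<alpha> + e * ipx H \<alpha>" for \<alpha> by (simp add: X_def IP.add_left IP.scaleR_left)
  have Xge: "ipx \<beta> \<beta> \<le> ipx X \<alpha>" if \<alpha>: "\<alpha> \<in> supp w" for \<alpha>
  proof (cases "ipx \<beta> \<alpha> = ipx \<beta> \<beta>")
    case True
    have "0 \<le> e * ipx H \<alpha>" using Hface[OF True] H0ge[OF hull_inc[OF \<alpha>]] e0 by simp
    then show ?thesis using True by (simp add: X\<alpha>)
  next
    case False
    then have "ipx \<beta> \<beta> < ipx \<beta> \<alpha>" using \<beta>min[OF hull_inc[OF \<alpha>]] by simp
    then show ?thesis using e2 \<alpha> by (force simp: X\<alpha>)
  qed
  have Xstrict: "\<exists>\<alpha>\<in>supp w. ipx \<beta> \<beta> < ipx X \<alpha>"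
  proof (cases "\<forall>\<alpha>\<in>supp w. ipx \<beta> \<alpha> = ipx \<beta> \<beta>")
    case True
    obtain \<alpha> where \<alpha>: "\<alpha> \<in> supp w" "ipx H0 \<beta> < ipx H0 \<alpha>" using H0strict by blast
    have t: "ipx \<beta> \<alpha> = ipx \<beta> \<beta>" using True \<alpha>(1) by blast
    have "0 < e * ipx H \<alpha>" using Hface[OF t] \<alpha>(2) e0 by simp
    then show ?thesis using \<alpha>(1) t by (intro bexI[of _ \<alpha>]) (simp_all add: X\<alpha>)
  next
    case False
    then obtain \<alpha> where \<alpha>: "\<alpha> \<in> supp w" "ipx \<beta> \<alpha> \<noteq> ipx \<beta> \<beta>" by blast
    then have "ipx \<beta> \<beta> < ipx \<beta> \<alpha>" using \<beta>min[OF hull_inc[OF \<alpha>(1)]] by simp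
    then show ?thesis using e2 \<alpha>(1) by (force simp: X\<alpha>)
  qed
  have "ev A X < 0" if A: "A \<in> D" and neg: "ev A \<beta> < 0" for A
  proof -
    have "- ev A \<beta> + e * (- ev A H) > 0" using e1 A neg by blast
    then show ?thesis unfolding X_def ev_add[OF A] by simp
  qed
  moreover have "ipx X \<beta> = ipx \<beta> \<beta>" by (simp add: X\<alpha> H\<beta>)
  ultimately show ?thesis using Xa Xge Xstrict by blast
qed

text \<open>
  The same \<open>p\<close> is parabolic for \<open>\<beta>\<close> and for the perturbed \<open>X\<close>: the decay rate for \<open>\<beta>\<close> determines
  \<open>m(p w) = \<beta>\<close>, and then the rate for \<open>X\<close> is attained, which makes \<open>p w\<close> an eigenvector of \<open>\<pi> X\<close>.
\<close>

lemma mcc_interior_of_distinguished: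
  assumes W: "nice_space U G \<tau> ip \<aa> W" "w \<in> W" and w: "w \<noteq> 0"
    and g: "g \<in> G" and crit: "critical_point F (\<tau> g w)"
  shows "mcc ip (supp w) \<in> rel_interior (convex hull (supp w))"
proof (rule ccontr)
  define \<beta> where "\<beta> = mcc ip (supp w)"
  assume "\<not> ?thesis"
  then have nri: "\<beta> \<notin> rel_interior (convex hull (supp w))" by (simp add: \<beta>_def)
  note \<beta>a = mcc_supp(2)[OF w, folded \<beta>_def] and \<beta>min = mcc_supp(3)[OF w, folded \<beta>_def]
  define v where "v = \<tau> g w"
  have v: "v \<noteq> 0" using w \<tau>_eq_0[OF g] by (simp add: v_def)
  have \<gamma>v: "\<pi> (\<mm> v) v = ipx (\<mm> v) (\<mm> v) *\<^sub>R v"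
    using crit critical_iff[OF v] by (simp add: v_def[symmetric] F_eq)
  have le_\<beta>: "ipx (\<mm> v) (\<mm> v) \<le> ipx \<beta> \<beta>"
    unfolding \<beta>_def by (rule critical_moment_le_mcc[OF W w g moment_p]) (use \<gamma>v v_def in simp)
  obtain D ev where D: "ad_basis \<aa> D ev" using ad_basis_exists[OF a_p a_commute] by blast
  from supporting_perturbation[OF w D, folded \<beta>_def, OF nri]
  obtain X where Xa: "X \<in> \<aa>" and X\<beta>: "ipx X \<beta> = ipx \<beta> \<beta>" and Xge': "\<forall>\<alpha>\<in>supp w. ipx \<beta> \<beta> \<le> ipx X \<alpha>"
    and Xstrict: "\<exists>\<alpha>\<in>supp w. ipx \<beta> \<beta> < ipx X \<alpha>" and X\<beta>neg: "\<forall>A\<in>D. ev A \<beta> < 0 \<longrightarrow> ev A X < 0" by blast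
  have Xge: "ipx \<beta> \<beta> \<le> ipx X \<alpha>" if "\<alpha> \<in> supp w" for \<alpha> using Xge' that by simp
  obtain k p where k: "k \<in> K" and p: "p \<in> G" "g = k ** p" and parX: "\<forall>A\<in>D. ev A X < 0 \<longrightarrow> B p A = 0"
    using parabolic_decomposition[OF D a_p Xa g] by blast
  have parX': "B p A = 0" if "A \<in> D" "ev A X < 0" for A using parX that by simp
  have par\<beta>: "B p A = 0" if "A \<in> D" "ev A \<beta> < 0" for A using parX X\<beta>neg that by simp
  let ?x = "\<tau> p w"
  have vx: "v = \<tau> k ?x" unfolding v_def p(2) by (rule \<tau>_mult[OF K_G[OF k] p(1)])
  have Fx: "ipx (\<mm> ?x) (\<mm> ?x) \<le> ipx \<beta> \<beta>"
    using le_\<beta> F_K_invariant[OF k, of ?x] by (simp add: F_eq vx)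
  have "ipx \<beta> \<beta> \<le> rayleigh \<beta> ?x"
    by (rule parabolic_slope(1)[OF D a_p \<beta>a p(1) par\<beta> w rescaled_flow_tendsto[OF \<beta>a]])
      (assumption, assumption, rule \<beta>min, erule hull_inc)
  then have "ipx \<beta> \<beta> \<le> ipx (\<mm> ?x) \<beta>" by (simp add: moment_rayleigh[OF in_a_p[OF \<beta>a]])
  then have "ipx (\<mm> ?x - \<beta>) (\<mm> ?x - \<beta>) \<le> 0" using Fx by (simp add: ipx_diff_sq)
  moreover have d: "\<mm> ?x - \<beta> \<in> \<gg>" by (intro subspace_diff[OF subspace_g] p_g[OF moment_p] in_a_g[OF \<beta>a])
  ultimately have mx: "\<mm> ?x = \<beta>" using ipx_nonneg[OF d] ipx_eq_0[OF d] by simp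
  have RX: "rayleigh X ?x = ipx \<beta> \<beta>"
    unfolding moment_rayleigh[OF in_a_p[OF Xa], symmetric] mx by (simp add: ipx_sym[of \<beta> X] X\<beta>)
  have eX: "\<pi> X ?x = ipx \<beta> \<beta> *\<^sub>R ?x"
    by (rule parabolic_slope(2)[OF D a_p Xa p(1) parX' w rescaled_flow_tendsto[OF Xa Xge] RX])
  have "ipx X \<alpha> = ipx \<beta> \<beta>" if "\<alpha> \<in> supp w" for \<alpha>
    by (rule nice_parabolic_rigidity[OF W Xa D p(1) parX' eX Xge that])
  then show False using Xstrict by force
qed

end

theorem theorem3p14:
  fixes U G \<aa> :: "'n::finite cmat set"
    and \<tau> :: "'n cmat \<Rightarrow> 'v::euclidean_space \<Rightarrow> 'v"
    and ip :: "'n cmat \<Rightarrow> 'n cmat \<Rightarrow> real"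
    and w :: 'v
  assumes "real_reductive U G" and "real_algebraic G"
    and "rational_representation G \<tau>"
    and "compatible_inner_on_V U G \<tau>"
    and "compatible_inner_on_lie U G ip"
    and "maximal_subalgebra_in_p U G \<aa>"
    and "w \<noteq> 0" and "nice_element U G \<tau> ip \<aa> w"
  shows "(distinguished_orbit U G \<tau> ip ((\<lambda>g. \<tau> g w) ` G) \<longleftrightarrow>
            mcc ip (weight_support \<tau> ip \<aa> w) \<in> rel_interior (convex hull (weight_support \<tau> ip \<aa> w)))
       \<and> (distinguished_orbit U G \<tau> ip ((\<lambda>g. \<tau> g w) ` G) \<longrightarrow>
            (\<exists>X\<in>\<aa>. critical_point (moment_norm_sq U G \<tau> ip) (\<tau> (mexp X) w)))"
proof -
  interpret reductive_weights U G \<tau> ip \<aa>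
    using assms by unfold_locales (simp_all add: maximal_subalgebra_in_p_def)
  obtain W where W: "nice_space U G \<tau> ip \<aa> W" "w \<in> W"
    using assms(8) unfolding nice_element_def by blast
  let ?Orb = "(\<lambda>g. \<tau> g w) ` G"
  let ?int = "mcc ip (supp w) \<in> rel_interior (convex hull (supp w))"
  have 1: "?int" if "distinguished_orbit U G \<tau> ip ?Orb"
  proof -
    have "\<exists>g\<in>G. critical_point F (\<tau> g w)"
      using that unfolding distinguished_orbit_def by (simp only: bex_simps)
    then obtain g where "g \<in> G" "critical_point F (\<tau> g w)" by (elim bexE)
    then show ?thesis by (rule mcc_interior_of_distinguished[OF W \<open>w \<noteq> 0\<close>])
  qed
  have 2: "\<exists>X\<in>\<aa>. critical_point F (\<tau> (mexp X) w)" if "?int"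
    by (rule mcc_interior_imp_critical[OF W \<open>w \<noteq> 0\<close> that])
  have 3: "distinguished_orbit U G \<tau> ip ?Orb" if i: "?int"
  proof -
    obtain X where X: "X \<in> \<aa>" "critical_point F (\<tau> (mexp X) w)" using 2[OF i] by blast
    have "mexp X \<in> G" by (rule lie_mexp[OF in_a_g[OF X(1)]])
    then show ?thesis using X(2) unfolding distinguished_orbit_def by blast
  qed
  show ?thesis using 1 2 3 by blast
qed

end
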